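(* A net with no $\flat$-formulas in its conclusions is strongly indexable and sequentializable iff it is a proof net.
   Context: A net is a finite graph-like object whose nodes are links and whose directed edges are labelled by formulas or $\flat$-formulas, together with a set of boxes (each delimited by one of course link, its principal port, and pax links, its auxiliary ports, containing a net; boxes are disjoint or nested). Links: axiom (conclusions $A^\bot,A$), cut (premises $A,A^\bot$), one, bottom, tensor, par (conclusion $A\mathbin{⅋}B$), flat (premise $A$, conclusion $\flat A$), pax, why not (any number of premises $\flat A$, conclusion $?A$), of course, paragraph (premise $A$, conclusion $\S A$). An indexing is a map $I$ from edges to $\mathbb Z$ with equal index on both conclusions of an axiom and both premises of a cut, equal index on premises and conclusion of one, bottom, tensor, par, flat, pax, why not, of course links, and premise index $i+1$ when the conclusion of a paragraph link has index $i$; it is strong if all conclusions of the net get the same index. Sequentializable nets are defined inductively: the empty net, a single axiom, a single one link; the juxtaposition of two sequentializable nets; and the results of adding to sequentializable nets a cut between two of their conclusions $A,A^\bot$ from two different nets, a tensor on conclusions of two different nets, a bottom link, a par link on two conclusions of one net, a why not link on conclusions $\flat A,\ldots,\flat A$, a flat link, a paragraph link, or a box around a net with conclusions $\flat B_1,\ldots,\flat B_n,A$. A switching of a net is obtained from its underlying undirected graph by keeping exactly one premise of each par and why not link and collapsing each depth-zero box into a single node. A net is DR-correct if all its switchings are acyclic and the net inside each box is DR-correct. A DR-net is a DR-correct net with no $\flat$-formula among its conclusions. The $\mathbin{⅋}$-closure of a net with conclusions $A_1,\ldots,A_n$ is obtained by adding a tree of par links yielding the single conclusion $A_1\mathbin{⅋}\cdots\mathbin{⅋}A_n$.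 A cycle is balanced if it traverses paragraph links from premise to conclusion as many times as from conclusion to premise. A proof net is a DR-net whose $\mathbin{⅋}$-closure has all its cycles balanced. *)

theory Defs
  imports Main
begin

datatype 'a formula =
    Atom 'a
  | NegAtom 'a
  | One
  | Bottom
  | Tensor "'a formula" "'a formula"
  | Par "'a formula" "'a formula"
  | OfCourse "'a formula"
  | WhyNot "'a formula"
  | Paragraph "'a formula"

fun dual :: "'a formula \<Rightarrow> 'a formula" where
  "dual (Atom X) = NegAtom X"
| "dual (NegAtom X) = Atom X"
| "dual One = Bottom"
| "dual Bottom = One"
| "dual (Tensor A B) = Par (dual A) (dual B)"
| "dual (Par A B) = Tensor (dual A) (dual B)"
| "dual (OfCourse A) = WhyNot (dual A)"
| "dual (WhyNot A) = OfCourse (dual A)"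
| "dual (Paragraph A) = Paragraph (dual A)"

datatype 'a label = Formula "'a formula" | Flat "'a formula"

text \<open>An edge carries its label; the identifier distinguishes edges with equal labels.\<close>

datatype 'a edge = Edge (edge_id: nat) (label: "'a label")

text \<open>
  A link is given by its kind and its incident edges, premises before the conclusion. Since every
  link has an incident edge, and an edge of a net is a conclusion of one link and a premise of at
  most one link, distinct links of a net are distinct values of this type.
\<close>

datatype 'a link =
    AxLink "'a edge" "'a edge"
  | CutLink "'a edge" "'a edge"
  | OneLink "'a edge"
  | BottomLink "'a edge"
  | TensorLink "'a edge" "'a edge" "'a edge"
  | ParLink "'a edge" "'a edge" "'a edge"
  | FlatLink "'a edge" "'a edge"
  | PaxLink "'a edge" "'a edge"
  | WhyNotLink "'a edge set" "'a edge"
  | OfCourseLink "'a edge" "'a edge"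
  | ParagraphLink "'a edge" "'a edge"

fun prems :: "'a link \<Rightarrow> 'a edge set" where
  "prems (AxLink c d) = {}"
| "prems (CutLink a b) = {a, b}"
| "prems (OneLink c) = {}"
| "prems (BottomLink c) = {}"
| "prems (TensorLink a b c) = {a, b}"
| "prems (ParLink a b c) = {a, b}"
| "prems (FlatLink a c) = {a}"
| "prems (PaxLink a c) = {a}"
| "prems (WhyNotLink E c) = E"
| "prems (OfCourseLink a c) = {a}"
| "prems (ParagraphLink a c) = {a}"

fun concs :: "'a link \<Rightarrow> 'a edge set" where
  "concs (AxLink c d) = {c, d}"
| "concs (CutLink a b) = {}"
| "concs (OneLink c) = {c}"
| "concs (BottomLink c) = {c}"
| "concs (TensorLink a b c) = {c}"
| "concs (ParLink a b c) = {c}"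
| "concs (FlatLink a c) = {c}"
| "concs (PaxLink a c) = {c}"
| "concs (WhyNotLink E c) = {c}"
| "concs (OfCourseLink a c) = {c}"
| "concs (ParagraphLink a c) = {c}"

text \<open>The two premises of a tensor or par link must be different edges; for the two conclusions of
  an axiom and the two premises of a cut this is forced by the labels.\<close>

fun typed :: "'a link \<Rightarrow> bool" where
  "typed (AxLink c d) \<longleftrightarrow> (\<exists>A. label c = Formula (dual A) \<and> label d = Formula A)"
| "typed (CutLink a b) \<longleftrightarrow> (\<exists>A. label a = Formula A \<and> label b = Formula (dual A))"
| "typed (OneLink c) \<longleftrightarrow> label c = Formula One"
| "typed (BottomLink c) \<longleftrightarrow> label c = Formula Bottom"
| "typed (TensorLink a b c) \<longleftrightarrow> a \<noteq> b \<and>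
     (\<exists>A B. label a = Formula A \<and> label b = Formula B \<and> label c = Formula (Tensor A B))"
| "typed (ParLink a b c) \<longleftrightarrow> a \<noteq> b \<and>
     (\<exists>A B. label a = Formula A \<and> label b = Formula B \<and> label c = Formula (Par A B))"
| "typed (FlatLink a c) \<longleftrightarrow> (\<exists>A. label a = Formula A \<and> label c = Flat A)"
| "typed (PaxLink a c) \<longleftrightarrow> (\<exists>A. label a = Flat A \<and> label c = Flat A)"
| "typed (WhyNotLink E c) \<longleftrightarrow> finite E \<and>
     (\<exists>A. (\<forall>a\<in>E. label a = Flat A) \<and> label c = Formula (WhyNot A))"
| "typed (OfCourseLink a c) \<longleftrightarrow> (\<exists>A. label a = Formula A \<and> label c = Formula (OfCourse A))"
| "typed (ParagraphLink a c) \<longleftrightarrow> (\<exists>A. label a = Formula A \<and> label c = Formula (Paragraph A))"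

text \<open>The content of a box does not include its ports.\<close>

datatype 'a box = Box (principal: "'a link") (auxiliary: "'a link set") (content: "'a link set")

definition ports :: "'a box \<Rightarrow> 'a link set" where
  "ports b = insert (principal b) (auxiliary b)"

definition box_links :: "'a box \<Rightarrow> 'a link set" where
  "box_links b = ports b \<union> content b"

datatype 'a net = Net (links: "'a link set") (boxes: "'a box set")

definition edges_of :: "'a link set \<Rightarrow> 'a edge set" where
  "edges_of L = \<Union>(prems ` L) \<union> \<Union>(concs ` L)"

definition conclusions_of :: "'a link set \<Rightarrow> 'a edge set" where
  "conclusions_of L = edges_of L - \<Union>(prems ` L)"

abbreviation edges :: "'a net \<Rightarrow> 'a edge set" where
  "edges N \<equiv> edges_of (links N)"

abbreviation conclusions :: "'a net \<Rightarrow> 'a edge set" where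
  "conclusions N \<equiv> conclusions_of (links N)"

definition net_graph :: "'a link set \<Rightarrow> bool" where
  "net_graph L \<longleftrightarrow> finite L \<and> (\<forall>l\<in>L. typed l) \<and>
     (\<forall>e\<in>edges_of L. \<exists>!l. l \<in> L \<and> e \<in> concs l) \<and>
     (\<forall>l\<in>L. \<forall>m\<in>L. prems l \<inter> prems m \<noteq> {} \<longrightarrow> l = m)"

definition delimits_box :: "'a link set \<Rightarrow> 'a box \<Rightarrow> bool" where
  "delimits_box L b \<longleftrightarrow> box_links b \<subseteq> L \<and>
     (\<exists>a c. principal b = OfCourseLink a c) \<and>
     (\<forall>l\<in>auxiliary b. \<exists>a c. l = PaxLink a c) \<and>
     ports b \<inter> content b = {} \<and>
     net_graph (content b) \<and>
     conclusions_of (content b) = \<Union>(prems ` ports b)"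

definition is_net :: "'a net \<Rightarrow> bool" where
  "is_net N \<longleftrightarrow> net_graph (links N) \<and>
     (\<forall>b\<in>boxes N. delimits_box (links N) b) \<and>
     (\<forall>a c. OfCourseLink a c \<in> links N \<longrightarrow> (\<exists>!b. b \<in> boxes N \<and> OfCourseLink a c = principal b)) \<and>
     (\<forall>a c. PaxLink a c \<in> links N \<longrightarrow> (\<exists>!b. b \<in> boxes N \<and> PaxLink a c \<in> auxiliary b)) \<and>
     (\<forall>b\<in>boxes N. \<forall>b'\<in>boxes N. b \<noteq> b' \<longrightarrow>
        box_links b \<inter> box_links b' = {} \<or>
        box_links b \<subseteq> content b' \<or> box_links b' \<subseteq> content b)"

definition flat_free_conclusions :: "'a net \<Rightarrow> bool" where
  "flat_free_conclusions N \<longleftrightarrow> (\<forall>e\<in>conclusions N. \<exists>A. label e = Formula A)"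

definition box_net :: "'a net \<Rightarrow> 'a box \<Rightarrow> 'a net" where
  "box_net N b = Net (content b) {c \<in> boxes N. box_links c \<subseteq> content b}"

fun index_constraint :: "('a edge \<Rightarrow> int) \<Rightarrow> 'a link \<Rightarrow> bool" where
  "index_constraint I (ParagraphLink a c) \<longleftrightarrow> I a = I c + 1"
| "index_constraint I l \<longleftrightarrow> (\<forall>e \<in> prems l \<union> concs l. \<forall>e' \<in> prems l \<union> concs l. I e = I e')"

definition indexing :: "'a net \<Rightarrow> ('a edge \<Rightarrow> int) \<Rightarrow> bool" where
  "indexing N I \<longleftrightarrow> (\<forall>l\<in>links N. index_constraint I l)"

definition strong_indexing :: "'a net \<Rightarrow> ('a edge \<Rightarrow> int) \<Rightarrow> bool" where
  "strong_indexing N I \<longleftrightarrow> indexing N I \<and> (\<forall>e\<in>conclusions N. \<forall>e'\<in>conclusions N. I e = I e')"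

definition strongly_indexable :: "'a net \<Rightarrow> bool" where
  "strongly_indexable N \<longleftrightarrow> (\<exists>I. strong_indexing N I)"

definition juxtapose :: "'a net \<Rightarrow> 'a net \<Rightarrow> 'a net" where
  "juxtapose M N = Net (links M \<union> links N) (boxes M \<union> boxes N)"

definition add_link :: "'a link \<Rightarrow> 'a net \<Rightarrow> 'a net" where
  "add_link l N = Net (insert l (links N)) (boxes N)"

text \<open>In the box rule, \<open>E\<close> is the set of edges labelled \<open>\<flat>B\<^sub>1, \<dots>, \<flat>B\<^sub>n\<close>, and \<open>f\<close> gives for each of
  them the conclusion of the pax link placed below it.\<close>

inductive sequentializable :: "'a net \<Rightarrow> bool" where
  empty: "sequentializable (Net {} {})"
| ax: "typed (AxLink c d) \<Longrightarrow> sequentializable (Net {AxLink c d} {})"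
| one: "typed (OneLink c) \<Longrightarrow> sequentializable (Net {OneLink c} {})"
| juxtaposition:
    "\<lbrakk>sequentializable M; sequentializable N; edges M \<inter> edges N = {}\<rbrakk>
     \<Longrightarrow> sequentializable (juxtapose M N)"
| cut:
    "\<lbrakk>sequentializable M; sequentializable N; edges M \<inter> edges N = {};
      a \<in> conclusions M; b \<in> conclusions N; typed (CutLink a b)\<rbrakk>
     \<Longrightarrow> sequentializable (add_link (CutLink a b) (juxtapose M N))"
| tensor:
    "\<lbrakk>sequentializable M; sequentializable N; edges M \<inter> edges N = {};
      a \<in> conclusions M; b \<in> conclusions N; c \<notin> edges M \<union> edges N; typed (TensorLink a b c)\<rbrakk>
     \<Longrightarrow> sequentializable (add_link (TensorLink a b c) (juxtapose M N))"
| bottom: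
    "\<lbrakk>sequentializable N; c \<notin> edges N; typed (BottomLink c)\<rbrakk>
     \<Longrightarrow> sequentializable (add_link (BottomLink c) N)"
| par:
    "\<lbrakk>sequentializable N; a \<in> conclusions N; b \<in> conclusions N; c \<notin> edges N;
      typed (ParLink a b c)\<rbrakk>
     \<Longrightarrow> sequentializable (add_link (ParLink a b c) N)"
| why_not:
    "\<lbrakk>sequentializable N; E \<subseteq> conclusions N; c \<notin> edges N; typed (WhyNotLink E c)\<rbrakk>
     \<Longrightarrow> sequentializable (add_link (WhyNotLink E c) N)"
| flat:
    "\<lbrakk>sequentializable N; a \<in> conclusions N; c \<notin> edges N; typed (FlatLink a c)\<rbrakk>
     \<Longrightarrow> sequentializable (add_link (FlatLink a c) N)"
| para:
    "\<lbrakk>sequentializable N; a \<in> conclusions N; c \<notin> edges N; typed (ParagraphLink a c)\<rbrakk>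
     \<Longrightarrow> sequentializable (add_link (ParagraphLink a c) N)"
| box:
    "\<lbrakk>sequentializable N; conclusions N = insert a E;
      c \<notin> edges N; typed (OfCourseLink a c);
      inj_on f E; f ` E \<inter> edges N = {}; c \<notin> f ` E; \<forall>e\<in>E. typed (PaxLink e (f e));
      p = OfCourseLink a c; P = (\<lambda>e. PaxLink e (f e)) ` E\<rbrakk>
     \<Longrightarrow> sequentializable (Net (insert p P \<union> links N) (insert (Box p P (links N)) (boxes N)))"

text \<open>
  An undirected multigraph is given by a set of triples \<open>(u, e, v)\<close>, the edge \<open>e\<close> joining \<open>u\<close> and
  \<open>v\<close>; isolated nodes and edges with a free end are left out, being on no cycle. A cycle is listed
  by its successive steps, the last one returning to the source of the first; it repeats neither
  nodes nor edges, but may consist of one loop or of two parallel edges.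
\<close>

definition step_source :: "'v \<times> 'e \<times> 'v \<Rightarrow> 'v" where "step_source = fst"
definition step_edge :: "'v \<times> 'e \<times> 'v \<Rightarrow> 'e" where "step_edge = fst \<circ> snd"
definition step_target :: "'v \<times> 'e \<times> 'v \<Rightarrow> 'v" where "step_target = snd \<circ> snd"

definition cycle :: "('v \<times> 'e \<times> 'v) set \<Rightarrow> ('v \<times> 'e \<times> 'v) list \<Rightarrow> bool" where
  "cycle G p \<longleftrightarrow> p \<noteq> [] \<and>
     (\<forall>(u, e, v) \<in> set p. (u, e, v) \<in> G \<or> (v, e, u) \<in> G) \<and>
     (\<forall>i < length p. step_target (p ! i) = step_source (p ! (Suc i mod length p))) \<and>
     distinct (map step_source p) \<and> distinct (map step_edge p)"

definition outermost_boxes :: "'a net \<Rightarrow> 'a box set" where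
  "outermost_boxes N = {b \<in> boxes N. \<forall>b'\<in>boxes N. \<not> box_links b \<subseteq> content b'}"

datatype 'a node = LinkNode "'a link" | BoxNode "'a box"

fun collapses_to :: "'a net \<Rightarrow> 'a link \<Rightarrow> 'a node \<Rightarrow> bool" where
  "collapses_to N l (LinkNode k) \<longleftrightarrow> k = l \<and> l \<in> links N \<and> (\<forall>b\<in>boxes N. l \<notin> box_links b)"
| "collapses_to N l (BoxNode b) \<longleftrightarrow> b \<in> outermost_boxes N \<and> l \<in> box_links b"

fun switched :: "'a link \<Rightarrow> bool" where
  "switched (ParLink a b c) = True"
| "switched (WhyNotLink E c) = True"
| "switched _ = False"

definition switching_choice :: "'a net \<Rightarrow> ('a link \<Rightarrow> 'a edge) \<Rightarrow> bool" where
  "switching_choice N s \<longleftrightarrow>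
     (\<forall>l\<in>links N. switched l \<and> prems l \<noteq> {} \<longrightarrow> s l \<in> prems l)"

definition switching :: "'a net \<Rightarrow> ('a link \<Rightarrow> 'a edge) \<Rightarrow> ('a node \<times> 'a edge \<times> 'a node) set" where
  "switching N s =
     {(x, e, y). (\<exists>l m. collapses_to N l x \<and> collapses_to N m y \<and>
                        e \<in> concs l \<and> e \<in> prems m \<and> (switched m \<longrightarrow> e = s m)) \<and>
                 \<not> (\<exists>b. x = BoxNode b \<and> y = BoxNode b)}"

inductive DR_correct :: "'a net \<Rightarrow> bool" where
  "\<lbrakk>\<And>s. switching_choice N s \<Longrightarrow> \<nexists>p. cycle (switching N s) p;
    \<And>b. b \<in> boxes N \<Longrightarrow> DR_correct (box_net N b)\<rbrakk>
   \<Longrightarrow> DR_correct N"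

definition DR_net :: "'a net \<Rightarrow> bool" where
  "DR_net N \<longleftrightarrow> is_net N \<and> DR_correct N \<and> flat_free_conclusions N"

text \<open>The \<open>\<parr>\<close>-closure is determined up to the shape of the tree of par links and the names of the
  added edges. A net with at most one conclusion is its own closure.\<close>

inductive par_closure :: "'a net \<Rightarrow> 'a net \<Rightarrow> bool" where
  closed: "\<forall>e\<in>conclusions N. \<forall>e'\<in>conclusions N. e = e' \<Longrightarrow> par_closure N N"
| step:
    "\<lbrakk>a \<in> conclusions N; b \<in> conclusions N; c \<notin> edges N; typed (ParLink a b c);
      par_closure (add_link (ParLink a b c) N) C\<rbrakk>
     \<Longrightarrow> par_closure N C"

definition underlying_graph :: "'a net \<Rightarrow> ('a link \<times> 'a edge \<times> 'a link) set" where
  "underlying_graph N = {(l, e, m). l \<in> links N \<and> m \<in> links N \<and> e \<in> concs l \<and> e \<in> prems m}"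

text \<open>The positions at which a cycle enters a paragraph link by its premise and leaves it by its
  conclusion; then the other way round.\<close>

definition downward_traversals :: "('a link \<times> 'a edge \<times> 'a link) list \<Rightarrow> nat set" where
  "downward_traversals p = {i. i < length p \<and>
     step_target (p ! i) =
       ParagraphLink (step_edge (p ! i)) (step_edge (p ! (Suc i mod length p)))}"

definition upward_traversals :: "('a link \<times> 'a edge \<times> 'a link) list \<Rightarrow> nat set" where
  "upward_traversals p = {i. i < length p \<and>
     step_target (p ! i) =
       ParagraphLink (step_edge (p ! (Suc i mod length p))) (step_edge (p ! i))}"

definition balanced :: "('a link \<times> 'a edge \<times> 'a link) list \<Rightarrow> bool" where
  "balanced p \<longleftrightarrow> card (downward_traversals p) = card (upward_traversals p)"

definition proof_net :: "'a net \<Rightarrow> bool" where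
  "proof_net N \<longleftrightarrow> DR_net N \<and>
     (\<exists>C. par_closure N C \<and> (\<forall>p. cycle (underlying_graph C) p \<longrightarrow> balanced p))"

end

theory Submission
  imports Defs "HOL-Library.Disjoint_Sets"
begin

text \<open>
  The switching graphs at depth zero are handled as one graph in which two premises of the same
  par or why not link form a cusp: the switchings are acyclic iff every cycle has a cusp. As in
  Yeo's theorem, a strict order on the edges, given by cusp-free paths that no cusp-free
  continuation can meet again, has a maximal element; its target is a terminal link, and either two
  of the premises of this link form a cusp or the maximal edge is a bridge. Peeling off such a link
  sequentializes the net.

  For the indexings, the \<open>\<section>\<close>-links put weights on the edges of the underlying graph, an
  indexing is a potential for these weights, and a potential exists iff every cycle has weight zero,
  i.e. is balanced. The \<open>\<parr>\<close>-closure forces the conclusions to have equal indices.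
\<close>

section \<open>Walks and cycles in multigraphs\<close>

(* Otherwise simp splits quantified steps and the facts about their projections no longer match. *)
declare split_paired_All [simp del] split_paired_Ex [simp del]

definition rev_step :: "'v \<times> 'e \<times> 'v \<Rightarrow> 'v \<times> 'e \<times> 'v" where
  "rev_step s = (step_target s, step_edge s, step_source s)"

lemma step_simps [simp]:
  "step_source (u, e, v) = u" "step_edge (u, e, v) = e" "step_target (u, e, v) = v"
  "step_source (rev_step s) = step_target s" "step_edge (rev_step s) = step_edge s"
  "step_target (rev_step s) = step_source s" "rev_step (rev_step s) = s"
  "rev_step (u, e, v) = (v, e, u)"
  by (simp_all add: step_source_def step_edge_def step_target_def rev_step_def)

lemma rev_step_eq_iff: "rev_step s = t \<longleftrightarrow> s = rev_step t"
  by auto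

definition sym_steps :: "('v \<times> 'e \<times> 'v) set \<Rightarrow> ('v \<times> 'e \<times> 'v) set" where
  "sym_steps G = {s. s \<in> G \<or> rev_step s \<in> G}"

lemma in_sym_steps: "s \<in> sym_steps G \<longleftrightarrow> s \<in> G \<or> rev_step s \<in> G"
  by (simp add: sym_steps_def)

lemma rev_step_sym_steps [simp]: "rev_step s \<in> sym_steps G \<longleftrightarrow> s \<in> sym_steps G"
  by (auto simp: in_sym_steps)

lemma sym_steps_mono: "G \<subseteq> H \<Longrightarrow> sym_steps G \<subseteq> sym_steps H"
  by (auto simp: sym_steps_def)

lemma sym_steps_eq_or_rev:
  assumes inj: "inj_on step_edge G"
    and st: "s \<in> sym_steps G" "t \<in> sym_steps G" "step_edge s = step_edge t"
  shows "s = t \<or> s = rev_step t"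
proof -
  have "x = y" if "x \<in> G" "y \<in> G" "step_edge x = step_edge y" for x y
    using inj that by (simp add: inj_on_eq_iff)
  from this[of s t] this[of s "rev_step t"] this[of "rev_step s" t]
    this[of "rev_step s" "rev_step t"]
  show ?thesis
    using st rev_step_eq_iff[of s t] rev_step_eq_iff[of s "rev_step t"] by (auto simp: in_sym_steps)
qed

subsection \<open>Walks\<close>

fun walk :: "'v \<Rightarrow> ('v \<times> 'e \<times> 'v) list \<Rightarrow> 'v \<Rightarrow> bool" where
  "walk u [] v \<longleftrightarrow> u = v"
| "walk u (s # p) v \<longleftrightarrow> step_source s = u \<and> walk (step_target s) p v"

definition reversed :: "('v \<times> 'e \<times> 'v) list \<Rightarrow> ('v \<times> 'e \<times> 'v) list" where
  "reversed p = rev (map rev_step p)"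

lemma reversed_simps [simp]:
  "reversed [] = []" "reversed (s # p) = reversed p @ [rev_step s]" "reversed p = [] \<longleftrightarrow> p = []"
  "p \<noteq> [] \<Longrightarrow> hd (reversed p) = rev_step (last p)" "p \<noteq> [] \<Longrightarrow> last (reversed p) = rev_step (hd p)"
  "map step_source (reversed p) = rev (map step_target p)" "reversed (reversed p) = p"
  by (auto simp: reversed_def hd_rev last_rev last_map hd_map rev_map o_def)

lemma set_reversed_subset_sym_steps [simp]: "set (reversed p) \<subseteq> sym_steps G \<longleftrightarrow> set p \<subseteq> sym_steps G"
  unfolding reversed_def set_rev set_map image_subset_iff rev_step_sym_steps by blast

definition sources :: "('v \<times> 'e \<times> 'v) list \<Rightarrow> 'v set" where
  "sources p = step_source ` set p"

definition targets :: "('v \<times> 'e \<times> 'v) list \<Rightarrow> 'v set" where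
  "targets p = step_target ` set p"

lemma sources_simps [simp]:
  "sources [] = {}" "sources (s # p) = insert (step_source s) (sources p)"
  "sources (p @ q) = sources p \<union> sources q" "sources (reversed p) = targets p"
  by (auto simp: sources_def targets_def reversed_def image_image)

lemma targets_simps [simp]:
  "targets [] = {}" "targets (s # p) = insert (step_target s) (targets p)"
  "targets (p @ q) = targets p \<union> targets q"
  by (auto simp: targets_def)

lemma image_source_set [simp]: "step_source ` set p = sources p"
  by (simp add: sources_def)

lemma image_target_set [simp]: "step_target ` set p = targets p"
  by (simp add: targets_def)

lemma in_sources_iff: "v \<in> sources p \<longleftrightarrow> (\<exists>s\<in>set p. step_source s = v)"
  unfolding sources_def image_iff by metis

lemma in_targets_iff: "v \<in> targets p \<longleftrightarrow> (\<exists>s\<in>set p. step_target s = v)"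
  unfolding targets_def image_iff by metis

lemma source_in_sources: "s \<in> set p \<Longrightarrow> step_source s \<in> sources p"
  unfolding sources_def by (rule imageI)

lemma target_in_targets: "s \<in> set p \<Longrightarrow> step_target s \<in> targets p"
  unfolding targets_def by (rule imageI)

lemma walk_append: "walk u (p @ q) v \<longleftrightarrow> (\<exists>w. walk u p w \<and> walk w q v)"
  by (induction p arbitrary: u) auto

lemma walk_reversed [simp]: "walk v (reversed p) u \<longleftrightarrow> walk u p v"
  by (induction p arbitrary: u v) (auto simp: walk_append)

lemma walk_vertices: "walk u p v \<Longrightarrow> map step_source p @ [v] = u # map step_target p"
  by (induction p arbitrary: u) auto

lemma walk_vertex_set: "walk u p v \<Longrightarrow> insert v (sources p) = insert u (targets p)"
  by (drule walk_vertices) (drule arg_cong[of _ _ set], simp)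

lemma walk_hd: "walk u p v \<Longrightarrow> p \<noteq> [] \<Longrightarrow> step_source (hd p) = u"
  by (cases p) auto

lemma walk_last: "walk u p v \<Longrightarrow> p \<noteq> [] \<Longrightarrow> step_target (last p) = v"
  by (induction p arbitrary: u) auto

abbreviation linked :: "'v \<times> 'e \<times> 'v \<Rightarrow> 'v \<times> 'e \<times> 'v \<Rightarrow> bool" where
  "linked s t \<equiv> step_target s = step_source t"

lemma walk_iff_successively_linked:
  "p \<noteq> [] \<Longrightarrow> walk u p v \<longleftrightarrow> successively linked p \<and> step_source (hd p) = u \<and> step_target (last p) = v"
proof (induction p arbitrary: u)
  case (Cons s p)
  show ?case
    using Cons.IH[of "step_target s"] by (cases "p = []") (auto simp: successively_Cons)
qed simp

definition connected_in :: "('v \<times> 'e \<times> 'v) set \<Rightarrow> 'v \<Rightarrow> 'v \<Rightarrow> bool" where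
  "connected_in G u v \<longleftrightarrow> (\<exists>p. set p \<subseteq> sym_steps G \<and> walk u p v)"

lemma connected_in_refl: "connected_in G u u"
  unfolding connected_in_def by (intro exI[of _ "[]"]) simp

lemma connected_in_step: "s \<in> sym_steps G \<Longrightarrow> connected_in G (step_source s) (step_target s)"
  unfolding connected_in_def by (intro exI[of _ "[s]"]) simp

lemma connected_in_sym:
  assumes "connected_in G u v"
  shows "connected_in G v u"
proof -
  obtain p where "set p \<subseteq> sym_steps G" "walk u p v"
    using assms unfolding connected_in_def by blast
  then have "set (reversed p) \<subseteq> sym_steps G \<and> walk v (reversed p) u" by simp
  then show ?thesis unfolding connected_in_def ..
qed

lemma connected_in_trans:
  assumes "connected_in G u v" "connected_in G v w"
  shows "connected_in G u w"
proof -
  obtain p q where "set p \<subseteq> sym_steps G" "walk u p v" "set q \<subseteq> sym_steps G" "walk v q w"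
    using assms unfolding connected_in_def by blast
  then have "set (p @ q) \<subseteq> sym_steps G \<and> walk u (p @ q) w" by (auto simp: walk_append)
  then show ?thesis unfolding connected_in_def ..
qed

lemma connected_in_invariant:
  assumes "connected_in G u v" and inv: "\<And>s. s \<in> G \<Longrightarrow> P (step_source s) \<longleftrightarrow> P (step_target s)"
  shows "P u \<longleftrightarrow> P v"
proof -
  obtain p where "set p \<subseteq> sym_steps G" "walk u p v"
    using assms(1) unfolding connected_in_def by blast
  then show ?thesis
  proof (induction p arbitrary: u)
    case (Cons s p)
    have "P (step_source s) \<longleftrightarrow> P (step_target s)"
      using Cons.prems(1) inv[of s] inv[of "rev_step s"] by (simp add: in_sym_steps) blast
    moreover have "P (step_target s) \<longleftrightarrow> P v"
      using Cons by simp
    ultimately show ?case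
      using Cons.prems(2) by simp
  qed simp
qed

subsection \<open>Simple paths\<close>

definition simple_path ::
  "('v \<times> 'e \<times> 'v) set \<Rightarrow> 'v \<Rightarrow> ('v \<times> 'e \<times> 'v) list \<Rightarrow> 'v \<Rightarrow> bool" where
  "simple_path G u p v \<longleftrightarrow> set p \<subseteq> sym_steps G \<and> walk u p v \<and> distinct (map step_source p) \<and>
     v \<notin> sources p"

lemma simple_path_Nil [simp]: "simple_path G u [] v \<longleftrightarrow> u = v"
  by (simp add: simple_path_def)

lemma simple_path_Cons:
  "simple_path G u (s # p) v \<longleftrightarrow> s \<in> sym_steps G \<and> step_source s = u \<and>
     simple_path G (step_target s) p v \<and> u \<notin> insert v (sources p)"
  by (auto simp: simple_path_def)

lemma simple_path_append:
  "simple_path G u (p @ q) v \<longleftrightarrow> (\<exists>w. simple_path G u p w \<and> simple_path G w q v \<and>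
     sources p \<inter> insert v (sources q) = {})"
proof -
  have "simple_path G u (p @ q) v \<longleftrightarrow> (\<exists>w. set p \<subseteq> sym_steps G \<and> walk u p w \<and> simple_path G w q v \<and>
      distinct (map step_source p) \<and> sources p \<inter> insert v (sources q) = {})"
    by (auto simp: simple_path_def walk_append)
  moreover have "w \<in> insert v (sources q)" if "simple_path G w q v" for w
    using walk_vertex_set[of w q v] that unfolding simple_path_def by blast
  ultimately show ?thesis
    unfolding simple_path_def[of G u p] by (simp cong: conj_cong) (metis disjoint_iff)
qed

lemma simple_path_reversed [simp]: "simple_path G v (reversed p) u \<longleftrightarrow> simple_path G u p v"
proof -
  have "distinct (map step_source p) \<and> v \<notin> sources p \<longleftrightarrow> distinct (map step_target p) \<and> u \<notin> targets p"
    if "walk u p v"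
    using arg_cong[OF walk_vertices[OF that], of distinct] by auto
  then show ?thesis
    by (auto simp: simple_path_def)
qed

lemma simple_path_distinct_edges:
  assumes "inj_on step_edge G" "simple_path G u p v"
  shows "distinct (map step_edge p)"
  using assms(2)
proof (induction p arbitrary: u)
  case (Cons s p)
  have s: "s \<in> sym_steps G" "step_source s \<notin> insert v (sources p)"
    and p: "simple_path G (step_target s) p v"
    using Cons.prems by (auto simp: simple_path_Cons)
  have "step_edge s \<noteq> step_edge t" if t: "t \<in> set p" for t
  proof
    assume "step_edge s = step_edge t"
    then have "s = t \<or> s = rev_step t"
      using sym_steps_eq_or_rev[OF assms(1) s(1), of t] p t by (auto simp: simple_path_def)
    then show False
    proof
      assume "s = t"
      then show False using s(2) source_in_sources[OF t] by simp
    next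
      assume "s = rev_step t"
      then have "step_source s \<in> targets p" using target_in_targets[OF t] by simp
      then show False
        using s(2) p walk_vertex_set[of "step_target s" p v] by (auto simp: simple_path_def)
    qed
  qed
  then show ?case
    using Cons.IH[OF p] by auto
qed simp

lemma connected_in_imp_simple_path:
  assumes "connected_in G u v"
  obtains p where "simple_path G u p v"
proof -
  obtain p where "set p \<subseteq> sym_steps G" "walk u p v"
    using assms unfolding connected_in_def by blast
  then have "\<exists>p. simple_path G u p v"
  proof (induction p arbitrary: u)
    case Nil
    then show ?case by (intro exI[of _ "[]"]) simp
  next
    case (Cons s p)
    then obtain q where q: "simple_path G (step_target s) q v" by auto
    show ?case
    proof (cases "u \<in> insert v (sources q)")
      case True
      then consider (target) "u = v" | (source) t where "t \<in> set q" "step_source t = u"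
        by (auto simp: in_sources_iff)
      then show ?thesis
      proof cases
        case target
        then show ?thesis by (intro exI[of _ "[]"]) simp
      next
        case (source t)
        then obtain q1 q2 where "q = q1 @ t # q2" by (metis split_list)
        then have "simple_path G u (t # q2) v"
          using q source by (auto simp: simple_path_append simple_path_Cons)
        then show ?thesis ..
      qed
    next
      case False
      then have "simple_path G u (s # q) v"
        using q Cons.prems by (auto simp: simple_path_Cons)
      then show ?thesis ..
    qed
  qed
  then show thesis using that by blast
qed

subsection \<open>Simple circuits and cycles\<close>

definition cyclically :: "('s \<Rightarrow> 's \<Rightarrow> bool) \<Rightarrow> 's list \<Rightarrow> bool" where
  "cyclically R p \<longleftrightarrow> p \<noteq> [] \<and> successively R p \<and> R (last p) (hd p)"

lemma cyclically_rotate: "cyclically R (p @ q) \<Longrightarrow> cyclically R (q @ p)"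
  by (cases "p = []"; cases "q = []") (auto simp: cyclically_def successively_append_iff)

lemma cyclically_conv_nth:
  "cyclically R p \<longleftrightarrow> p \<noteq> [] \<and> (\<forall>i < length p. R (p ! i) (p ! (Suc i mod length p)))"
proof (cases p rule: rev_cases)
  case (snoc q s)
  have "(\<forall>i < length p. Q i) \<longleftrightarrow> (\<forall>i < length q. Q i) \<and> Q (length q)" for Q
    by (auto simp: snoc less_Suc_eq)
  then show ?thesis
    by (simp add: cyclically_def successively_conv_nth snoc nth_append hd_conv_nth)
qed (simp add: cyclically_def)

lemma cyclically_linked_iff_walk:
  "cyclically linked p \<longleftrightarrow> p \<noteq> [] \<and> walk (step_source (hd p)) p (step_source (hd p))"
  by (auto simp: cyclically_def walk_iff_successively_linked)

definition simple_circuit :: "('v \<times> 'e \<times> 'v) set \<Rightarrow> ('v \<times> 'e \<times> 'v) list \<Rightarrow> bool" where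
  "simple_circuit G p \<longleftrightarrow> set p \<subseteq> sym_steps G \<and> cyclically linked p \<and> distinct (map step_source p)"

lemma cycle_iff_simple_circuit:
  "cycle G p \<longleftrightarrow> simple_circuit G p \<and> distinct (map step_edge p)"
proof -
  have "(\<forall>(u, e, v) \<in> set p. (u, e, v) \<in> G \<or> (v, e, u) \<in> G) \<longleftrightarrow> set p \<subseteq> sym_steps G"
    by (force simp: sym_steps_def)
  then show ?thesis
    by (auto simp: cycle_def simple_circuit_def cyclically_conv_nth)
qed

lemma simple_circuit_rotate: "simple_circuit G (p @ q) \<Longrightarrow> simple_circuit G (q @ p)"
  by (auto simp: simple_circuit_def intro: cyclically_rotate)

lemma cycle_rotate: "cycle G (p @ q) \<Longrightarrow> cycle G (q @ p)"
  by (auto simp: cycle_iff_simple_circuit intro: simple_circuit_rotate)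

lemma cycle_mono: "cycle G p \<Longrightarrow> G \<subseteq> H \<Longrightarrow> cycle H p"
  unfolding cycle_def by fast

lemma simple_circuit_targets:
  assumes "simple_circuit G p"
  shows "map step_target p = rotate1 (map step_source p)" "targets p = sources p"
proof -
  obtain s q where p: "p = s # q" "walk (step_source s) p (step_source s)"
    using assms unfolding simple_circuit_def cyclically_linked_iff_walk by (metis list.exhaust_sel)
  then show "map step_target p = rotate1 (map step_source p)"
    using walk_vertices[OF p(2)] by simp
  from arg_cong[OF this, of set] show "targets p = sources p"
    by simp
qed

lemma simple_circuit_snoc:
  "simple_circuit G (p @ [s]) \<longleftrightarrow> s \<in> sym_steps G \<and> simple_path G (step_target s) p (step_source s)"
  by (cases p)
    (auto simp: simple_circuit_def simple_path_def cyclically_linked_iff_walk walk_append)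

lemma simple_circuit_append:
  assumes "p \<noteq> []" "q \<noteq> []"
  shows "simple_circuit G (p @ q) \<longleftrightarrow>
     simple_path G (step_source (hd p)) p (step_source (hd q)) \<and>
     simple_path G (step_source (hd q)) q (step_source (hd p)) \<and>
     sources p \<inter> sources q = {}"
proof -
  let ?u = "step_source (hd p)" and ?v = "step_source (hd q)"
  have "?v \<notin> sources p \<and> ?u \<notin> sources q"
    if "sources p \<inter> sources q = {}"
    using that source_in_sources[OF hd_in_set[OF assms(1)]]
      source_in_sources[OF hd_in_set[OF assms(2)]]
    by blast
  moreover have "walk ?u (p @ q) ?u \<longleftrightarrow> walk ?u p ?v \<and> walk ?v q ?u"
    unfolding walk_append using walk_hd[OF _ assms(2)] by metis
  ultimately show ?thesis
    using assms
    by (auto simp: simple_circuit_def simple_path_def cyclically_linked_iff_walk)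
qed

lemma cycleI:
  assumes inj: "inj_on step_edge G"
    and p: "simple_circuit G p" "step_edge (last p) \<noteq> step_edge (hd p)"
  shows "cycle G p"
proof -
  obtain q s where qs: "p = q @ [s]" "s \<in> sym_steps G"
    and q: "simple_path G (step_target s) q (step_source s)"
    using p(1) simple_circuit_snoc by (metis simple_circuit_def cyclically_def rev_exhaust)
  have source_neq: "step_source t \<noteq> step_source s" if "t \<in> set q" for t
    using q source_in_sources[OF that] by (auto simp: simple_path_def)
  have "step_edge s \<noteq> step_edge t" if t: "t \<in> set q" for t
  proof
    assume "step_edge s = step_edge t"
    then have "t = s \<or> t = rev_step s"
      using sym_steps_eq_or_rev[OF inj, of t s] q t qs(2) by (auto simp: simple_path_def)
    then have "step_source t = step_target s"
      using source_neq[OF t] by auto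
    moreover have "q \<noteq> []" using t by auto
    moreover have "step_source (hd q) = step_target s"
      using q walk_hd[of "step_target s" q "step_source s"] \<open>q \<noteq> []\<close>
      by (simp add: simple_path_def)
    ultimately have "step_source t = step_source (hd q)" "hd q \<in> set q" by simp_all
    moreover have "inj_on step_source (set q)"
      using q by (simp add: simple_path_def distinct_map)
    ultimately have "hd q = t"
      using t inj_on_eq_iff[of step_source "set q" "hd q" t] by simp
    then show False
      using p(2) \<open>step_edge s = step_edge t\<close> \<open>q \<noteq> []\<close> unfolding qs(1) by simp
  qed
  then have "step_edge s \<notin> step_edge ` set q"
    by (simp add: image_iff)
  then show ?thesis
    using p(1) simple_path_distinct_edges[OF inj q] by (simp add: cycle_iff_simple_circuit qs(1))
qed

lemma simple_circuit_ear:
  assumes circuit: "simple_circuit G (p @ q @ r)" and ne: "q \<noteq> []" "r \<noteq> []"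
    and ear: "simple_path G (step_source (hd r)) x (step_source (hd q))"
    and interior: "sources x \<inter> sources (p @ q @ r) \<subseteq> {step_source (hd r)}"
  shows "simple_circuit G (q @ x)" "simple_circuit G (p @ reversed x @ r)"
proof -
  let ?u = "step_source (hd q)" and ?v = "step_source (hd r)"
  have "simple_circuit G (q @ r @ p)"
    using simple_circuit_rotate[of G p "q @ r"] circuit by simp
  then have q: "simple_path G ?u q ?v" and rp: "simple_path G ?v (r @ p) ?u"
    using simple_circuit_append[of q "r @ p" G] ne by auto
  have uv: "?v \<notin> sources q" "?u \<in> sources q"
    using q ne source_in_sources[of "hd q" q] by (simp_all add: simple_path_def)
  then have x: "x \<noteq> []"
    using ear by (cases x) auto
  have hd_x: "step_source (hd x) = ?v" "step_source (hd (reversed x)) = ?u"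
    using ear x walk_hd[of ?v x ?u] walk_last[of ?v x ?u] by (simp_all add: simple_path_def)
  have "sources q \<inter> sources x = {}"
    using interior uv by auto
  then show "simple_circuit G (q @ x)"
    using simple_circuit_append[of q x G] ne x hd_x q ear by simp
  have "simple_path G ?u (reversed x) ?v"
    using ear by simp
  then have "?v \<notin> targets x" "targets x \<subseteq> insert ?u (sources x)"
    using ear walk_vertex_set[of ?v x ?u] unfolding simple_path_def by auto
  moreover have "?u \<notin> sources (r @ p)"
    using rp by (simp add: simple_path_def)
  ultimately have "sources (r @ p) \<inter> sources (reversed x) = {}"
    using interior by auto
  then have "simple_circuit G ((r @ p) @ reversed x)"
    using simple_circuit_append[of "r @ p" "reversed x" G] ne x hd_x rp ear by simp
  then show "simple_circuit G (p @ reversed x @ r)"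
    using simple_circuit_rotate[of G r "p @ reversed x"] by simp
qed

subsection \<open>Acyclic graphs and bridges\<close>

definition acyclic_graph :: "('v \<times> 'e \<times> 'v) set \<Rightarrow> bool" where
  "acyclic_graph G \<longleftrightarrow> (\<nexists>p. cycle G p)"

lemma acyclic_graph_mono: "acyclic_graph H \<Longrightarrow> G \<subseteq> H \<Longrightarrow> acyclic_graph G"
  unfolding acyclic_graph_def using cycle_mono[of G _ H] by blast

lemma acyclic_graph_empty [simp]: "acyclic_graph {}"
  by (simp add: acyclic_graph_def cycle_iff_simple_circuit simple_circuit_def cyclically_def
      sym_steps_def)

definition bridge :: "('v \<times> 'e \<times> 'v) set \<Rightarrow> 'v \<times> 'e \<times> 'v \<Rightarrow> bool" where
  "bridge G s \<longleftrightarrow> \<not> connected_in (G - {s}) (step_source s) (step_target s)"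

lemma cycle_through_non_bridge:
  assumes inj: "inj_on step_edge G" and s: "s \<in> G" "\<not> bridge G s"
  obtains p where "cycle G (p @ [s])" "set p \<subseteq> sym_steps (G - {s})"
proof -
  have inj': "inj_on step_edge (G - {s})"
    using inj by (rule inj_on_subset) blast
  obtain p where p: "simple_path (G - {s}) (step_target s) p (step_source s)"
    using s(2) connected_in_sym connected_in_imp_simple_path unfolding bridge_def by metis
  have "step_edge s \<noteq> step_edge t" if "t \<in> set p" for t
  proof -
    have "t \<in> G - {s} \<or> rev_step t \<in> G - {s}"
      using p that by (auto simp: simple_path_def in_sym_steps)
    then show ?thesis
      using s(1) inj_on_eq_iff[OF inj, of s t] inj_on_eq_iff[OF inj, of s "rev_step t"] by auto
  qed
  then have "step_edge s \<notin> step_edge ` set p"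
    by (simp add: image_iff)
  moreover have "simple_circuit G (p @ [s])"
    using p s(1) sym_steps_mono[of "G - {s}" G]
    by (auto simp: simple_circuit_snoc simple_path_def in_sym_steps)
  ultimately have "cycle G (p @ [s])"
    using simple_path_distinct_edges[OF inj' p] by (simp add: cycle_iff_simple_circuit)
  then show thesis
    using p that by (simp add: simple_path_def)
qed

lemma cycle_source_connected:
  assumes "cycle G p" "s \<in> set p"
  shows "connected_in G (step_source (hd p)) (step_source s)"
proof -
  obtain q r where p: "p = q @ s # r"
    using assms(2) by (metis split_list)
  have "set q \<subseteq> sym_steps G" "walk (step_source (hd p)) q (step_source s)"
    using assms(1)
    unfolding cycle_iff_simple_circuit simple_circuit_def cyclically_linked_iff_walk p
    by (auto simp: walk_append)
  then show ?thesis unfolding connected_in_def by blast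
qed

lemma acyclic_graph_Un:
  assumes G: "acyclic_graph G" "\<And>s. s \<in> G \<Longrightarrow> step_source s \<in> V \<and> step_target s \<in> V"
    and H: "acyclic_graph H" "\<And>s. s \<in> H \<Longrightarrow> step_source s \<notin> V \<and> step_target s \<notin> V"
  shows "acyclic_graph (G \<union> H)"
  unfolding acyclic_graph_def
proof
  assume "\<exists>p. cycle (G \<union> H) p"
  then obtain p where p: "cycle (G \<union> H) p" ..
  let ?u = "step_source (hd p)"
  have side: "step_source s \<in> V \<longleftrightarrow> ?u \<in> V" if "s \<in> set p" for s
    by (rule connected_in_invariant[OF cycle_source_connected[OF p that], symmetric])
      (use G(2) H(2) in blast)
  have steps: "s \<in> sym_steps G \<and> step_source s \<in> V \<or> s \<in> sym_steps H \<and> step_source s \<notin> V"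
    if "s \<in> set p" for s
  proof -
    have "s \<in> G \<union> H \<or> rev_step s \<in> G \<union> H"
      using p that by (auto simp: cycle_iff_simple_circuit simple_circuit_def in_sym_steps)
    then show ?thesis
      using G(2)[of s] G(2)[of "rev_step s"] H(2)[of s] H(2)[of "rev_step s"]
      by (auto simp: in_sym_steps)
  qed
  have "set p \<subseteq> sym_steps G \<or> set p \<subseteq> sym_steps H"
    using side steps by (cases "?u \<in> V") blast+
  then have "cycle G p \<or> cycle H p"
    using p by (auto simp: cycle_iff_simple_circuit simple_circuit_def)
  then show False
    using G(1) H(1) unfolding acyclic_graph_def by blast
qed

lemma acyclic_graph_insert:
  assumes G: "acyclic_graph G" and s: "\<not> connected_in G (step_source s) (step_target s)"
  shows "acyclic_graph (insert s G)"
  unfolding acyclic_graph_def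
proof
  assume "\<exists>p. cycle (insert s G) p"
  then obtain p where p: "cycle (insert s G) p" ..
  have steps: "t \<in> sym_steps G \<or> t = s \<or> t = rev_step s" if "t \<in> set p" for t
    using p that rev_step_eq_iff[of t s]
    by (auto simp: cycle_iff_simple_circuit simple_circuit_def in_sym_steps)
  show False
  proof (cases "set p \<subseteq> sym_steps G")
    case True
    then have "cycle G p"
      using p by (simp add: cycle_iff_simple_circuit simple_circuit_def)
    then show False using G unfolding acyclic_graph_def by blast
  next
    case False
    then obtain t where t: "t \<in> set p" "t = s \<or> t = rev_step s"
      using steps by blast
    obtain q r where "p = q @ t # r"
      using t(1) by (metis split_list)
    then have rotated: "cycle (insert s G) ((t # r) @ q)"
      using p cycle_rotate[of "insert s G" q "t # r"] by simp
    have "set (r @ q) \<subseteq> sym_steps G"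
    proof
      fix t' assume t': "t' \<in> set (r @ q)"
      then have "step_edge t' \<noteq> step_edge t"
        using rotated by (auto simp: cycle_iff_simple_circuit image_iff)
      then show "t' \<in> sym_steps G"
        using steps[of t'] t(2) t' \<open>p = q @ t # r\<close> by auto
    qed
    moreover have "walk (step_target t) (r @ q) (step_source t)"
      using rotated
      by (simp add: cycle_iff_simple_circuit simple_circuit_def cyclically_linked_iff_walk)
    ultimately have "connected_in G (step_target t) (step_source t)"
      unfolding connected_in_def by blast
    then show False
      using s t(2) connected_in_sym[of G] by auto
  qed
qed

lemma acyclic_graph_insert_leaf:
  assumes G: "acyclic_graph G" "\<And>s. s \<in> G \<Longrightarrow> step_source s \<noteq> v \<and> step_target s \<noteq> v" and "u \<noteq> v"
  shows "acyclic_graph (insert (u, e, v) G)"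
proof (rule acyclic_graph_insert[OF G(1)])
  have "connected_in G u v \<Longrightarrow> u = v \<longleftrightarrow> v = v"
    by (erule connected_in_invariant) (use G(2) in blast)
  then show "\<not> connected_in G (step_source (u, e, v)) (step_target (u, e, v))"
    using \<open>u \<noteq> v\<close> by auto
qed

subsection \<open>Potentials\<close>

definition signed_weight ::
  "('v \<times> 'e \<times> 'v) set \<Rightarrow> ('v \<times> 'e \<times> 'v \<Rightarrow> 'w::ab_group_add) \<Rightarrow> 'v \<times> 'e \<times> 'v \<Rightarrow> 'w" where
  "signed_weight G w s = (if s \<in> G then w s else - w (rev_step s))"

definition potential ::
  "('v \<times> 'e \<times> 'v) set \<Rightarrow> ('v \<times> 'e \<times> 'v \<Rightarrow> 'w::ab_group_add) \<Rightarrow> ('v \<Rightarrow> 'w) \<Rightarrow> bool" where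
  "potential G w J \<longleftrightarrow> (\<forall>s\<in>G. J (step_target s) - J (step_source s) = w s)"

lemma potential_walk:
  assumes J: "potential G w J" and "set p \<subseteq> sym_steps G" "walk u p v"
  shows "(\<Sum>s\<leftarrow>p. signed_weight G w s) = J v - J u"
  using assms(2,3)
proof (induction p arbitrary: u)
  case (Cons s p)
  have "signed_weight G w s = J (step_target s) - J (step_source s)"
  proof (cases "s \<in> G")
    case True
    then show ?thesis using J by (simp add: potential_def signed_weight_def)
  next
    case False
    then have "rev_step s \<in> G" using Cons.prems(1) by (simp add: in_sym_steps)
    then have "w (rev_step s) = J (step_source s) - J (step_target s)"
      using J unfolding potential_def by force
    then show ?thesis using False by (simp add: signed_weight_def)
  qed
  then show ?case using Cons.prems Cons.IH[of "step_target s"] by simp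
qed simp

lemma potential_insert_disconnected:
  assumes J: "potential G w J" and s: "\<not> connected_in G (step_source s) (step_target s)"
  shows "\<exists>J. potential (insert s G) w J"
proof
  define c where "c = J (step_source s) + w s - J (step_target s)"
  define J' where "J' x = (if connected_in G (step_target s) x then J x + c else J x)" for x
  have "J' (step_target t) - J' (step_source t) = w t" if t: "t \<in> G" for t
  proof -
    have "connected_in G (step_source t) (step_target t)"
      "connected_in G (step_target t) (step_source t)"
      using t connected_in_step[of t G] connected_in_sym[of G] by (simp_all add: in_sym_steps)
    then have "connected_in G (step_target s) (step_source t) \<longleftrightarrow>
        connected_in G (step_target s) (step_target t)"
      using connected_in_trans[of G "step_target s"] by blast
    then show ?thesis
      using bspec[OF J[unfolded potential_def] t] by (simp add: J'_def)
  qed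
  moreover have "J' (step_target s) - J' (step_source s) = w s"
    using s connected_in_sym[of G] connected_in_refl[of G] by (auto simp: J'_def c_def)
  ultimately show "potential (insert s G) w J'"
    by (simp add: potential_def)
qed

lemma signed_weight_subset:
  assumes inj: "inj_on step_edge G" and "H \<subseteq> G" "s \<in> sym_steps H"
  shows "signed_weight H w s = signed_weight G w s"
proof (cases "s \<in> H")
  case False
  then have "rev_step s \<in> H"
    using assms(3) by (simp add: in_sym_steps)
  then have "s \<notin> G"
    using inj_on_eq_iff[OF inj, of s "rev_step s"] False assms(2) by auto
  then show ?thesis using False by (simp add: signed_weight_def)
qed (use assms(2) in \<open>auto simp: signed_weight_def\<close>)

lemma sum_signed_weight_subset:
  assumes "inj_on step_edge G" "H \<subseteq> G" "set p \<subseteq> sym_steps H"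
  shows "(\<Sum>s\<leftarrow>p. signed_weight H w s) = (\<Sum>s\<leftarrow>p. signed_weight G w s)"
proof (intro arg_cong[of _ _ sum_list] map_cong refl)
  fix s assume "s \<in> set p"
  then show "signed_weight H w s = signed_weight G w s"
    using assms(3) by (intro signed_weight_subset[OF assms(1,2)]) blast
qed

lemma potential_insert:
  assumes inj: "inj_on step_edge (insert s G)" and "s \<notin> G" and J: "potential G w J"
    and zero: "\<And>p. cycle (insert s G) p \<Longrightarrow> (\<Sum>t\<leftarrow>p. signed_weight (insert s G) w t) = 0"
  shows "\<exists>J. potential (insert s G) w J"
proof (cases "connected_in G (step_source s) (step_target s)")
  case False
  then show ?thesis by (rule potential_insert_disconnected[OF J])
next
  case True
  have "insert s G - {s} = G" using \<open>s \<notin> G\<close> by blast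
  then obtain p where p: "cycle (insert s G) (p @ [s])" "set p \<subseteq> sym_steps G"
    using True cycle_through_non_bridge[OF inj, of s] by (auto simp: bridge_def)
  have "(\<Sum>t\<leftarrow>p. signed_weight G w t) = J (step_source s) - J (step_target s)"
    using p by (intro potential_walk[OF J])
      (simp_all add: cycle_iff_simple_circuit simple_circuit_snoc simple_path_def)
  moreover have "(\<Sum>t\<leftarrow>p. signed_weight G w t) + w s = 0"
    using zero[OF p(1)] unfolding sum_signed_weight_subset[OF inj subset_insertI p(2)]
    by (simp add: signed_weight_def[of _ _ s])
  ultimately have "J (step_target s) - J (step_source s) = w s"
    by (simp add: add_eq_0_iff)
  then have "potential (insert s G) w J"
    using J by (simp add: potential_def)
  then show ?thesis by blast
qed

theorem potential_exists_iff:
  assumes fin: "finite G" and inj: "inj_on step_edge G"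
  shows "(\<exists>J. potential G w J) \<longleftrightarrow> (\<forall>p. cycle G p \<longrightarrow> (\<Sum>s\<leftarrow>p. signed_weight G w s) = 0)"
proof (intro iffI allI impI)
  fix p assume "\<exists>J. potential G w J" and p: "cycle G p"
  then obtain J where J: "potential G w J" by blast
  show "(\<Sum>s\<leftarrow>p. signed_weight G w s) = 0"
    using p potential_walk[OF J, of p "step_source (hd p)" "step_source (hd p)"]
    by (simp add: cycle_iff_simple_circuit simple_circuit_def cyclically_linked_iff_walk)
next
  assume "\<forall>p. cycle G p \<longrightarrow> (\<Sum>s\<leftarrow>p. signed_weight G w s) = 0"
  with fin inj show "\<exists>J. potential G w J"
  proof (induction G rule: finite_induct)
    case empty
    then show ?case by (simp add: potential_def)
  next
    case (insert s G)
    have "(\<Sum>t\<leftarrow>p. signed_weight G w t) = 0" if p: "cycle G p" for p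
    proof -
      have "set p \<subseteq> sym_steps G"
        using p by (simp add: cycle_iff_simple_circuit simple_circuit_def)
      then show ?thesis
        using insert.prems(2) cycle_mono[OF p, of "insert s G"]
          sum_signed_weight_subset[OF insert.prems(1), of G p w] by auto
    qed
    then obtain J where "potential G w J"
      using insert.IH insert.prems(1) by auto
    then show ?case
      using insert.prems(2) by (intro potential_insert[OF insert.prems(1) insert.hyps(2)]) auto
  qed
qed

section \<open>Graphs with cusps\<close>

locale cusped_graph =
  fixes G :: "('v \<times> 'e \<times> 'v) set" and cusp :: "'v \<Rightarrow> 'e \<Rightarrow> 'e \<Rightarrow> bool"
  assumes finite_graph: "finite G"
    and inj_edges: "inj_on step_edge G"
    and no_loop: "s \<in> G \<Longrightarrow> step_source s \<noteq> step_target s"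
    and cusp_sym: "cusp v e e' \<Longrightarrow> cusp v e' e"
    and cusp_trans: "cusp v e e' \<Longrightarrow> cusp v e' e'' \<Longrightarrow> cusp v e e''"
    and cusp_incoming: "cusp v e e' \<Longrightarrow> \<exists>s\<in>G. step_edge s = e \<and> step_target s = v"
begin

definition smooth :: "'v \<times> 'e \<times> 'v \<Rightarrow> 'v \<times> 'e \<times> 'v \<Rightarrow> bool" where
  "smooth s t \<longleftrightarrow> linked s t \<and> step_edge s \<noteq> step_edge t \<and>
     \<not> cusp (step_target s) (step_edge s) (step_edge t)"

lemma smooth_rev_step [simp]: "smooth (rev_step t) (rev_step s) \<longleftrightarrow> smooth s t"
  using cusp_sym by (auto simp: smooth_def)

lemma successively_smooth_reversed [simp]:
  "successively smooth (reversed p) \<longleftrightarrow> successively smooth p"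
  by (simp add: reversed_def successively_map)

lemma smooth_detour:
  assumes "smooth s u" "step_target t = step_target s" "\<not> smooth t u"
  shows "smooth s (rev_step t)"
  using assms cusp_trans[of "step_target s" "step_edge s" "step_edge t" "step_edge u"]
  by (auto simp: smooth_def)

lemma cusp_step_in_graph:
  assumes s: "s \<in> sym_steps G" "cusp (step_target s) (step_edge s) e"
  shows "s \<in> G"
proof -
  obtain t where t: "t \<in> G" "step_edge t = step_edge s" "step_target t = step_target s"
    using cusp_incoming[OF s(2)] by blast
  then have "s = t \<or> s = rev_step t"
    using sym_steps_eq_or_rev[OF inj_edges s(1), of t] by (simp add: in_sym_steps)
  then show ?thesis
    using t no_loop[of t] by auto
qed

lemma no_cusp_at_source:
  assumes "s \<in> G"
  shows "\<not> cusp (step_source s) e (step_edge s)"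
proof
  assume "cusp (step_source s) e (step_edge s)"
  then have "rev_step s \<in> G"
    using assms cusp_sym cusp_step_in_graph[of "rev_step s" e] by (simp add: in_sym_steps)
  then have "rev_step s = s"
    using assms inj_on_eq_iff[OF inj_edges, of s "rev_step s"] by simp
  then show False
    using no_loop[OF assms] step_simps(4)[of s] by metis
qed

definition trail :: "'v \<times> 'e \<times> 'v \<Rightarrow> ('v \<times> 'e \<times> 'v) list \<Rightarrow> bool" where
  "trail s p \<longleftrightarrow> p \<noteq> [] \<and> simple_path G (step_target s) p (step_target (last p)) \<and>
     successively smooth (s # p)"

definition precedes :: "'v \<times> 'e \<times> 'v \<Rightarrow> 'v \<times> 'e \<times> 'v \<Rightarrow> bool" where
  "precedes s t \<longleftrightarrow> (\<exists>p. trail s p \<and> last p = t \<and> (\<forall>q. trail t q \<longrightarrow> sources p \<inter> targets q = {}))"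

lemma trail_prefix:
  assumes "trail s (p @ q)" "p \<noteq> []"
  shows "trail s p"
proof -
  obtain v where p: "simple_path G (step_target s) p v"
    using assms(1) by (auto simp: trail_def simple_path_append)
  then have "step_target (last p) = v"
    using walk_last[of "step_target s" p v] assms(2) by (simp add: simple_path_def)
  then show ?thesis
    using p assms successively_append_iff[of smooth "s # p" q] by (simp add: trail_def)
qed

lemma trail_append:
  assumes p: "trail s p" and q: "trail (last p) q" and disj: "sources p \<inter> targets q = {}"
  shows "trail s (p @ q)"
proof -
  have "insert (step_target (last q)) (sources q) = insert (step_target (last p)) (targets q)"
    using q walk_vertex_set[of "step_target (last p)" q] by (simp add: trail_def simple_path_def)
  moreover have "step_target (last p) \<notin> sources p"
    using p by (simp add: trail_def simple_path_def)
  ultimately have "sources p \<inter> insert (step_target (last q)) (sources q) = {}"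
    using disj by simp
  then have "simple_path G (step_target s) (p @ q) (step_target (last q))"
    using p q unfolding trail_def simple_path_append by blast
  then show ?thesis
    using p q by (auto simp: trail_def successively_Cons successively_append_iff)
qed

lemma precedes_trans:
  assumes "precedes s t" "precedes t u"
  shows "precedes s u"
proof -
  obtain p where p: "trail s p" "last p = t" "\<And>x. trail t x \<Longrightarrow> sources p \<inter> targets x = {}"
    using assms(1) unfolding precedes_def by metis
  obtain q where q: "trail t q" "last q = u" "\<And>x. trail u x \<Longrightarrow> sources q \<inter> targets x = {}"
    using assms(2) unfolding precedes_def by metis
  have "sources (p @ q) \<inter> targets x = {}" if x: "trail u x" for x
  proof -
    have "trail t (q @ x)"
      using trail_append[OF q(1), of x] q x by simp
    from p(3)[OF this] show ?thesis
      using q(3)[OF x] by auto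
  qed
  moreover have "trail s (p @ q)"
    using trail_append[OF p(1), of q] p q by simp
  moreover have "last (p @ q) = u"
    using q by (simp add: trail_def)
  ultimately show ?thesis
    unfolding precedes_def by blast
qed

lemma precedes_irrefl: "\<not> precedes s s"
proof
  assume "precedes s s"
  then obtain p where p: "trail s p" "last p = s" unfolding precedes_def by blast
  then have "step_source (hd p) = step_target s" "step_target s \<notin> sources p" "p \<noteq> []"
    by (auto simp: trail_def simple_path_def smooth_def successively_Cons)
  then show False
    using source_in_sources[of "hd p" p] by simp
qed

fun cusp_count :: "('v \<times> 'e \<times> 'v) list \<Rightarrow> nat" where
  "cusp_count (s # t # p) = of_bool (\<not> smooth s t) + cusp_count (t # p)"
| "cusp_count _ = 0"

lemma cusp_count_append:
  assumes "p \<noteq> []" "q \<noteq> []"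
  shows "cusp_count (p @ q) = cusp_count p + of_bool (\<not> smooth (last p) (hd q)) + cusp_count q"
  using assms
proof (induction p rule: cusp_count.induct)
  case ("2_2" s)
  then show ?case by (cases q) auto
qed auto

lemma cusp_count_eq_0_iff: "cusp_count p = 0 \<longleftrightarrow> successively smooth p"
  by (induction p rule: cusp_count.induct) auto

end

lemma not_successively_split:
  assumes "\<not> successively R p"
  obtains p1 p2 where "p = p1 @ p2" "p1 \<noteq> []" "p2 \<noteq> []" "successively R p1" "\<not> R (last p1) (hd p2)"
proof -
  have "\<exists>p1 p2. p = p1 @ p2 \<and> p1 \<noteq> [] \<and> p2 \<noteq> [] \<and> successively R p1 \<and> \<not> R (last p1) (hd p2)"
    using assms
  proof (induction p rule: rev_induct)
    case (snoc x p)
    show ?case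
    proof (cases "successively R p")
      case True
      then show ?thesis
        using snoc.prems by (intro exI[of _ p] exI[of _ "[x]"]) (auto simp: successively_append_iff)
    next
      case False
      from snoc.IH[OF this] obtain p1 p2 where "p = p1 @ p2" "p1 \<noteq> []" "p2 \<noteq> []" "successively R p1"
        "\<not> R (last p1) (hd p2)" by blast
      then show ?thesis
        by (intro exI[of _ p1] exI[of _ "p2 @ [x]"]) simp
    qed
  qed simp
  then show thesis using that by blast
qed

locale cuspfree_acyclic = cusped_graph G cusp
  for G :: "('v \<times> 'e \<times> 'v) set" and cusp +
  assumes cycle_has_cusp: "cycle G p \<Longrightarrow> \<not> cyclically smooth p"
begin

lemma closing_cusp:
  assumes p: "simple_circuit G p" "successively smooth p"
  shows "cusp (step_source (hd p)) (step_edge (last p)) (step_edge (hd p))"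
proof (cases "step_edge (last p) = step_edge (hd p)")
  case False
  then have "\<not> smooth (last p) (hd p)"
    using p cycle_has_cusp[OF cycleI[OF inj_edges p(1)]]
    by (simp add: cyclically_def simple_circuit_def)
  then show ?thesis
    using False p(1) by (simp add: smooth_def simple_circuit_def cyclically_def)
next
  case True
  obtain s q where s: "p = s # q" "s \<in> sym_steps G"
    using p(1) by (cases p) (auto simp: simple_circuit_def cyclically_def)
  have "q \<noteq> []"
    using p(1) s no_loop[of s] no_loop[of "rev_step s"]
    by (auto simp: simple_circuit_def cyclically_def in_sym_steps)
  then obtain r t where q: "q = r @ [t]"
    by (metis rev_exhaust)
  have "t = s \<or> t = rev_step s"
    using sym_steps_eq_or_rev[OF inj_edges, of t s] p(1) True s(2) unfolding s(1) q
    by (simp add: simple_circuit_def)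
  then have t: "t = rev_step s"
    using p(1) unfolding s(1) q by (auto simp: simple_circuit_def)
  show ?thesis
  proof (cases r)
    case Nil
    then show ?thesis using p(2) True s(1) q by (simp add: smooth_def)
  next
    case (Cons u r')
    then have "step_source u = step_source t"
      using p(2) unfolding s(1) q t by (simp add: smooth_def)
    then show ?thesis
      using p(1) unfolding s(1) q Cons by (simp add: simple_circuit_def)
  qed
qed

lemma precedes_outgoing_step:
  assumes s: "s \<in> G" "t \<in> G" "step_source t = step_target s"
  shows "precedes s t"
proof -
  have "s \<noteq> t" using no_loop[OF s(1)] s(3) by auto
  then have "smooth s t"
    using s no_cusp_at_source[OF s(2)] inj_on_eq_iff[OF inj_edges s(1,2)] by (simp add: smooth_def)
  then have "trail s [t]"
    using s no_loop[OF s(2)] by (simp add: trail_def simple_path_Cons in_sym_steps)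
  moreover have "step_source t \<notin> targets q" if q: "trail t q" for q
  proof
    assume "step_source t \<in> targets q"
    then obtain u where u: "u \<in> set q" "step_target u = step_source t"
      by (auto simp: in_targets_iff)
    then obtain q1 q2 where "q = (q1 @ [u]) @ q2"
      using split_list[OF u(1)] by auto
    then have q1: "trail t (q1 @ [u])"
      using trail_prefix q by blast
    have "simple_circuit G ([t] @ (q1 @ [u]))"
      using q1 u(2) s(2) no_loop[OF s(2)] walk_hd[of "step_target t" "q1 @ [u]"]
      by (subst simple_circuit_append) (auto simp: trail_def simple_path_def in_sym_steps)
    from closing_cusp[OF this] have "cusp (step_source t) (step_edge u) (step_edge t)"
      using q1 by (simp add: trail_def)
    then show False using no_cusp_at_source[OF s(2)] by blast
  qed
  ultimately show ?thesis
    unfolding precedes_def by (intro exI[of _ "[t]"]) simp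
qed

end

locale minimal_cusp_cycle = cuspfree_acyclic G cusp
  for G :: "('v \<times> 'e \<times> 'v) set" and cusp +
  fixes p q :: "('v \<times> 'e \<times> 'v) list"
  assumes cycle: "cycle G (p @ q)" and nonempty: "p \<noteq> []" "q \<noteq> []"
    and no_cusp_at_hd: "\<not> cusp (step_source (hd p)) e e'"
    and smooth_p: "successively smooth p" and not_smooth_junction: "\<not> smooth (last p) (hd q)"
    and minimal: "cycle G r \<Longrightarrow> last r = last q \<Longrightarrow> cusp_count (p @ q) \<le> cusp_count r"
begin

lemma circuit: "simple_circuit G (p @ q)"
  using cycle by (simp add: cycle_iff_simple_circuit)

lemma p_path: "simple_path G (step_source (hd p)) p (step_source (hd q))"
  and q_path: "simple_path G (step_source (hd q)) q (step_source (hd p))"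
  using circuit nonempty by (simp_all add: simple_circuit_append)

lemma target_last_p: "step_target (last p) = step_source (hd q)"
  and target_last_q: "step_target (last q) = step_source (hd p)"
  using p_path q_path nonempty walk_last[of "step_source (hd p)" p "step_source (hd q)"]
    walk_last[of "step_source (hd q)" q "step_source (hd p)"] by (simp_all add: simple_path_def)

lemma edges_distinct:
  assumes "s \<in> set p" "t \<in> set q"
  shows "step_edge s \<noteq> step_edge t"
proof -
  have "step_edge ` set p \<inter> step_edge ` set q = {}"
    using cycle by (simp add: cycle_iff_simple_circuit)
  then show ?thesis
    using assms imageI[of s "set p" step_edge] imageI[of t "set q" step_edge] by auto
qed

lemma ends_distinct: "step_edge (last q) \<noteq> step_edge (hd p)"
  using edges_distinct[of "hd p" "last q"] nonempty by simp

lemma last_p_in_graph: "last p \<in> G"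
proof -
  have "step_edge (last p) \<noteq> step_edge (hd q)"
    using edges_distinct[of "last p" "hd q"] nonempty by simp
  then have "cusp (step_target (last p)) (step_edge (last p)) (step_edge (hd q))"
    using not_smooth_junction target_last_p by (simp add: smooth_def)
  moreover have "last p \<in> sym_steps G"
    using p_path last_in_set[OF nonempty(1)] by (auto simp: simple_path_def)
  ultimately show ?thesis by (rule cusp_step_in_graph[rotated])
qed

lemma trail_p: "trail (last q) p"
  using p_path nonempty smooth_p ends_distinct no_cusp_at_hd
  by (simp add: trail_def target_last_p target_last_q successively_Cons smooth_def)

definition ear :: "('v \<times> 'e \<times> 'v) list \<Rightarrow> bool" where
  "ear x \<longleftrightarrow> trail (last p) x \<and> sources x \<inter> sources (p @ q) \<subseteq> {step_source (hd q)}"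

lemma ear_path: "ear x \<Longrightarrow> simple_path G (step_source (hd q)) x (step_target (last x))"
  and ear_smooth: "ear x \<Longrightarrow> x \<noteq> []" "ear x \<Longrightarrow> successively smooth x" "ear x \<Longrightarrow> smooth (last p) (hd x)"
  by (auto simp: ear_def trail_def target_last_p successively_Cons)

lemma ear_reversed_smooth:
  assumes "ear x"
  shows "smooth (rev_step (hd x)) (hd q)"
proof -
  have "smooth (rev_step (hd x)) (rev_step (last p))"
    "\<not> smooth (rev_step (hd q)) (rev_step (last p))"
    using ear_smooth(3)[OF assms] not_smooth_junction by simp_all
  from smooth_detour[OF this(1) _ this(2)] show ?thesis
    using ear_smooth(3)[OF assms] target_last_p by (simp add: smooth_def)
qed

lemma cusp_count_cycle: "cusp_count (p @ q) = Suc (cusp_count q)"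
  using nonempty smooth_p not_smooth_junction
  by (simp add: cusp_count_append cusp_count_eq_0_iff[THEN iffD2])

lemma ear_target_not_in_p:
  assumes x: "ear x"
  shows "step_target (last x) \<notin> sources p"
proof
  assume "step_target (last x) \<in> sources p"
  then obtain t where t: "t \<in> set p" "step_source t = step_target (last x)"
    by (auto simp: in_sources_iff)
  then obtain pa pb where p_eq: "p = pa @ t # pb"
    by (metis split_list)
  have interior: "sources x \<inter> sources (p @ q) \<subseteq> {step_source (hd q)}"
    using x by (simp add: ear_def)
  have circuits: "simple_circuit G ((t # pb) @ x)" "simple_circuit G (pa @ reversed x @ q)"
    using simple_circuit_ear[of G pa "t # pb" q x] circuit nonempty ear_path[OF x] interior t(2)
    by (simp_all add: p_eq)
  have "successively smooth ((t # pb) @ x)"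
    using smooth_p ear_smooth[OF x] successively_append_iff[of smooth "t # pb" x]
    by (simp add: p_eq successively_append_iff)
  from closing_cusp[OF circuits(1) this]
  have cusp: "cusp (step_source t) (step_edge (last x)) (step_edge t)"
    using ear_smooth(1)[OF x] by simp
  then have pa: "pa \<noteq> []"
    using no_cusp_at_hd by (auto simp: p_eq)
  then have "smooth (last pa) t"
    using smooth_p by (simp add: p_eq successively_append_iff)
  then have "smooth (last pa) (rev_step (last x))"
    using cusp t(2) by (intro smooth_detour) (auto simp: smooth_def)
  then have "cusp_count (pa @ reversed x @ q) = cusp_count q"
    using pa nonempty smooth_p ear_smooth[OF x] ear_reversed_smooth[OF x]
    by (simp add: cusp_count_append p_eq successively_append_iff cusp_count_eq_0_iff[THEN iffD2])
  moreover have "cycle G (pa @ reversed x @ q)"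
    using ends_distinct pa nonempty by (intro cycleI[OF inj_edges circuits(2)]) (simp add: p_eq)
  ultimately show False
    using minimal[of "pa @ reversed x @ q"] nonempty cusp_count_cycle by simp
qed

lemma ear_target_not_in_q:
  assumes x: "ear x"
  shows "step_target (last x) \<notin> sources q"
proof
  assume "step_target (last x) \<in> sources q"
  then obtain t where t: "t \<in> set q" "step_source t = step_target (last x)"
    by (auto simp: in_sources_iff)
  then obtain qa qb where q_eq: "q = qa @ t # qb"
    by (metis split_list)
  have rev_path: "simple_path G (step_target (last x)) (reversed x) (step_source (hd q))"
    using ear_path[OF x] by simp
  have "step_source (hd q) \<noteq> step_target (last x)"
    using ear_path[OF x] ear_smooth(1)[OF x] by (cases x) (auto simp: simple_path_Cons)
  then have qa: "qa \<noteq> []"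
    using t(2) by (auto simp: q_eq)
  have "sources (reversed x) \<inter> sources (p @ q) \<subseteq> {step_target (last x)}"
    using x ear_path[OF x] rev_path
      walk_vertex_set[of "step_source (hd q)" x "step_target (last x)"]
    by (auto simp: ear_def simple_path_def)
  then have circuits: "simple_circuit G (qa @ reversed x)" "simple_circuit G (p @ x @ t # qb)"
    using simple_circuit_ear[of G p qa "t # qb" "reversed x"] circuit qa rev_path t(2)
    by (simp_all add: q_eq)
  have "cycle G (p @ x @ t # qb)"
    using ends_distinct nonempty by (intro cycleI[OF inj_edges circuits(2)]) (simp add: q_eq)
  then have "cusp_count (p @ q) \<le> cusp_count (p @ x @ t # qb)"
    by (rule minimal) (simp add: q_eq)
  \<comment> \<open>The detour along \<open>x\<close> trades the cusp at the end of \<open>p\<close> for one at the end of \<open>x\<close>, so by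
    minimality \<open>qa\<close> has no cusp and closes up with \<open>x\<close>.\<close>
  also have "cusp_count (p @ x @ t # qb) = of_bool (\<not> smooth (last x) t) + cusp_count (t # qb)"
    using nonempty smooth_p ear_smooth[OF x]
    by (simp add: cusp_count_append cusp_count_eq_0_iff[THEN iffD2])
  also have "cusp_count (p @ q) =
      Suc (cusp_count qa + of_bool (\<not> smooth (last qa) t) + cusp_count (t # qb))"
    using qa by (simp add: cusp_count_cycle) (simp add: q_eq cusp_count_append)
  finally have detour: "\<not> smooth (last x) t" "smooth (last qa) t" "successively smooth qa"
    by (auto simp: cusp_count_eq_0_iff[symmetric] of_bool_def split: if_splits)
  then have "smooth (last qa) (rev_step (last x))"
    using t(2) by (intro smooth_detour) (auto simp: smooth_def)
  then have "successively smooth (qa @ reversed x)"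
    using detour ear_smooth[OF x] by (simp add: successively_append_iff)
  from closing_cusp[OF circuits(1) this] show False
    using ear_reversed_smooth[OF x] ear_smooth(1)[OF x] qa by (auto simp: q_eq smooth_def)
qed

lemma precedes_last_p: "precedes (last q) (last p)"
proof -
  have "sources p \<inter> targets x = {}" if x: "trail (last p) x" for x
  proof (rule ccontr)
    assume "sources p \<inter> targets x \<noteq> {}"
    then have "\<exists>t\<in>set x. step_target t \<in> sources (p @ q)"
      by (auto simp: in_targets_iff)
    from split_list_first_propE[OF this] obtain xa t xb where x_eq: "x = (xa @ [t]) @ xb"
      and t: "step_target t \<in> sources (p @ q)" and xa: "\<forall>u\<in>set xa. step_target u \<notin> sources (p @ q)"
      by (metis append.assoc append_Cons append_Nil)
    have trail: "trail (last p) (xa @ [t])"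
      using trail_prefix x x_eq by blast
    then have "insert (step_target t) (sources (xa @ [t])) =
        insert (step_source (hd q)) (targets (xa @ [t]))"
      "step_target t \<notin> sources (xa @ [t])"
      using walk_vertex_set[of _ "xa @ [t]"]
      unfolding trail_def simple_path_def target_last_p by auto
    moreover have "targets xa \<inter> sources (p @ q) = {}"
      using xa by (auto simp: in_targets_iff)
    ultimately have "ear (xa @ [t])"
      using trail unfolding ear_def by auto
    then show False
      using ear_target_not_in_p[of "xa @ [t]"] ear_target_not_in_q[of "xa @ [t]"] t by simp
  qed
  then show ?thesis
    unfolding precedes_def using trail_p by blast
qed

end

context cuspfree_acyclic
begin

lemma precedes_on_cycle:
  assumes "cycle G r" "last r = s" and no_cusp: "\<And>e e'. \<not> cusp (step_target s) e e'"
  obtains t where "t \<in> G" "precedes s t"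
proof -
  obtain r where r: "cycle G r" "last r = s"
    and least: "\<And>r'. cycle G r' \<and> last r' = s \<Longrightarrow> cusp_count r \<le> cusp_count r'"
    using ex_has_least_nat[of "\<lambda>r. cycle G r \<and> last r = s" r cusp_count] assms(1,2) by auto
  have circuit: "r \<noteq> []" "linked s (hd r)"
    using r by (auto simp: cycle_iff_simple_circuit simple_circuit_def cyclically_def)
  have "\<not> successively smooth r"
  proof
    assume "successively smooth r"
    then have "cusp (step_target s) (step_edge s) (step_edge (hd r))"
      using closing_cusp[of r] r circuit by (simp add: cycle_iff_simple_circuit)
    then show False using no_cusp by blast
  qed
  then obtain p q where pq: "r = p @ q" "p \<noteq> []" "q \<noteq> []" "successively smooth p"
    "\<not> smooth (last p) (hd q)"
    by (rule not_successively_split)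
  interpret minimal_cusp_cycle G cusp p q
  proof
    show "\<not> cusp (step_source (hd p)) e e'" for e e'
      using no_cusp circuit pq(1,2) by simp
    show "cusp_count (p @ q) \<le> cusp_count r'" if "cycle G r'" "last r' = last q" for r'
      using least[of r'] that r(2) pq by simp
  qed (use r pq in auto)
  show thesis
    using that[OF last_p_in_graph] precedes_last_p r(2) pq by simp
qed

theorem splitting_step:
  assumes "G \<noteq> {}"
  obtains s where "s \<in> G" "\<And>t. t \<in> G \<Longrightarrow> step_source t \<noteq> step_target s"
    "(\<exists>e e'. cusp (step_target s) e e') \<or> bridge G s"
proof -
  have "transp_on G precedes"
    using precedes_trans by (rule transp_onI)
  moreover have "asymp_on G precedes"
  proof (rule asymp_onI)
    fix s t assume "precedes s t"
    then show "\<not> precedes t s"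
      using precedes_trans[of s t s] precedes_irrefl[of s] by blast
  qed
  ultimately obtain s where s: "s \<in> G" and max: "\<forall>t\<in>G. t \<noteq> s \<longrightarrow> \<not> precedes s t"
    using Finite_Set.bex_max_element[OF finite_graph _ _ assms] by blast
  have maximal: "\<not> precedes s t" if "t \<in> G" for t
    using max that precedes_irrefl[of s] by (cases "t = s") auto
  show ?thesis
  proof (rule that[OF s])
    show "step_source t \<noteq> step_target s" if "t \<in> G" for t
      using precedes_outgoing_step[OF s that] maximal[OF that] by blast
    show "(\<exists>e e'. cusp (step_target s) e e') \<or> bridge G s"
    proof (rule ccontr)
      assume "\<not> ((\<exists>e e'. cusp (step_target s) e e') \<or> bridge G s)"
      then have no_cusp: "\<not> cusp (step_target s) e e'" and "\<not> bridge G s" for e e'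
        by auto
      obtain p where "cycle G (p @ [s])"
        by (rule cycle_through_non_bridge[OF inj_edges s \<open>\<not> bridge G s\<close>])
      then obtain t where "t \<in> G" "precedes s t"
        by (rule precedes_on_cycle[OF _ _ no_cusp]) simp
      then show False using maximal by blast
    qed
  qed
qed

end

section \<open>Nets and their parts\<close>

lemma edges_ofI:
  "l \<in> L \<Longrightarrow> e \<in> prems l \<Longrightarrow> e \<in> edges_of L"
  "l \<in> L \<Longrightarrow> e \<in> concs l \<Longrightarrow> e \<in> edges_of L"
  by (auto simp: edges_of_def)

lemma edges_of_Un: "edges_of (L \<union> L') = edges_of L \<union> edges_of L'"
  by (auto simp: edges_of_def)

lemma edges_of_insert: "edges_of (insert l L) = prems l \<union> concs l \<union> edges_of L"
  by (auto simp: edges_of_def)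

lemma conclusions_of_iff: "e \<in> conclusions_of L \<longleftrightarrow> e \<in> edges_of L \<and> (\<forall>l\<in>L. e \<notin> prems l)"
  by (auto simp: conclusions_of_def)

lemma incident_nonempty: "prems l \<union> concs l \<noteq> {}"
  by (cases l) auto

lemma net_graph_iff:
  "net_graph L \<longleftrightarrow> finite L \<and> (\<forall>l\<in>L. typed l) \<and> \<Union>(prems ` L) \<subseteq> \<Union>(concs ` L) \<and>
     disjoint_family_on concs L \<and> disjoint_family_on prems L"
proof -
  have family: "disjoint_family_on f L \<longleftrightarrow> (\<forall>e. \<forall>l\<in>L. \<forall>m\<in>L. e \<in> f l \<longrightarrow> e \<in> f m \<longrightarrow> l = m)"
    for f :: "_ \<Rightarrow> 'a edge set"
    by (auto simp: disjoint_family_on_def)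
  have "(\<forall>e\<in>edges_of L. \<exists>!l. l \<in> L \<and> e \<in> concs l) \<longleftrightarrow>
      (\<forall>e\<in>edges_of L. \<exists>l\<in>L. e \<in> concs l) \<and> disjoint_family_on concs L"
    unfolding family using edges_ofI(2)[of _ L] by metis
  moreover have "(\<forall>e\<in>edges_of L. \<exists>l\<in>L. e \<in> concs l) \<longleftrightarrow> \<Union>(prems ` L) \<subseteq> \<Union>(concs ` L)"
    by (auto simp: edges_of_def)
  moreover have "(\<forall>l\<in>L. \<forall>m\<in>L. prems l \<inter> prems m \<noteq> {} \<longrightarrow> l = m) \<longleftrightarrow> disjoint_family_on prems L"
    unfolding family disjoint_iff by metis
  ultimately show ?thesis
    unfolding net_graph_def by simp
qed

lemma net_graph_finite: "net_graph L \<Longrightarrow> finite L"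
  by (simp add: net_graph_iff)

lemma net_graph_typed: "net_graph L \<Longrightarrow> l \<in> L \<Longrightarrow> typed l"
  by (simp add: net_graph_iff)

lemma net_graph_finite_edges:
  assumes "net_graph L"
  shows "finite (edges_of L)"
proof -
  have "finite (prems l \<union> concs l)" if "typed l" for l :: "'a link"
    using that by (cases l) auto
  then show ?thesis
    using assms by (auto simp: net_graph_iff edges_of_def)
qed

lemma net_graph_prem_unique:
  "net_graph L \<Longrightarrow> l \<in> L \<Longrightarrow> m \<in> L \<Longrightarrow> e \<in> prems l \<Longrightarrow> e \<in> prems m \<Longrightarrow> l = m"
  unfolding net_graph_iff disjoint_family_on_def by blast

definition producer :: "'a link set \<Rightarrow> 'a edge \<Rightarrow> 'a link" where
  "producer L e = (THE l. l \<in> L \<and> e \<in> concs l)"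

lemma producer_eq: "net_graph L \<Longrightarrow> l \<in> L \<Longrightarrow> e \<in> concs l \<Longrightarrow> producer L e = l"
  unfolding producer_def net_graph_iff disjoint_family_on_def by (intro the_equality) blast+

lemma producer_in:
  assumes "net_graph L" "e \<in> edges_of L"
  shows "producer L e \<in> L" "e \<in> concs (producer L e)"
proof -
  obtain l where "l \<in> L" "e \<in> concs l"
    using assms unfolding net_graph_iff edges_of_def by blast
  then show "producer L e \<in> L" "e \<in> concs (producer L e)"
    using producer_eq[OF assms(1)] by simp_all
qed

lemma net_graph_subset:
  assumes L: "net_graph L" and "L' \<subseteq> L"
    and closed: "\<And>l e. l \<in> L' \<Longrightarrow> e \<in> prems l \<Longrightarrow> producer L e \<in> L'"
  shows "net_graph L'"
proof -
  have "\<Union>(prems ` L') \<subseteq> \<Union>(concs ` L')"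
  proof
    fix e assume "e \<in> \<Union>(prems ` L')"
    then obtain l where "l \<in> L'" "e \<in> prems l" by blast
    then show "e \<in> \<Union>(concs ` L')"
      using closed producer_in(2)[OF L edges_ofI(1)] \<open>L' \<subseteq> L\<close> by blast
  qed
  then show ?thesis
    using L \<open>L' \<subseteq> L\<close> unfolding net_graph_iff
    by (auto intro: finite_subset disjoint_family_on_mono)
qed

lemma disjoint_family_on_UnI:
  assumes "disjoint_family_on f K" "disjoint_family_on f L" "\<Union>(f ` K) \<inter> \<Union>(f ` L) = {}"
  shows "disjoint_family_on f (K \<union> L)"
  using assms unfolding disjoint_family_on_def by blast

lemma net_graph_extend:
  assumes L: "net_graph L" and K: "finite K" "\<And>k. k \<in> K \<Longrightarrow> typed k"
      "disjoint_family_on prems K" "disjoint_family_on concs K"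
    and prems: "\<Union>(prems ` K) \<subseteq> conclusions_of L \<union> \<Union>(concs ` K)"
    and fresh: "\<Union>(concs ` K) \<inter> edges_of L = {}"
  shows "net_graph (K \<union> L)"
proof -
  have sub: "\<Union>(prems ` L) \<subseteq> edges_of L" "\<Union>(concs ` L) \<subseteq> edges_of L"
    by (auto simp: edges_of_def)
  have conclusions: "conclusions_of L \<subseteq> \<Union>(concs ` L)" "conclusions_of L \<inter> \<Union>(prems ` L) = {}"
    by (auto simp: conclusions_of_def edges_of_def)
  have "\<Union>(prems ` K) \<inter> \<Union>(prems ` L) = {}"
    using prems fresh sub(1) conclusions(2) by blast
  then have "disjoint_family_on prems (K \<union> L)"
    using L K(3) by (simp add: net_graph_iff disjoint_family_on_UnI)
  moreover have "\<Union>(concs ` K) \<inter> \<Union>(concs ` L) = {}"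
    using fresh sub(2) by blast
  then have "disjoint_family_on concs (K \<union> L)"
    using L K(4) by (simp add: net_graph_iff disjoint_family_on_UnI)
  moreover have "\<Union>(prems ` (K \<union> L)) \<subseteq> \<Union>(concs ` (K \<union> L))"
    using L prems conclusions(1) unfolding net_graph_iff image_Un Union_Un_distrib by blast
  ultimately show ?thesis
    using L K(1,2) by (auto simp: net_graph_iff)
qed

lemma producer_subset:
  assumes "net_graph L" "net_graph L'" "L' \<subseteq> L" "e \<in> edges_of L'"
  shows "producer L' e = producer L e"
  using producer_in[OF assms(2,4)] assms(3) by (intro producer_eq[OF assms(1), symmetric]) auto

subsection \<open>Boxes\<close>

lemma principal_in_box: "principal b \<in> box_links b"
  by (simp add: box_links_def ports_def)

lemma delimits_boxD:
  assumes "delimits_box L b"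
  shows "box_links b \<subseteq> L" "ports b \<inter> content b = {}" "net_graph (content b)"
    "conclusions_of (content b) = \<Union>(prems ` ports b)" "content b \<subset> box_links b"
  using assms unfolding delimits_box_def box_links_def ports_def by blast+

lemma port_cases:
  assumes "delimits_box L b"
  shows "OfCourseLink a c \<in> ports b \<longleftrightarrow> OfCourseLink a c = principal b"
    "PaxLink a c \<in> ports b \<longleftrightarrow> PaxLink a c \<in> auxiliary b"
  using assms unfolding delimits_box_def ports_def by auto

lemma delimits_box_mono: "delimits_box L b \<Longrightarrow> box_links b \<subseteq> L' \<Longrightarrow> delimits_box L' b"
  unfolding delimits_box_def by blast

fun port_link :: "'a link \<Rightarrow> bool" where
  "port_link (OfCourseLink a c) = True"
| "port_link (PaxLink a c) = True"
| "port_link _ = False"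

lemma port_link_iff: "port_link l \<longleftrightarrow> (\<exists>a c. l = OfCourseLink a c \<or> l = PaxLink a c)"
  by (cases l) auto

lemma delimits_box_port_link: "delimits_box L b \<Longrightarrow> l \<in> ports b \<Longrightarrow> port_link l"
  unfolding delimits_box_def ports_def by auto

definition nested_or_disjoint :: "'a box \<Rightarrow> 'a box \<Rightarrow> bool" where
  "nested_or_disjoint b b' \<longleftrightarrow>
     box_links b \<inter> box_links b' = {} \<or> box_links b \<subseteq> content b' \<or> box_links b' \<subseteq> content b"

lemma nested_or_disjoint_port:
  assumes "nested_or_disjoint b b'" "delimits_box L b" "l \<in> ports b" "l \<in> box_links b'"
  shows "box_links b \<subseteq> content b'"
  using assms delimits_boxD(2)[OF assms(2)] unfolding nested_or_disjoint_def box_links_def by blast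

text \<open>A port belongs to a single box because boxes are disjoint or nested, so existence suffices.\<close>

lemma is_net_iff:
  "is_net N \<longleftrightarrow> net_graph (links N) \<and> (\<forall>b\<in>boxes N. delimits_box (links N) b) \<and>
     (\<forall>l\<in>links N. port_link l \<longrightarrow> (\<exists>b\<in>boxes N. l \<in> ports b)) \<and> pairwise nested_or_disjoint (boxes N)"
proof -
  let ?principal = "\<lambda>a c b. b \<in> boxes N \<and> OfCourseLink a c = principal b"
  let ?auxiliary = "\<lambda>a c b. b \<in> boxes N \<and> PaxLink a c \<in> auxiliary b"
  have ports: "(\<forall>a c. OfCourseLink a c \<in> links N \<longrightarrow> (\<exists>!b. ?principal a c b)) \<and>
      (\<forall>a c. PaxLink a c \<in> links N \<longrightarrow> (\<exists>!b. ?auxiliary a c b)) \<longleftrightarrow>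
      (\<forall>l\<in>links N. port_link l \<longrightarrow> (\<exists>b\<in>boxes N. l \<in> ports b))"
    if boxes: "\<forall>b\<in>boxes N. delimits_box (links N) b"
      and nested: "pairwise nested_or_disjoint (boxes N)"
  proof -
    have unique: "b = b'" if "b \<in> boxes N" "b' \<in> boxes N" "l \<in> ports b" "l \<in> ports b'" for b b' l
    proof (rule ccontr)
      assume "b \<noteq> b'"
      then have "box_links b \<subseteq> content b'"
        using nested_or_disjoint_port[of b b' "links N" l] pairwiseD[OF nested, of b b'] boxes that
        unfolding box_links_def by blast
      then show False
        using that delimits_boxD(2)[of "links N" b'] boxes unfolding box_links_def by blast
    qed
    have principal: "?principal a c b \<longleftrightarrow> b \<in> boxes N \<and> OfCourseLink a c \<in> ports b" for a c b
      using port_cases(1)[of "links N" b] boxes by auto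
    have auxiliary: "?auxiliary a c b \<longleftrightarrow> b \<in> boxes N \<and> PaxLink a c \<in> ports b" for a c b
      using port_cases(2)[of "links N" b] boxes by auto
    have ex1: "(\<exists>!b. b \<in> boxes N \<and> l \<in> ports b) \<longleftrightarrow> (\<exists>b\<in>boxes N. l \<in> ports b)" for l
      using unique[of _ _ l] by blast
    show ?thesis
      unfolding principal auxiliary ex1 port_link_iff by blast
  qed
  have "(\<forall>b\<in>boxes N. \<forall>b'\<in>boxes N. b \<noteq> b' \<longrightarrow> box_links b \<inter> box_links b' = {} \<or>
      box_links b \<subseteq> content b' \<or> box_links b' \<subseteq> content b) \<longleftrightarrow> pairwise nested_or_disjoint (boxes N)"
    by (simp add: pairwise_def nested_or_disjoint_def)
  then show ?thesis
    unfolding is_net_def using ports by argo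
qed

lemma is_netD:
  assumes "is_net N"
  shows "net_graph (links N)" "\<And>b. b \<in> boxes N \<Longrightarrow> delimits_box (links N) b"
    "\<And>b. b \<in> boxes N \<Longrightarrow> box_links b \<subseteq> links N"
    "\<And>l. l \<in> links N \<Longrightarrow> port_link l \<Longrightarrow> \<exists>b\<in>boxes N. l \<in> ports b"
    "\<And>b b'. b \<in> boxes N \<Longrightarrow> b' \<in> boxes N \<Longrightarrow> b \<noteq> b' \<Longrightarrow> nested_or_disjoint b b'"
  using assms delimits_boxD(1) unfolding is_net_iff pairwise_def by blast+

lemma box_premise_producer:
  assumes N: "is_net N" and b: "b \<in> boxes N" and l: "l \<in> box_links b" "e \<in> prems l"
  shows "producer (links N) e \<in> content b"
proof -
  note box = delimits_boxD[OF is_netD(2)[OF N b]]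
  have "e \<in> edges_of (content b)"
    using l box(4) edges_ofI(1) by (auto simp: box_links_def conclusions_of_def)
  then show ?thesis
    using producer_in(1)[OF box(3)] producer_subset[OF is_netD(1)[OF N] box(3)] box(1,5) by auto
qed

subsection \<open>Restriction to a set of links\<close>

definition restrict_net :: "'a net \<Rightarrow> 'a link set \<Rightarrow> 'a net" where
  "restrict_net N L = Net L {b \<in> boxes N. box_links b \<subseteq> L}"

lemma restrict_net_simps [simp]:
  "links (restrict_net N L) = L" "boxes (restrict_net N L) = {b \<in> boxes N. box_links b \<subseteq> L}"
  by (simp_all add: restrict_net_def)

lemma box_net_eq_restrict_net: "box_net N b = restrict_net N (content b)"
  by (simp add: box_net_def restrict_net_def)

lemma is_net_restrict_net:
  assumes N: "is_net N" and L: "net_graph L" "L \<subseteq> links N"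
    and ports: "\<And>b. b \<in> boxes N \<Longrightarrow> ports b \<inter> L \<noteq> {} \<Longrightarrow> box_links b \<subseteq> L"
  shows "is_net (restrict_net N L)"
  unfolding is_net_iff restrict_net_simps
proof (intro conjI ballI impI)
  fix b assume "b \<in> {b \<in> boxes N. box_links b \<subseteq> L}"
  then show "delimits_box L b"
    using is_netD(2)[OF N] delimits_box_mono by blast
next
  fix l assume "l \<in> L" "port_link l"
  then show "\<exists>b\<in>{b \<in> boxes N. box_links b \<subseteq> L}. l \<in> ports b"
    using is_netD(4)[OF N] L(2) ports by blast
next
  show "pairwise nested_or_disjoint {b \<in> boxes N. box_links b \<subseteq> L}"
    using N by (auto simp: is_net_iff intro: pairwise_subset)
qed (rule L(1))

lemma is_net_box_net:
  assumes N: "is_net N" and b: "b \<in> boxes N"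
  shows "is_net (box_net N b)"
  unfolding box_net_eq_restrict_net
proof (rule is_net_restrict_net[OF N])
  note box = delimits_boxD[OF is_netD(2)[OF N b]]
  show "net_graph (content b)" "content b \<subseteq> links N"
    using box(1,3,5) by auto
  fix c assume c: "c \<in> boxes N" "ports c \<inter> content b \<noteq> {}"
  then have "c \<noteq> b" using box(2) by auto
  then show "box_links c \<subseteq> content b"
    using nested_or_disjoint_port[OF is_netD(5)[OF N c(1) b] is_netD(2)[OF N c(1)]] c(2) box(5)
    by blast
qed

definition closed_part :: "'a net \<Rightarrow> 'a link set \<Rightarrow> bool" where
  "closed_part N L \<longleftrightarrow> L \<subseteq> links N \<and> (\<forall>l\<in>L. \<forall>e\<in>prems l. producer (links N) e \<in> L) \<and>
     (\<forall>b\<in>boxes N. box_links b \<inter> L \<noteq> {} \<longrightarrow> box_links b \<subseteq> L)"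

lemma closed_partD:
  assumes "closed_part N L"
  shows "L \<subseteq> links N" "\<And>l e. l \<in> L \<Longrightarrow> e \<in> prems l \<Longrightarrow> producer (links N) e \<in> L"
    "\<And>b l. b \<in> boxes N \<Longrightarrow> l \<in> box_links b \<Longrightarrow> l \<in> L \<Longrightarrow> box_links b \<subseteq> L"
  using assms unfolding closed_part_def by blast+

lemma net_graph_closed_part: "is_net N \<Longrightarrow> closed_part N L \<Longrightarrow> net_graph L"
  using net_graph_subset is_netD(1) closed_partD(1,2) by metis

lemma is_net_closed_part:
  assumes N: "is_net N" and L: "closed_part N L"
  shows "is_net (restrict_net N L)"
proof (rule is_net_restrict_net[OF N net_graph_closed_part[OF N L] closed_partD(1)[OF L]])
  fix b assume "b \<in> boxes N" "ports b \<inter> L \<noteq> {}"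
  then show "box_links b \<subseteq> L"
    using closed_partD(3)[OF L] by (auto simp: box_links_def)
qed

lemma edges_disjoint_closed_parts:
  assumes N: "is_net N" and L: "closed_part N L" "closed_part N L'" and disj: "L \<inter> L' = {}"
  shows "edges_of L \<inter> edges_of L' = {}"
proof -
  have "producer (links N) e \<in> K" if "closed_part N K" "e \<in> edges_of K" for K e
    using producer_in(1) producer_subset is_netD(1)[OF N] net_graph_closed_part[OF N that(1)]
      closed_partD(1)[OF that(1)] that(2) by metis
  then show ?thesis using L disj by blast
qed

lemma conclusion_of_closed_part:
  assumes N: "is_net N" and L: "closed_part N L" and l: "l \<in> links N - L" "e \<in> prems l"
    and "producer (links N) e \<in> L"
  shows "e \<in> conclusions_of L"
  unfolding conclusions_of_iff
proof (intro conjI ballI notI)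
  have "e \<in> edges N" using l edges_ofI(1) by blast
  then show "e \<in> edges_of L"
    using producer_in(2)[OF is_netD(1)[OF N]] assms(5) edges_ofI(2) by blast
  show False if "m \<in> L" "e \<in> prems m" for m
    using net_graph_prem_unique[OF is_netD(1)[OF N], of m l e] that l closed_partD(1)[OF L] by blast
qed

lemma fresh_for_closed_part:
  assumes N: "is_net N" and L: "closed_part N L" and l: "l \<in> links N - L"
  shows "concs l \<inter> edges_of L = {}"
proof -
  have "producer L e = l" if "e \<in> concs l" "e \<in> edges_of L" for e
    using producer_eq[OF is_netD(1)[OF N], of l e] l that
      producer_subset[OF is_netD(1)[OF N] net_graph_closed_part[OF N L] closed_partD(1)[OF L]
        that(2)]
    by simp
  then show ?thesis
    using producer_in(1)[OF net_graph_closed_part[OF N L]] l by fastforce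
qed

lemma boxes_of_closed_parts:
  assumes N: "is_net N" and L: "closed_part N L" "closed_part N L'"
    and cover: "\<And>l. l \<in> links N \<Longrightarrow> port_link l \<Longrightarrow> l \<in> L \<union> L'"
  shows "boxes N = boxes (restrict_net N L) \<union> boxes (restrict_net N L')"
proof -
  have "box_links b \<subseteq> L \<or> box_links b \<subseteq> L'" if b: "b \<in> boxes N" for b
  proof -
    have "port_link (principal b)"
      using delimits_box_port_link[OF is_netD(2)[OF N b]] by (simp add: ports_def)
    then have "principal b \<in> L \<union> L'"
      using cover is_netD(3)[OF N b] principal_in_box[of b] by blast
    then show ?thesis
      using closed_partD(3)[OF L(1) b principal_in_box] closed_partD(3)[OF L(2) b principal_in_box]
      by blast
  qed
  then show ?thesis by auto
qed

section \<open>Nets at depth zero\<close>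

lemma ex1_outermost_box:
  assumes N: "is_net N" and b: "b \<in> boxes N" "l \<in> box_links b"
  shows "\<exists>!b. b \<in> outermost_boxes N \<and> l \<in> box_links b"
proof (rule ex_ex1I)
  let ?F = "box_links ` {b \<in> boxes N. l \<in> box_links b}"
  have "?F \<subseteq> Pow (links N)"
    using is_netD(3)[OF N] by auto
  then have "finite ?F" "?F \<noteq> {}"
    using net_graph_finite[OF is_netD(1)[OF N]] b by (auto intro: finite_subset)
  then obtain c where c: "c \<in> boxes N" "l \<in> box_links c"
    and max: "\<And>b. b \<in> boxes N \<Longrightarrow> l \<in> box_links b \<Longrightarrow> box_links c \<subseteq> box_links b \<Longrightarrow>
      box_links c = box_links b"
    using finite_has_maximal[of ?F] by auto
  have "\<not> box_links c \<subseteq> content b" if "b \<in> boxes N" for b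
    using max[OF that] c(2) delimits_boxD(5)[OF is_netD(2)[OF N that]] by auto
  then show "\<exists>b. b \<in> outermost_boxes N \<and> l \<in> box_links b"
    using c by (auto simp: outermost_boxes_def)
next
  fix b c assume "b \<in> outermost_boxes N \<and> l \<in> box_links b" "c \<in> outermost_boxes N \<and> l \<in> box_links c"
  then show "b = c"
    using is_netD(5)[OF N, of b c] by (auto simp: outermost_boxes_def nested_or_disjoint_def)
qed

definition node_of :: "'a net \<Rightarrow> 'a link \<Rightarrow> 'a node" where
  "node_of N l = (if \<exists>b\<in>boxes N. l \<in> box_links b
     then BoxNode (THE b. b \<in> outermost_boxes N \<and> l \<in> box_links b) else LinkNode l)"

definition depth0_links :: "'a net \<Rightarrow> 'a link set" where
  "depth0_links N = links N - \<Union>(box_links ` boxes N)"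

lemma depth0_links_subset: "l \<in> depth0_links N \<Longrightarrow> l \<in> links N"
  by (simp add: depth0_links_def)

lemma node_of_depth0 [simp]: "l \<in> depth0_links N \<Longrightarrow> node_of N l = LinkNode l"
  by (auto simp: depth0_links_def node_of_def)

lemma node_of_eq_LinkNode_iff:
  "l \<in> links N \<Longrightarrow> node_of N l = LinkNode m \<longleftrightarrow> l = m \<and> m \<in> depth0_links N"
  by (auto simp: depth0_links_def node_of_def split: if_splits)

lemma node_of_outermost:
  assumes N: "is_net N" and b: "b \<in> outermost_boxes N" "l \<in> box_links b"
  shows "node_of N l = BoxNode b"
proof -
  have "b \<in> boxes N" using b(1) by (simp add: outermost_boxes_def)
  moreover have "(THE b. b \<in> outermost_boxes N \<and> l \<in> box_links b) = b"
    using the1_equality[OF ex1_outermost_box[OF N \<open>b \<in> boxes N\<close> b(2)]] b by blast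
  ultimately show ?thesis using b(2) by (auto simp: node_of_def)
qed

lemma node_of_box:
  assumes N: "is_net N" and b: "b \<in> boxes N" "l \<in> box_links b"
  obtains c where "c \<in> outermost_boxes N" "l \<in> box_links c" "node_of N l = BoxNode c"
  using ex1_outermost_box[OF assms] node_of_outermost[OF N] by blast

lemma collapses_to_iff:
  assumes N: "is_net N"
  shows "collapses_to N l x \<longleftrightarrow> l \<in> links N \<and> x = node_of N l"
proof (cases "\<exists>b\<in>boxes N. l \<in> box_links b")
  case True
  then obtain b where b: "b \<in> boxes N" "l \<in> box_links b" by blast
  then have "l \<in> links N" using is_netD(3)[OF N] by blast
  obtain c where c: "c \<in> outermost_boxes N" "l \<in> box_links c" "node_of N l = BoxNode c"
    by (rule node_of_box[OF N b])
  show ?thesis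
  proof (cases x)
    case (LinkNode m)
    then show ?thesis using True c(3) by auto
  next
    case (BoxNode b')
    have "b' \<in> outermost_boxes N \<and> l \<in> box_links b' \<longleftrightarrow> b' = c"
      using node_of_outermost[OF N, of b' l] c by auto
    then show ?thesis using BoxNode c(3) \<open>l \<in> links N\<close> by simp
  qed
next
  case False
  then show ?thesis
    by (cases x) (auto simp: node_of_def outermost_boxes_def)
qed

lemma node_of_same_box:
  assumes N: "is_net N" and b: "b \<in> boxes N" "k \<in> box_links b" "l \<in> box_links b"
  shows "node_of N k = node_of N l"
proof -
  obtain c where c: "c \<in> outermost_boxes N" "k \<in> box_links c" "node_of N k = BoxNode c"
    by (rule node_of_box[OF N b(1,2)])
  then have "c \<in> boxes N" "\<not> box_links c \<subseteq> content b"
    using b(1) by (auto simp: outermost_boxes_def)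
  then have "box_links b \<subseteq> box_links c"
    using is_netD(5)[OF N b(1), of c] b(2) c(2) delimits_boxD(5)[OF is_netD(2)[OF N, of c]]
    by (auto simp: nested_or_disjoint_def)
  then show ?thesis
    using node_of_outermost[OF N c(1)] c(3) b(3) by auto
qed

definition origin :: "'a net \<Rightarrow> 'a edge \<Rightarrow> 'a node" where
  "origin N e = node_of N (producer (links N) e)"

definition depth0_graph :: "'a net \<Rightarrow> ('a node \<times> 'a edge \<times> 'a node) set" where
  "depth0_graph N = {(origin N e, e, LinkNode m) | e m. m \<in> depth0_links N \<and> e \<in> prems m}"

lemma depth0_graph_iff:
  "s \<in> depth0_graph N \<longleftrightarrow> step_source s = origin N (step_edge s) \<and>
     (\<exists>m\<in>depth0_links N. step_target s = LinkNode m \<and> step_edge s \<in> prems m)"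
  by (cases s) (auto simp: depth0_graph_def)

lemma origin_premise_in_box:
  assumes N: "is_net N" and l: "l \<in> links N" "l \<notin> depth0_links N" "e \<in> prems l"
  shows "origin N e = node_of N l"
proof -
  obtain b where b: "b \<in> boxes N" "l \<in> box_links b"
    using l(1,2) by (auto simp: depth0_links_def)
  then have "producer (links N) e \<in> box_links b"
    using box_premise_producer[OF N b l(3)] by (simp add: box_links_def)
  then show ?thesis
    unfolding origin_def by (rule node_of_same_box[OF N b(1) _ b(2)])
qed

lemma switching_iff_nodes:
  assumes N: "is_net N"
  shows "s \<in> switching N c \<longleftrightarrow>
     (\<exists>m\<in>links N. step_source s = origin N (step_edge s) \<and> step_target s = node_of N m \<and>
        step_edge s \<in> prems m \<and> (switched m \<longrightarrow> step_edge s = c m)) \<and>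
     \<not> (\<exists>b. step_source s = BoxNode b \<and> step_target s = BoxNode b)"
proof -
  obtain x e y where s: "s = (x, e, y)" by (cases s)
  have origin: "(\<exists>l. l \<in> links N \<and> x = node_of N l \<and> e \<in> concs l) \<longleftrightarrow> x = origin N e"
    if "m \<in> links N" "e \<in> prems m" for m
    using producer_eq[OF is_netD(1)[OF N]] producer_in[OF is_netD(1)[OF N] edges_ofI(1)[OF that]]
    unfolding origin_def by metis
  have source: "(\<exists>l. l \<in> links N \<and> x = node_of N l \<and> e \<in> concs l) \<and> y = node_of N m \<and>
      e \<in> prems m \<and> (switched m \<longrightarrow> e = c m) \<longleftrightarrow>
      x = origin N e \<and> y = node_of N m \<and> e \<in> prems m \<and> (switched m \<longrightarrow> e = c m)"
    if "m \<in> links N" for m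
    using origin[OF that] by blast
  have "s \<in> switching N c \<longleftrightarrow> (\<exists>m\<in>links N. (\<exists>l. l \<in> links N \<and> x = node_of N l \<and> e \<in> concs l) \<and>
      y = node_of N m \<and> e \<in> prems m \<and> (switched m \<longrightarrow> e = c m)) \<and>
      \<not> (\<exists>b. x = BoxNode b \<and> y = BoxNode b)"
    unfolding switching_def s collapses_to_iff[OF N] by auto
  then show ?thesis
    using source by (simp add: s)
qed

lemma switching_iff:
  assumes N: "is_net N"
  shows "s \<in> switching N c \<longleftrightarrow> s \<in> depth0_graph N \<and>
     (\<forall>m. step_target s = LinkNode m \<longrightarrow> switched m \<longrightarrow> step_edge s = c m)"
proof (cases "step_target s")
  case (LinkNode m)
  have "(\<exists>k\<in>links N. step_target s = node_of N k \<and> step_edge s \<in> prems k \<and>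
      (switched k \<longrightarrow> step_edge s = c k)) \<longleftrightarrow>
      m \<in> depth0_links N \<and> step_edge s \<in> prems m \<and> (switched m \<longrightarrow> step_edge s = c m)"
    using node_of_eq_LinkNode_iff[of _ N m] depth0_links_subset[of m N] unfolding LinkNode by metis
  then show ?thesis
    unfolding switching_iff_nodes[OF N] depth0_graph_iff using LinkNode by auto
next
  case (BoxNode b)
  have "origin N (step_edge s) = BoxNode b"
    if "m \<in> links N" "node_of N m = BoxNode b" "step_edge s \<in> prems m" for m
    using origin_premise_in_box[OF N that(1) _ that(3)] that(2) by fastforce
  then have "s \<notin> switching N c"
    unfolding switching_iff_nodes[OF N] using BoxNode by metis
  then show ?thesis
    using BoxNode by (simp add: depth0_graph_iff)
qed

definition premise_cusp :: "'a net \<Rightarrow> 'a node \<Rightarrow> 'a edge \<Rightarrow> 'a edge \<Rightarrow> bool" where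
  "premise_cusp N v e e' \<longleftrightarrow>
     (\<exists>m\<in>depth0_links N. v = LinkNode m \<and> switched m \<and> e \<in> prems m \<and> e' \<in> prems m)"

lemma inj_on_step_edge_depth0_graph:
  assumes N: "is_net N"
  shows "inj_on step_edge (depth0_graph N)"
proof (rule inj_onI)
  fix s t assume st: "s \<in> depth0_graph N" "t \<in> depth0_graph N" "step_edge s = step_edge t"
  obtain m where m: "m \<in> links N" "step_target s = LinkNode m" "step_edge s \<in> prems m"
    using st(1) by (auto simp: depth0_graph_iff dest: depth0_links_subset)
  obtain k where k: "k \<in> links N" "step_target t = LinkNode k" "step_edge t \<in> prems k"
    using st(2) by (auto simp: depth0_graph_iff dest: depth0_links_subset)
  have "m = k"
    using net_graph_prem_unique[OF is_netD(1)[OF N] m(1) k(1) m(3)] k(3) st(3) by simp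
  then show "s = t"
    using st m(2) k(2) by (cases s; cases t) (simp add: depth0_graph_iff)
qed

lemma finite_depth0_graph:
  assumes N: "is_net N"
  shows "finite (depth0_graph N)"
proof (rule inj_on_finite[OF inj_on_step_edge_depth0_graph[OF N]])
  show "step_edge ` depth0_graph N \<subseteq> edges N"
  proof (rule image_subsetI)
    fix s assume "s \<in> depth0_graph N"
    then obtain m where "m \<in> links N" "step_edge s \<in> prems m"
      by (auto simp: depth0_graph_iff dest: depth0_links_subset)
    then show "step_edge s \<in> edges N" by (rule edges_ofI(1))
  qed
  show "finite (edges N)" by (rule net_graph_finite_edges[OF is_netD(1)[OF N]])
qed

definition DR_acyclic :: "'a net \<Rightarrow> bool" where
  "DR_acyclic N \<longleftrightarrow> (\<forall>c. switching_choice N c \<longrightarrow> acyclic_graph (switching N c))"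

lemma DR_correct_iff:
  "DR_correct N \<longleftrightarrow> DR_acyclic N \<and> (\<forall>b\<in>boxes N. DR_correct (box_net N b))"
  by (subst DR_correct.simps) (auto simp: DR_acyclic_def acyclic_graph_def)

definition choice_through :: "'a edge set \<Rightarrow> 'a link \<Rightarrow> 'a edge" where
  "choice_through E m = (if E \<inter> prems m \<noteq> {} then SOME e. e \<in> E \<inter> prems m else SOME e. e \<in> prems m)"

lemma choice_through_in: "E \<inter> prems m \<noteq> {} \<Longrightarrow> choice_through E m \<in> E \<inter> prems m"
  by (simp only: choice_through_def some_in_eq if_True not_False_eq_True)

lemma switching_choice_through: "switching_choice N (choice_through E)"
proof -
  have "choice_through E m \<in> prems m" if "prems m \<noteq> {}" for m
  proof (cases "E \<inter> prems m = {}")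
    case True
    then show ?thesis using that by (simp only: choice_through_def some_in_eq if_False simp_thms)
  next
    case False
    then show ?thesis using choice_through_in by blast
  qed
  then show ?thesis by (simp add: switching_choice_def)
qed

lemma DR_acyclic_no_cycle_through:
  assumes "is_net N" "DR_acyclic N" "cycle G p" "set p \<subseteq> sym_steps (switching N (choice_through E))"
  shows False
  using assms switching_choice_through[of N E]
  by (auto simp: DR_acyclic_def acyclic_graph_def cycle_iff_simple_circuit simple_circuit_def)

context cusped_graph
begin

lemma smooth_cycle_no_cusp:
  assumes p: "cycle G p" "cyclically smooth p"
    and st: "s \<in> set p" "t \<in> set p" "step_edge s \<noteq> step_edge t"
    and v: "step_source s = v \<or> step_target s = v" "step_source t = v \<or> step_target t = v"
  shows "\<not> cusp v (step_edge s) (step_edge t)"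
proof -
  have "v \<in> sources p"
    using v(1) p(1) source_in_sources[OF st(1)] target_in_targets[OF st(1)]
      simple_circuit_targets(2)
    unfolding cycle_iff_simple_circuit by metis
  then obtain q u r where u: "p = q @ u # r" "step_source u = v"
    by (metis in_sources_iff split_list)
  have smooth: "cyclically smooth (u # r @ q)"
    using p(2) cyclically_rotate[of smooth q "u # r"] by (simp add: u(1))
  define x where "x = last (u # r @ q)"
  have x: "x \<in> set p" "smooth x u" "step_target x = v"
    using smooth last_in_set[of "u # r @ q"] u by (auto simp: x_def cyclically_def smooth_def)
  have "distinct (map step_source p)" "distinct (map step_target p)"
    using p(1) simple_circuit_targets(1)[of G p]
    by (auto simp: cycle_iff_simple_circuit simple_circuit_def)
  then have inj: "inj_on step_source (set p)" "inj_on step_target (set p)"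
    by (simp_all add: distinct_map)
  have only: "y = u \<or> y = x" if "y \<in> set p" "step_source y = v \<or> step_target y = v" for y
    using that x(1,3) u inj_on_eq_iff[OF inj(1), of y u] inj_on_eq_iff[OF inj(2), of y x] by auto
  have "s = u \<and> t = x \<or> s = x \<and> t = u"
    using only[OF st(1) v(1)] only[OF st(2) v(2)] st(3) by auto
  then show ?thesis
    using x(2,3) cusp_sym by (auto simp: smooth_def)
qed

end

lemma cusped_graph_depth0_graph:
  assumes N: "is_net N" and acyclic: "DR_acyclic N"
  shows "cusped_graph (depth0_graph N) (premise_cusp N)"
proof
  show "finite (depth0_graph N)" by (rule finite_depth0_graph[OF N])
  show "inj_on step_edge (depth0_graph N)" by (rule inj_on_step_edge_depth0_graph[OF N])
  show "step_source s \<noteq> step_target s" if s: "s \<in> depth0_graph N" for s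
  proof
    assume "step_source s = step_target s"
    then have "cycle (depth0_graph N) [s]"
      using s by (simp add: cycle_iff_simple_circuit simple_circuit_def cyclically_def in_sym_steps)
    moreover have "s \<in> switching N (choice_through {step_edge s})"
      using s unfolding switching_iff[OF N] by (auto simp: depth0_graph_iff choice_through_def)
    ultimately show False
      using DR_acyclic_no_cycle_through[OF N acyclic, of _ "[s]"] by (auto simp: in_sym_steps)
  qed
  show "premise_cusp N v e' e" if "premise_cusp N v e e'" for v e e'
    using that by (auto simp: premise_cusp_def)
  show "premise_cusp N v e e''" if "premise_cusp N v e e'" "premise_cusp N v e' e''" for v e e' e''
    using that by (auto simp: premise_cusp_def)
  show "\<exists>s\<in>depth0_graph N. step_edge s = e \<and> step_target s = v"
    if cusp: "premise_cusp N v e e'" for v e e'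
  proof -
    obtain m where "m \<in> depth0_links N" "v = LinkNode m" "e \<in> prems m"
      using cusp by (auto simp: premise_cusp_def)
    then have "(origin N e, e, v) \<in> depth0_graph N" by (auto simp: depth0_graph_def)
    then show ?thesis by force
  qed
qed

lemma depth0_step_incident:
  assumes N: "is_net N" and s: "s \<in> sym_steps (depth0_graph N)"
    and m: "m \<in> depth0_links N" "step_edge s \<in> prems m"
  shows "step_source s = LinkNode m \<or> step_target s = LinkNode m"
proof -
  have "step_target t = LinkNode m" if "t \<in> depth0_graph N" "step_edge t = step_edge s" for t
    using that m net_graph_prem_unique[OF is_netD(1)[OF N] _ _ m(2)]
    by (auto simp: depth0_graph_iff dest!: depth0_links_subset)
  from this[of s] this[of "rev_step s"] show ?thesis
    using s by (auto simp: in_sym_steps)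
qed

lemma steps_in_switching:
  assumes N: "is_net N" and steps: "set p \<subseteq> sym_steps (depth0_graph N)"
    and unique: "\<And>m s t. m \<in> depth0_links N \<Longrightarrow> switched m \<Longrightarrow> s \<in> set p \<Longrightarrow> t \<in> set p \<Longrightarrow>
      step_edge s \<in> prems m \<Longrightarrow> step_edge t \<in> prems m \<Longrightarrow> step_edge s = step_edge t"
  shows "set p \<subseteq> sym_steps (switching N (choice_through (step_edge ` set p)))"
proof
  let ?c = "choice_through (step_edge ` set p)"
  have in_switching: "s \<in> switching N ?c"
    if s: "s \<in> depth0_graph N" and t: "t \<in> set p" "step_edge t = step_edge s" for s t
    unfolding switching_iff[OF N]
  proof (intro conjI allI impI, rule s)
    fix m assume m: "step_target s = LinkNode m" "switched m"
    then have prem: "m \<in> depth0_links N" "step_edge t \<in> prems m"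
      using s t(2) by (auto simp: depth0_graph_iff)
    then have "?c m \<in> step_edge ` set p \<inter> prems m"
      using t(1) by (intro choice_through_in) blast
    then show "step_edge s = ?c m"
      using unique[OF prem(1) m(2) t(1) _ prem(2)] t(2) by auto
  qed
  show "t \<in> sym_steps (switching N ?c)" if t: "t \<in> set p" for t
    using subsetD[OF steps t] in_switching[of t t] in_switching[of "rev_step t" t] t
    by (auto simp: in_sym_steps)
qed

lemma cuspfree_acyclic_depth0_graph:
  assumes N: "is_net N" and acyclic: "DR_acyclic N"
  shows "cuspfree_acyclic (depth0_graph N) (premise_cusp N)"
proof -
  interpret cusped_graph "depth0_graph N" "premise_cusp N"
    by (rule cusped_graph_depth0_graph[OF N acyclic])
  show ?thesis
  proof
    fix p assume p: "cycle (depth0_graph N) p"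
    then have steps: "set p \<subseteq> sym_steps (depth0_graph N)"
      by (simp add: cycle_iff_simple_circuit simple_circuit_def)
    show "\<not> cyclically smooth p"
    proof
      assume smooth: "cyclically smooth p"
      have "step_edge s = step_edge t"
        if "m \<in> depth0_links N" "switched m" "s \<in> set p" "t \<in> set p"
          "step_edge s \<in> prems m" "step_edge t \<in> prems m" for m s t
      proof (rule ccontr)
        assume "step_edge s \<noteq> step_edge t"
        then have "\<not> premise_cusp N (LinkNode m) (step_edge s) (step_edge t)"
          using that steps
          by (intro smooth_cycle_no_cusp[OF p smooth] depth0_step_incident[OF N]) auto
        then show False using that by (auto simp: premise_cusp_def)
      qed
      then show False
        by (rule DR_acyclic_no_cycle_through[OF N acyclic p steps_in_switching[OF N steps]])
    qed
  qed
qed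

lemma node_of_restrict_net:
  assumes N: "is_net N" and L: "closed_part N L" and l: "l \<in> L"
  shows "node_of (restrict_net N L) l = node_of N l"
proof (cases "\<exists>b\<in>boxes N. l \<in> box_links b")
  case True
  then obtain b where b: "b \<in> boxes N" "l \<in> box_links b" by blast
  obtain c where c: "c \<in> outermost_boxes N" "l \<in> box_links c" "node_of N l = BoxNode c"
    by (rule node_of_box[OF N b])
  then have "c \<in> outermost_boxes (restrict_net N L)"
    using closed_partD(3)[OF L, of c l] l by (auto simp: outermost_boxes_def)
  then show ?thesis
    using node_of_outermost[OF is_net_closed_part[OF N L]] c by simp
qed (auto simp: node_of_def)

lemma depth0_links_restrict_net:
  assumes L: "closed_part N L"
  shows "depth0_links (restrict_net N L) = depth0_links N \<inter> L"
proof -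
  have "(\<exists>b\<in>boxes N. box_links b \<subseteq> L \<and> l \<in> box_links b) \<longleftrightarrow> (\<exists>b\<in>boxes N. l \<in> box_links b)"
    if "l \<in> L" for l
    using closed_partD(3)[OF L _ _ that] by blast
  then show ?thesis
    using closed_partD(1)[OF L] by (auto simp: depth0_links_def)
qed

lemma origin_restrict_net:
  assumes N: "is_net N" and L: "closed_part N L" and e: "e \<in> edges_of L"
  shows "origin (restrict_net N L) e = origin N e"
proof -
  note G = net_graph_closed_part[OF N L]
  have "producer L e = producer (links N) e"
    by (rule producer_subset[OF is_netD(1)[OF N] G closed_partD(1)[OF L] e])
  then show ?thesis
    using node_of_restrict_net[OF N L producer_in(1)[OF G e]] by (simp add: origin_def)
qed

lemma depth0_graph_restrict_net:
  fixes N :: "'a net"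
  assumes N: "is_net N" and L: "closed_part N L"
  shows "depth0_graph (restrict_net N L) = {s \<in> depth0_graph N. \<exists>m\<in>L. step_target s = LinkNode m}"
proof (rule set_eqI)
  fix s :: "'a node \<times> 'a edge \<times> 'a node"
  have "origin (restrict_net N L) (step_edge s) = origin N (step_edge s)"
    if "m \<in> L" "step_edge s \<in> prems m" for m
    by (rule origin_restrict_net[OF N L edges_ofI(1)[OF that]])
  then show "s \<in> depth0_graph (restrict_net N L) \<longleftrightarrow>
      s \<in> {s \<in> depth0_graph N. \<exists>m\<in>L. step_target s = LinkNode m}"
    by (auto simp: depth0_graph_iff depth0_links_restrict_net[OF L])
qed

lemma switching_restrict_net:
  assumes N: "is_net N" and L: "closed_part N L"
  shows "switching (restrict_net N L) c = {s \<in> switching N c. \<exists>m\<in>L. step_target s = LinkNode m}"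
  using switching_iff[OF is_net_closed_part[OF N L], of _ c] switching_iff[OF N, of _ c]
  by (auto simp: depth0_graph_restrict_net[OF N L])

lemma box_net_restrict_net: "box_links b \<subseteq> L \<Longrightarrow> box_net (restrict_net N L) b = box_net N b"
  by (auto simp: box_net_def box_links_def)

lemma DR_correct_closed_part:
  assumes N: "is_net N" and DR: "DR_correct N" and L: "closed_part N L"
  shows "DR_correct (restrict_net N L)"
  unfolding DR_correct_iff[of "restrict_net N L"]
proof
  show "DR_acyclic (restrict_net N L)"
    unfolding DR_acyclic_def
  proof (intro allI impI)
    fix c assume c: "switching_choice (restrict_net N L) c"
    let ?c = "\<lambda>m. if m \<in> L then c m else choice_through {} m"
    have "switching_choice N ?c"
      using c switching_choice_through[of N "{}"] by (auto simp: switching_choice_def)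
    moreover have "switching (restrict_net N L) c \<subseteq> switching N ?c"
      unfolding switching_restrict_net[OF N L] using switching_iff[OF N] by auto
    ultimately show "acyclic_graph (switching (restrict_net N L) c)"
      using DR acyclic_graph_mono unfolding DR_correct_iff[of N] DR_acyclic_def by blast
  qed
  show "\<forall>b\<in>boxes (restrict_net N L). DR_correct (box_net (restrict_net N L) b)"
    using DR unfolding DR_correct_iff[of N] by (simp add: box_net_restrict_net)
qed

definition part :: "'a net \<Rightarrow> 'a node set \<Rightarrow> 'a link set" where
  "part N X = {l \<in> links N. node_of N l \<in> X}"

lemma closed_part_part:
  assumes N: "is_net N" and X: "\<And>s. s \<in> depth0_graph N \<Longrightarrow> step_target s \<in> X \<Longrightarrow> step_source s \<in> X"
  shows "closed_part N (part N X)"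
proof -
  have "origin N e \<in> X" if l: "l \<in> part N X" "e \<in> prems l" for l e
  proof (cases "l \<in> depth0_links N")
    case True
    then have "(origin N e, e, LinkNode l) \<in> depth0_graph N" "LinkNode l \<in> X"
      using l by (auto simp: depth0_graph_def part_def)
    then show ?thesis using X by force
  next
    case False
    then show ?thesis
      using origin_premise_in_box[OF N _ False l(2)] l(1) by (simp add: part_def)
  qed
  then have "producer (links N) e \<in> part N X" if "l \<in> part N X" "e \<in> prems l" for l e
    using that producer_in(1)[OF is_netD(1)[OF N], of e] edges_ofI(1)[of l "links N" e]
    by (auto simp: part_def origin_def)
  moreover have "box_links b \<subseteq> part N X"
    if b: "b \<in> boxes N" "k \<in> box_links b" "k \<in> part N X" for b k
    using b(3) node_of_same_box[OF N b(1) b(2)] is_netD(3)[OF N b(1)] by (auto simp: part_def)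
  moreover have "part N X \<subseteq> links N"
    by (auto simp: part_def)
  ultimately show ?thesis
    unfolding closed_part_def by blast
qed

section \<open>Correct nets are sequentializable\<close>

definition terminal :: "'a net \<Rightarrow> 'a link \<Rightarrow> bool" where
  "terminal N l \<longleftrightarrow> l \<in> depth0_links N \<and> (\<forall>m\<in>links N. concs l \<inter> prems m = {})"

fun negative :: "'a link \<Rightarrow> bool" where
  "negative (BottomLink c) = True"
| "negative (ParLink a b c) = True"
| "negative (WhyNotLink E c) = True"
| "negative (FlatLink a c) = True"
| "negative (ParagraphLink a c) = True"
| "negative _ = False"

lemma add_negative_link:
  assumes "sequentializable M" "negative l" "typed l" "prems l \<subseteq> conclusions M"
      "concs l \<inter> edges M = {}"
  shows "sequentializable (add_link l M)"
  using assms by (cases l) (auto intro: sequentializable.intros)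

lemma depth0_not_port_link:
  assumes N: "is_net N" and "l \<in> depth0_links N"
  shows "\<not> port_link l"
  using is_netD(4)[OF N, of l] assms(2) by (auto simp: depth0_links_def box_links_def)

lemma sequentializable_remove_negative:
  assumes N: "is_net N" and l: "terminal N l" "negative l"
    and rest: "closed_part N (links N - {l}) \<Longrightarrow> sequentializable (restrict_net N (links N - {l}))"
  shows "sequentializable N"
proof -
  let ?L = "links N - {l}"
  have lN: "l \<in> links N" "\<And>b. b \<in> boxes N \<Longrightarrow> l \<notin> box_links b"
    using l(1) by (auto simp: terminal_def depth0_links_def)
  have producer: "producer (links N) e \<in> ?L" if "k \<in> links N" "e \<in> prems k" for k e
    using producer_in[OF is_netD(1)[OF N] edges_ofI(1)[OF that]] that l(1)
    by (auto simp: terminal_def)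
  then have L: "closed_part N ?L"
    using is_netD(3)[OF N] lN by (auto simp: closed_part_def)
  have "prems l \<subseteq> conclusions_of ?L"
    using conclusion_of_closed_part[OF N L] producer lN(1) by blast
  moreover have "concs l \<inter> edges_of ?L = {}"
    using fresh_for_closed_part[OF N L] lN(1) by blast
  ultimately have "sequentializable (add_link l (restrict_net N ?L))"
    using rest[OF L] l(2) net_graph_typed[OF is_netD(1)[OF N] lN(1)]
    by (intro add_negative_link) simp_all
  moreover have "N = add_link l (restrict_net N ?L)"
    using lN is_netD(3)[OF N] by (cases N) (auto simp: add_link_def restrict_net_def)
  ultimately show ?thesis by simp
qed

lemma sequentializable_split:
  assumes N: "is_net N" and L: "closed_part N L" "closed_part N L'" "L \<inter> L' = {}"
    and l: "links N = insert l (L \<union> L')" "l \<notin> L \<union> L'" "l \<in> depth0_links N"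
      "l = CutLink a b \<or> (\<exists>c. l = TensorLink a b c)"
    and ab: "producer (links N) a \<in> L" "producer (links N) b \<in> L'"
    and seq: "sequentializable (restrict_net N L)" "sequentializable (restrict_net N L')"
  shows "sequentializable N"
proof -
  let ?M = "restrict_net N L" and ?M' = "restrict_net N L'"
  have lN: "l \<in> links N - L" "l \<in> links N - L'" and prems: "a \<in> prems l" "b \<in> prems l"
    using l by auto
  have conclusions: "a \<in> conclusions ?M" "b \<in> conclusions ?M'"
    using conclusion_of_closed_part[OF N L(1) lN(1) prems(1) ab(1)]
      conclusion_of_closed_part[OF N L(2) lN(2) prems(2) ab(2)] by simp_all
  have disjoint: "edges ?M \<inter> edges ?M' = {}"
    using edges_disjoint_closed_parts[OF N L] by simp
  have fresh: "concs l \<inter> (edges ?M \<union> edges ?M') = {}"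
    using fresh_for_closed_part[OF N L(1) lN(1)] fresh_for_closed_part[OF N L(2) lN(2)] by auto
  have typed: "typed l"
    using net_graph_typed[OF is_netD(1)[OF N]] lN by blast
  have "sequentializable (add_link l (juxtapose ?M ?M'))"
    using l(4)
  proof (elim disjE exE)
    assume "l = CutLink a b"
    then show ?thesis
      using sequentializable.cut[OF seq disjoint conclusions] typed by simp
  next
    fix c assume "l = TensorLink a b c"
    then show ?thesis
      using sequentializable.tensor[OF seq disjoint conclusions] typed fresh by simp
  qed
  moreover have "boxes N = boxes ?M \<union> boxes ?M'"
    using depth0_not_port_link[OF N l(3)] l(1) by (intro boxes_of_closed_parts[OF N L(1,2)]) auto
  then have "N = add_link l (juxtapose ?M ?M')"
    using l(1) by (cases N) (simp add: add_link_def juxtapose_def)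
  ultimately show ?thesis by simp
qed

lemma sequentializable_juxtapose_parts:
  assumes N: "is_net N" and L: "closed_part N L" "closed_part N L'" "L \<inter> L' = {}" "links N = L \<union> L'"
    and seq: "sequentializable (restrict_net N L)" "sequentializable (restrict_net N L')"
  shows "sequentializable N"
proof -
  have "boxes N = boxes (restrict_net N L) \<union> boxes (restrict_net N L')"
    using L(4) by (intro boxes_of_closed_parts[OF N L(1,2)]) auto
  then have "N = juxtapose (restrict_net N L) (restrict_net N L')"
    using L(4) by (cases N) (simp add: juxtapose_def)
  then show ?thesis
    using sequentializable.juxtaposition[OF seq] edges_disjoint_closed_parts[OF N L(1-3)] by simp
qed

lemma sequentializable_single_link:
  assumes "typed l" "prems l = {}" "\<not> port_link l"
  shows "sequentializable (Net {l} {})"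
proof (cases "negative l")
  case True
  then have "sequentializable (add_link l (Net {} {}))"
    using assms by (intro add_negative_link sequentializable.empty) (simp_all add: edges_of_def)
  then show ?thesis by (simp add: add_link_def)
next
  case False
  then show ?thesis
    using assms by (cases l) (auto intro: sequentializable.intros)
qed

lemma pax_links_as_image:
  assumes pax: "\<And>l. l \<in> P \<Longrightarrow> \<exists>a c. l = PaxLink a c"
    and disj: "disjoint_family_on prems P" "disjoint_family_on concs P"
  obtains f where "P = (\<lambda>e. PaxLink e (f e)) ` \<Union>(prems ` P)" "inj_on f (\<Union>(prems ` P))"
    "f ` \<Union>(prems ` P) = \<Union>(concs ` P)"
proof -
  have P: "\<exists>c. PaxLink e c \<in> P" if "e \<in> \<Union>(prems ` P)" for e
    using that pax by fastforce
  define f where "f e = (SOME c. PaxLink e c \<in> P)" for e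
  have f: "PaxLink e c \<in> P \<longleftrightarrow> e \<in> \<Union>(prems ` P) \<and> c = f e" for e c
  proof
    assume e: "PaxLink e c \<in> P"
    then have "PaxLink e (f e) \<in> P" unfolding f_def by (rule someI)
    then have "c = f e"
      using disjoint_family_onD[OF disj(1) e, of "PaxLink e (f e)"] by auto
    then show "e \<in> \<Union>(prems ` P) \<and> c = f e" using e by force
  next
    assume "e \<in> \<Union>(prems ` P) \<and> c = f e"
    then show "PaxLink e c \<in> P"
      using P[of e] someI_ex[of "\<lambda>c. PaxLink e c \<in> P"] by (simp add: f_def)
  qed
  have image: "P = (\<lambda>e. PaxLink e (f e)) ` \<Union>(prems ` P)"
    using f pax by (auto simp: image_iff) metis
  have "inj_on f (\<Union>(prems ` P))"
  proof (rule inj_onI)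
    fix e e' assume "e \<in> \<Union>(prems ` P)" "e' \<in> \<Union>(prems ` P)" "f e = f e'"
    then show "e = e'"
      using f disjoint_family_onD[OF disj(2), of "PaxLink e (f e)" "PaxLink e' (f e')"] by auto
  qed
  moreover have "\<Union>(concs ` P) = \<Union>(concs ` (\<lambda>e. PaxLink e (f e)) ` \<Union>(prems ` P))"
    using image by simp
  then have "f ` \<Union>(prems ` P) = \<Union>(concs ` P)" by auto
  ultimately show thesis using that image by blast
qed

lemma port_conclusions_fresh:
  assumes N: "is_net N" and b: "b \<in> boxes N" "l \<in> ports b"
  shows "concs l \<inter> edges_of (content b) = {}"
proof -
  note G = is_netD(1)[OF N] and box = delimits_boxD[OF is_netD(2)[OF N b(1)]]
  have False if e: "e \<in> concs l" "e \<in> edges_of (content b)" for e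
    using producer_in(1)[OF box(3) e(2)] producer_subset[OF G box(3) _ e(2)]
      producer_eq[OF G _ e(1)]
      b(2) box(1,2,5) by (auto simp: box_links_def)
  then show ?thesis by blast
qed

lemma net_of_single_box:
  assumes N: "is_net N" and b: "b \<in> boxes N" and all: "links N = box_links b"
  shows "N = Net (insert (principal b) (auxiliary b) \<union> links (box_net N b))
     (insert (Box (principal b) (auxiliary b) (links (box_net N b))) (boxes (box_net N b)))"
proof -
  have "box_links c \<subseteq> content b" if c: "c \<in> boxes N" "c \<noteq> b" for c
    using is_netD(5)[OF N c(1) b c(2)] is_netD(3)[OF N c(1)]
      delimits_boxD(5)[OF is_netD(2)[OF N c(1)]]
      all principal_in_box[of c] by (auto simp: nested_or_disjoint_def)
  then have "boxes N = insert b {c \<in> boxes N. box_links c \<subseteq> content b}"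
    using b by auto
  then show ?thesis
    using all by (cases N; cases b) (simp add: box_net_def box_links_def ports_def)
qed

lemma sequentializable_single_box:
  assumes N: "is_net N" and b: "b \<in> boxes N" and all: "links N = box_links b"
    and inner: "sequentializable (box_net N b)"
  shows "sequentializable N"
proof -
  note G = is_netD(1)[OF N] and delimits = is_netD(2)[OF N b]
  note box = delimits_boxD[OF delimits]
  have ports: "ports b \<subseteq> links N" using box(1) by (auto simp: box_links_def)
  then have families: "disjoint_family_on prems (ports b)" "disjoint_family_on concs (ports b)"
    using G by (auto simp: net_graph_iff intro: disjoint_family_on_mono)
  have typed: "typed l" if "l \<in> ports b" for l
    using net_graph_typed[OF G] ports that by blast
  note fresh = port_conclusions_fresh[OF N b]
  obtain a c where p: "principal b = OfCourseLink a c"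
    using delimits by (auto simp: delimits_box_def)
  define E where "E = \<Union>(prems ` auxiliary b)"
  have pax: "\<exists>a c. l = PaxLink a c" if "l \<in> auxiliary b" for l
    using delimits that by (auto simp: delimits_box_def)
  have aux: "auxiliary b \<subseteq> ports b" "principal b \<in> ports b" "principal b \<notin> auxiliary b"
    using pax[of "principal b"] p by (auto simp: ports_def)
  obtain f where f: "auxiliary b = (\<lambda>e. PaxLink e (f e)) ` E" "inj_on f E"
    "f ` E = \<Union>(concs ` auxiliary b)"
    unfolding E_def
    by (rule pax_links_as_image[OF pax disjoint_family_on_mono[OF aux(1) families(1)]
          disjoint_family_on_mono[OF aux(1) families(2)]])
  have "sequentializable (Net (insert (principal b) (auxiliary b) \<union> links (box_net N b))
      (insert (Box (principal b) (auxiliary b) (links (box_net N b))) (boxes (box_net N b))))"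
  proof (rule sequentializable.box[OF inner _ _ _ f(2) _ _ _ p f(1)])
    show "conclusions (box_net N b) = insert a E"
      using box(4) p by (simp add: box_net_def ports_def E_def)
    show "c \<notin> edges (box_net N b)" "typed (OfCourseLink a c)"
      using fresh[OF aux(2)] typed[OF aux(2)] p by (simp_all add: box_net_def)
    show "f ` E \<inter> edges (box_net N b) = {}"
      using fresh aux(1) unfolding f(3) by (auto simp: box_net_def)
    show "c \<notin> f ` E"
      using disjoint_family_onD[OF families(2) aux(2)] aux p unfolding f(3) by fastforce
    show "\<forall>e\<in>E. typed (PaxLink e (f e))"
      using typed aux(1) f(1) by blast
  qed
  then show ?thesis
    using net_of_single_box[OF N b all] by simp
qed

lemma part_iff: "l \<in> links N \<Longrightarrow> l \<in> part N X \<longleftrightarrow> node_of N l \<in> X"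
  by (simp add: part_def)

lemma terminal_if_no_outgoing:
  assumes N: "is_net N" and l: "l \<in> depth0_links N"
    and sink: "\<And>s. s \<in> depth0_graph N \<Longrightarrow> step_source s \<noteq> LinkNode l"
  shows "terminal N l"
  unfolding terminal_def
proof (intro conjI ballI l equals0I)
  fix m e assume m: "m \<in> links N" and "e \<in> concs l \<inter> prems m"
  then have e: "e \<in> concs l" "e \<in> prems m" by auto
  have producer: "producer (links N) e = l"
    using producer_eq[OF is_netD(1)[OF N] depth0_links_subset[OF l] e(1)] .
  show False
  proof (cases "m \<in> depth0_links N")
    case True
    then have "(origin N e, e, LinkNode m) \<in> depth0_graph N"
      using e(2) by (auto simp: depth0_graph_def)
    then show False
      using sink[of "(origin N e, e, LinkNode m)"] l by (simp add: origin_def producer)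
  next
    case False
    then obtain b where b: "b \<in> boxes N" "m \<in> box_links b"
      using m by (auto simp: depth0_links_def)
    then have "l \<in> content b"
      using box_premise_producer[OF N b e(2)] producer by simp
    then show False
      using l b(1) by (auto simp: depth0_links_def box_links_def)
  qed
qed

lemma bridge_parts:
  assumes N: "is_net N" and s: "s \<in> depth0_graph N" "bridge (depth0_graph N) s"
    and m: "step_target s = LinkNode m" "m \<in> depth0_links N" "e \<in> prems m" "e \<noteq> step_edge s"
    and sink: "\<And>t. t \<in> depth0_graph N \<Longrightarrow> step_source t \<noteq> LinkNode m"
  obtains L L' where "closed_part N L" "closed_part N L'" "L \<inter> L' = {}"
    "links N = insert m (L \<union> L')"
    "m \<notin> L \<union> L'" "producer (links N) (step_edge s) \<in> L" "producer (links N) e \<in> L'"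
proof -
  let ?G = "depth0_graph N"
  define X where "X = {x. connected_in (?G - {s}) (step_source s) x}"
  define Y where "Y = - X - {LinkNode m}"
  have m_notin: "LinkNode m \<notin> X" and "step_source s \<in> X"
    using s(2) m(1) by (auto simp: X_def bridge_def connected_in_refl)
  have step: "step_source t \<in> X \<longleftrightarrow> step_target t \<in> X" if "t \<in> ?G - {s}" for t
    using connected_in_step[of t "?G - {s}"] connected_in_sym[of "?G - {s}"]
      connected_in_trans[of "?G - {s}" "step_source s"] that
    unfolding X_def mem_Collect_eq in_sym_steps by blast
  have X: "step_source t \<in> X \<longleftrightarrow> step_target t \<in> X" if "t \<in> ?G" "step_target t \<noteq> LinkNode m" for t
    using step[of t] that m(1) by auto
  let ?t = "(origin N e, e, LinkNode m)"
  have "?t \<in> ?G - {s}"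
    using m by (auto simp: depth0_graph_def)
  then have "origin N e \<in> Y"
    using step[of ?t] sink[of ?t] m_notin by (auto simp: Y_def)
  moreover have "origin N (step_edge s) \<in> X"
    using s(1) \<open>step_source s \<in> X\<close> by (simp add: depth0_graph_iff)
  moreover have "producer (links N) (step_edge s) \<in> links N" "producer (links N) e \<in> links N"
    using producer_in(1)[OF is_netD(1)[OF N] edges_ofI(1)] depth0_links_subset[OF m(2)] m(3) s(1)
    by (auto simp: depth0_graph_iff m(1))
  ultimately have producers: "producer (links N) (step_edge s) \<in> part N X"
    "producer (links N) e \<in> part N Y"
    by (simp_all add: part_iff origin_def)
  have cover: "links N = insert m (part N X \<union> part N Y)"
    using node_of_eq_LinkNode_iff[of _ N m] depth0_links_subset[OF m(2)]
    by (auto simp: part_def Y_def)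
  show thesis
  proof (rule that[OF _ _ _ cover _ producers])
    show "closed_part N (part N X)"
      using X m_notin by (intro closed_part_part[OF N]) metis
    show "closed_part N (part N Y)"
      using X sink by (intro closed_part_part[OF N]) (auto simp: Y_def)
    show "part N X \<inter> part N Y = {}" "m \<notin> part N X \<union> part N Y"
      using m_notin m(2) by (auto simp: part_def Y_def)
  qed
qed

lemma dual_neq: "dual A \<noteq> A"
  by (induction A) auto

lemma cut_or_tensor:
  assumes "typed l" "\<not> negative l" "\<not> port_link l" "e \<in> prems l"
  obtains a b where "l = CutLink a b \<or> (\<exists>c. l = TensorLink a b c)" "a \<noteq> b" "e = a \<or> e = b"
proof -
  have "a \<noteq> b" if "l = CutLink a b" for a b
    using assms(1) dual_neq unfolding that by (metis label.inject(1) typed.simps(2))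
  then show thesis
    using that assms by (cases l) auto
qed

lemma sequentializable_bridge:
  assumes N: "is_net N" and s: "s \<in> depth0_graph N" "bridge (depth0_graph N) s"
    and m: "step_target s = LinkNode m" "m \<in> depth0_links N" "\<not> negative m" "step_edge s \<in> prems m"
    and sink: "\<And>t. t \<in> depth0_graph N \<Longrightarrow> step_source t \<noteq> LinkNode m"
    and parts: "\<And>L. closed_part N L \<Longrightarrow> L \<noteq> links N \<Longrightarrow> sequentializable (restrict_net N L)"
  shows "sequentializable N"
proof -
  have mN: "m \<in> links N" by (rule depth0_links_subset[OF m(2)])
  obtain a b where ab: "m = CutLink a b \<or> (\<exists>c. m = TensorLink a b c)" "a \<noteq> b"
      "step_edge s = a \<or> step_edge s = b"
    by (rule cut_or_tensor[OF net_graph_typed[OF is_netD(1)[OF N] mN] m(3)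
          depth0_not_port_link[OF N m(2)] m(4)])
  define e where "e = (if step_edge s = a then b else a)"
  have e: "e \<in> prems m" "e \<noteq> step_edge s"
    using ab by (auto simp: e_def)
  obtain L L' where L: "closed_part N L" "closed_part N L'" "L \<inter> L' = {}"
    "links N = insert m (L \<union> L')" "m \<notin> L \<union> L'"
    "producer (links N) (step_edge s) \<in> L" "producer (links N) e \<in> L'"
    by (rule bridge_parts[OF N s m(1,2) e sink])
  have seq: "sequentializable (restrict_net N L)" "sequentializable (restrict_net N L')"
    using parts L(1,2,4,5) by blast+
  show ?thesis
  proof (cases "step_edge s = a")
    case True
    then show ?thesis
      using sequentializable_split[OF N L(1-5) m(2) ab(1)] L(6,7) seq by (simp add: e_def)
  next
    case False
    then have "step_edge s = b" using ab(3) by simp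
    moreover have "L' \<inter> L = {}" "links N = insert m (L' \<union> L)" "m \<notin> L' \<union> L"
      using L(3-5) by auto
    ultimately show ?thesis
      using sequentializable_split[OF N L(2,1) _ _ _ m(2) ab(1)] L(6,7) seq False
      by (simp add: e_def)
  qed
qed

lemma sequentializable_nonempty_depth0:
  assumes N: "is_net N" and acyclic: "DR_acyclic N" and "depth0_graph N \<noteq> {}"
    and parts: "\<And>L. closed_part N L \<Longrightarrow> L \<noteq> links N \<Longrightarrow> sequentializable (restrict_net N L)"
  shows "sequentializable N"
proof -
  interpret cuspfree_acyclic "depth0_graph N" "premise_cusp N"
    by (rule cuspfree_acyclic_depth0_graph[OF N acyclic])
  obtain s where s: "s \<in> depth0_graph N"
    and sink: "\<And>t. t \<in> depth0_graph N \<Longrightarrow> step_source t \<noteq> step_target s"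
    and split: "(\<exists>e e'. premise_cusp N (step_target s) e e') \<or> bridge (depth0_graph N) s"
    by (rule splitting_step[OF \<open>depth0_graph N \<noteq> {}\<close>]) blast
  obtain m where m: "m \<in> depth0_links N" "step_target s = LinkNode m" "step_edge s \<in> prems m"
    using s by (auto simp: depth0_graph_iff)
  note sink' = sink[unfolded m(2)]
  show ?thesis
  proof (cases "negative m")
    case True
    then show ?thesis
      using depth0_links_subset[OF m(1)]
      by (intro parts
          sequentializable_remove_negative[OF N terminal_if_no_outgoing[OF N m(1) sink']]) auto
  next
    case False
    then have "\<not> switched m" by (cases m) auto
    then have "bridge (depth0_graph N) s"
      using split m(2) by (auto simp: premise_cusp_def)
    then show ?thesis
      by (rule sequentializable_bridge[OF N s _ m(2,1) False m(3) sink' parts])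
  qed
qed

lemma part_outermost_box:
  assumes N: "is_net N" and c: "c \<in> outermost_boxes N"
  shows "part N {BoxNode c} = box_links c"
proof (intro equalityI subsetI)
  fix l assume "l \<in> part N {BoxNode c}"
  then show "l \<in> box_links c"
    using collapses_to_iff[OF N, of l "BoxNode c"] by (simp add: part_def)
next
  fix l assume "l \<in> box_links c"
  then show "l \<in> part N {BoxNode c}"
    using node_of_outermost[OF N c] is_netD(3)[OF N, of c] c
    by (auto simp: part_def outermost_boxes_def)
qed

lemma sequentializable_single_node:
  assumes N: "is_net N" and empty: "depth0_graph N = {}" and k: "k \<in> links N"
    and inner: "\<And>b. b \<in> boxes N \<Longrightarrow> sequentializable (box_net N b)"
  shows "sequentializable (restrict_net N (part N {node_of N k}))"
proof -
  let ?L = "part N {node_of N k}"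
  have L: "closed_part N ?L"
    using empty by (intro closed_part_part[OF N]) auto
  show ?thesis
  proof (cases "k \<in> depth0_links N")
    case True
    then have "?L = {k}"
      using k node_of_eq_LinkNode_iff[of _ N k] by (auto simp: part_def)
    moreover have "\<not> box_links b \<subseteq> {k}" if "b \<in> boxes N" for b
      using that True principal_in_box[of b] by (auto simp: depth0_links_def)
    then have "restrict_net N {k} = Net {k} {}"
      by (auto simp: restrict_net_def)
    moreover have "prems k = {}"
      using True empty by (auto simp: depth0_graph_def)
    ultimately show ?thesis
      using sequentializable_single_link[of k] net_graph_typed[OF is_netD(1)[OF N] k] True
        depth0_not_port_link[OF N True] by simp
  next
    case False
    then obtain b where "b \<in> boxes N" "k \<in> box_links b"
      using k by (auto simp: depth0_links_def)
    then obtain c where c: "c \<in> outermost_boxes N" "k \<in> box_links c" "node_of N k = BoxNode c"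
      by (rule node_of_box[OF N])
    have "c \<in> boxes N" using c(1) by (simp add: outermost_boxes_def)
    moreover have "?L = box_links c"
      using part_outermost_box[OF N c(1)] c(3) by simp
    ultimately show ?thesis
      using sequentializable_single_box[OF is_net_closed_part[OF N L], of c] inner
        box_net_restrict_net[of c]
      by simp
  qed
qed

lemma sequentializable_empty_depth0:
  assumes N: "is_net N" and empty: "depth0_graph N = {}"
    and parts: "\<And>L. closed_part N L \<Longrightarrow> L \<noteq> links N \<Longrightarrow> sequentializable (restrict_net N L)"
    and inner: "\<And>b. b \<in> boxes N \<Longrightarrow> sequentializable (box_net N b)"
  shows "sequentializable N"
proof (cases "links N = {}")
  case True
  then have "N = Net {} {}"
    using is_netD(3)[OF N] principal_in_box by (cases N) fastforce
  then show ?thesis using sequentializable.empty by simp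
next
  case False
  then obtain k where k: "k \<in> links N" by blast
  let ?x = "node_of N k"
  have closed: "closed_part N (part N X)" for X
    using empty by (intro closed_part_part[OF N]) auto
  have "sequentializable (restrict_net N (part N (- {?x})))"
    using k by (intro parts closed) (auto simp: part_def)
  then show ?thesis
    using sequentializable_single_node[OF N empty k inner]
    by (intro sequentializable_juxtapose_parts[OF N closed[of "{?x}"] closed[of "- {?x}"]])
      (auto simp: part_def)
qed

theorem DR_correct_imp_sequentializable:
  "is_net N \<Longrightarrow> DR_correct N \<Longrightarrow> sequentializable N"
proof (induction "card (links N)" arbitrary: N rule: less_induct)
  case less
  note N = less.prems(1)
  have finite: "finite (links N)" by (rule net_graph_finite[OF is_netD(1)[OF N]])
  have parts: "sequentializable (restrict_net N L)" if L: "closed_part N L" "L \<noteq> links N" for L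
  proof -
    have "card L < card (links N)"
      using closed_partD(1)[OF L(1)] L(2) finite by (intro psubset_card_mono) auto
    then show ?thesis
      using less.hyps is_net_closed_part[OF N L(1)] DR_correct_closed_part[OF less.prems L(1)]
      by simp
  qed
  have inner: "sequentializable (box_net N b)" if b: "b \<in> boxes N" for b
  proof -
    have "content b \<subset> links N"
      using delimits_boxD(1,5)[OF is_netD(2)[OF N b]] by blast
    then have "card (links (box_net N b)) < card (links N)"
      using finite by (simp add: box_net_def psubset_card_mono)
    then show ?thesis
      using less.hyps is_net_box_net[OF N b] less.prems(2) b unfolding DR_correct_iff[of N] by blast
  qed
  have "DR_acyclic N"
    using less.prems(2) DR_correct_iff by blast
  then show ?case
    using sequentializable_empty_depth0[OF N _ parts inner]
      sequentializable_nonempty_depth0[OF N _ _ parts] by blast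
qed

section \<open>Sequentializable nets are correct\<close>

lemma juxtapose_simps [simp]:
  "links (juxtapose M N) = links M \<union> links N" "boxes (juxtapose M N) = boxes M \<union> boxes N"
  by (simp_all add: juxtapose_def)

lemma add_link_simps [simp]:
  "links (add_link l N) = insert l (links N)" "boxes (add_link l N) = boxes N"
  by (simp_all add: add_link_def)

lemma juxtapose_commute: "juxtapose M N = juxtapose N M"
  by (simp add: juxtapose_def Un_commute)

lemma links_disjoint: "edges_of L \<inter> edges_of L' = {} \<Longrightarrow> L \<inter> L' = {}"
  using incident_nonempty unfolding edges_of_def by fastforce

lemma sub_net_is_closed_part:
  assumes M: "is_net M" and N: "is_net N" and links: "links M \<subseteq> links N"
    and boxes: "boxes M \<subseteq> boxes N" "\<And>b. b \<in> boxes N \<Longrightarrow> b \<notin> boxes M \<Longrightarrow> box_links b \<inter> links M = {}"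
  shows "closed_part N (links M)" "restrict_net N (links M) = M"
proof -
  have "producer (links N) e \<in> links M" if "l \<in> links M" "e \<in> prems l" for l e
    using producer_in(1)[OF is_netD(1)[OF M] edges_ofI(1)[OF that]]
      producer_subset[OF is_netD(1)[OF N] is_netD(1)[OF M] links edges_ofI(1)[OF that]] by simp
  moreover have "box_links b \<subseteq> links M" if "b \<in> boxes N" "box_links b \<inter> links M \<noteq> {}" for b
    using that boxes(2) is_netD(3)[OF M] by blast
  ultimately show "closed_part N (links M)"
    using links unfolding closed_part_def by blast
  have "boxes M = {b \<in> boxes N. box_links b \<subseteq> links M}"
    using boxes is_netD(3)[OF M] principal_in_box by blast
  then show "restrict_net N (links M) = M"
    by (cases M) (simp add: restrict_net_def)
qed

definition nodes :: "'a net \<Rightarrow> 'a node set" where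
  "nodes N = node_of N ` links N"

lemma node_of_in_nodes: "l \<in> links N \<Longrightarrow> node_of N l \<in> nodes N"
  by (simp add: nodes_def)

lemma origin_in_nodes: "is_net N \<Longrightarrow> e \<in> edges N \<Longrightarrow> origin N e \<in> nodes N"
  unfolding origin_def using producer_in(1)[OF is_netD(1)] by (intro node_of_in_nodes)

lemma LinkNode_in_nodes: "LinkNode l \<in> nodes N \<Longrightarrow> l \<in> links N"
  using node_of_eq_LinkNode_iff[of _ N l] by (auto simp: nodes_def dest: sym)

lemma switching_nodes:
  assumes N: "is_net N" and s: "s \<in> switching N c"
  shows "step_source s \<in> nodes N \<and> step_target s \<in> nodes N"
proof -
  obtain m where m: "m \<in> depth0_links N" "step_target s = LinkNode m" "step_edge s \<in> prems m"
    "step_source s = origin N (step_edge s)"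
    using s by (auto simp: switching_iff[OF N] depth0_graph_iff)
  then show ?thesis
    using origin_in_nodes[OF N edges_ofI(1)[OF depth0_links_subset[OF m(1)] m(3)]]
      node_of_in_nodes[OF depth0_links_subset[OF m(1)]] by simp
qed

lemma nodes_disjoint:
  assumes M: "is_net M" and N: "is_net N" and disj: "links M \<inter> links N = {}"
  shows "nodes M \<inter> nodes N = {}"
proof -
  have False if "l \<in> links M" "k \<in> links N" "node_of M l = node_of N k" for l k
  proof -
    have collapses: "collapses_to M l (node_of M l)" "collapses_to N k (node_of M l)"
      using that collapses_to_iff[OF M] collapses_to_iff[OF N] by auto
    show False
    proof (cases "node_of M l")
      case (LinkNode m)
      then show False using collapses that disj by auto
    next
      case (BoxNode b)
      then have "b \<in> boxes M" "b \<in> boxes N" "l \<in> box_links b"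
        using collapses by (auto simp: outermost_boxes_def)
      then show False
        using is_netD(3)[OF M] is_netD(3)[OF N] disj by blast
    qed
  qed
  then show ?thesis by (auto simp: nodes_def)
qed

subsection \<open>Juxtaposition\<close>

lemma is_net_juxtapose:
  assumes M: "is_net M" and N: "is_net N" and disj: "edges M \<inter> edges N = {}"
  shows "is_net (juxtapose M N)"
  unfolding is_net_iff juxtapose_simps
proof (intro conjI ballI impI)
  show "net_graph (links M \<union> links N)"
    using is_netD(1)[OF M] is_netD(1)[OF N] disj
    by (intro net_graph_extend) (auto simp: net_graph_iff edges_of_def)
  show "delimits_box (links M \<union> links N) b" if "b \<in> boxes M \<union> boxes N" for b
    using that is_netD(2,3)[OF M, of b] is_netD(2,3)[OF N, of b] delimits_box_mono by blast
  show "\<exists>b\<in>boxes M \<union> boxes N. l \<in> ports b" if "l \<in> links M \<union> links N" "port_link l" for l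
    using that is_netD(4)[OF M, of l] is_netD(4)[OF N, of l] by blast
  have "nested_or_disjoint b b'" "nested_or_disjoint b' b" if "b \<in> boxes M" "b' \<in> boxes N" for b b'
    using is_netD(3)[OF M that(1)] is_netD(3)[OF N that(2)] links_disjoint[OF disj]
    by (auto simp: nested_or_disjoint_def)
  then show "pairwise nested_or_disjoint (boxes M \<union> boxes N)"
    using M N by (auto simp: is_net_iff pairwise_def)
qed

lemma closed_part_juxtapose:
  assumes M: "is_net M" and N: "is_net N" and disj: "edges M \<inter> edges N = {}"
  shows "closed_part (juxtapose M N) (links M)" "restrict_net (juxtapose M N) (links M) = M"
    "closed_part (juxtapose M N) (links N)" "restrict_net (juxtapose M N) (links N) = N"
proof -
  have J: "is_net (juxtapose M N)" by (rule is_net_juxtapose[OF assms])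
  have "box_links b \<inter> links N = {}" if "b \<in> boxes M" for b
    using is_netD(3)[OF M that] links_disjoint[OF disj] by blast
  then show "closed_part (juxtapose M N) (links N)" "restrict_net (juxtapose M N) (links N) = N"
    by (intro sub_net_is_closed_part[OF N J]; auto)+
  have "box_links b \<inter> links M = {}" if "b \<in> boxes N" for b
    using is_netD(3)[OF N that] links_disjoint[OF disj] by blast
  then show "closed_part (juxtapose M N) (links M)" "restrict_net (juxtapose M N) (links M) = M"
    by (intro sub_net_is_closed_part[OF M J]; auto)+
qed

lemma switching_juxtapose:
  assumes "is_net M" "is_net N" "edges M \<inter> edges N = {}"
  shows "switching (juxtapose M N) c = switching M c \<union> switching N c"
proof -
  note J = is_net_juxtapose[OF assms] and parts = closed_part_juxtapose[OF assms]
  have "\<exists>m\<in>links M \<union> links N. step_target s = LinkNode m" if "s \<in> switching (juxtapose M N) c" for s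
    using that depth0_links_subset[of _ "juxtapose M N"]
    by (auto simp: switching_iff[OF J] depth0_graph_iff)
  then show ?thesis
    using switching_restrict_net[OF J parts(1), of c] switching_restrict_net[OF J parts(3), of c]
    unfolding parts(2,4) by blast
qed

lemma DR_correct_juxtapose:
  assumes M: "is_net M" "DR_correct M" and N: "is_net N" "DR_correct N"
    and disj: "edges M \<inter> edges N = {}"
  shows "DR_correct (juxtapose M N)"
  unfolding DR_correct_iff[of "juxtapose M N"]
proof
  note parts = closed_part_juxtapose[OF M(1) N(1) disj]
  have nodes: "nodes M \<inter> nodes N = {}"
    by (rule nodes_disjoint[OF M(1) N(1) links_disjoint[OF disj]])
  show "DR_acyclic (juxtapose M N)"
    unfolding DR_acyclic_def switching_juxtapose[OF M(1) N(1) disj]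
  proof (intro allI impI)
    fix c assume "switching_choice (juxtapose M N) c"
    then have "acyclic_graph (switching M c)" "acyclic_graph (switching N c)"
      using M(2) N(2) unfolding DR_correct_iff[of M] DR_correct_iff[of N] DR_acyclic_def
      by (auto simp: switching_choice_def)
    then show "acyclic_graph (switching M c \<union> switching N c)"
      using switching_nodes[OF M(1)] switching_nodes[OF N(1)] nodes
      by (intro acyclic_graph_Un[where V = "nodes M"]) blast+
  qed
  have "box_net (juxtapose M N) b = box_net M b" if "b \<in> boxes M" for b
    using box_net_restrict_net[OF is_netD(3)[OF M(1) that], of "juxtapose M N"] parts(2) by simp
  moreover have "box_net (juxtapose M N) b = box_net N b" if "b \<in> boxes N" for b
    using box_net_restrict_net[OF is_netD(3)[OF N(1) that], of "juxtapose M N"] parts(4) by simp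
  ultimately show "\<forall>b\<in>boxes (juxtapose M N). DR_correct (box_net (juxtapose M N) b)"
    using M(2) N(2) unfolding DR_correct_iff[of M] DR_correct_iff[of N] by auto
qed

subsection \<open>Adding a link\<close>

definition addable :: "'a link \<Rightarrow> 'a net \<Rightarrow> bool" where
  "addable l M \<longleftrightarrow> typed l \<and> prems l \<subseteq> conclusions M \<and> concs l \<inter> edges M = {} \<and> \<not> port_link l"

lemma addable_new:
  assumes "addable l M"
  shows "l \<notin> links M"
proof
  assume l: "l \<in> links M"
  obtain e where "e \<in> prems l \<union> concs l" using incident_nonempty by blast
  then show False
    using assms l edges_ofI(2)[OF l] by (auto simp: addable_def conclusions_of_iff)
qed

lemma net_graph_insert:
  assumes "net_graph L" "typed l" "prems l \<subseteq> conclusions_of L" "concs l \<inter> edges_of L = {}"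
  shows "net_graph (insert l L)"
  using net_graph_extend[of L "{l}"] assms by (auto simp: disjoint_family_on_def)

lemma is_net_add_link:
  assumes M: "is_net M" and l: "addable l M"
  shows "is_net (add_link l M)"
  unfolding is_net_iff add_link_simps
proof (intro conjI ballI impI)
  show "net_graph (insert l (links M))"
    using net_graph_insert[OF is_netD(1)[OF M]] l by (simp add: addable_def)
  show "delimits_box (insert l (links M)) b" if "b \<in> boxes M" for b
    using is_netD(2,3)[OF M that] delimits_box_mono by blast
  show "\<exists>b\<in>boxes M. k \<in> ports b" if "k \<in> insert l (links M)" "port_link k" for k
    using that is_netD(4)[OF M, of k] l by (auto simp: addable_def)
  show "pairwise nested_or_disjoint (boxes M)"
    using M by (simp add: is_net_iff)
qed

definition steps_into ::
  "'a link \<Rightarrow> 'a net \<Rightarrow> ('a link \<Rightarrow> 'a edge) \<Rightarrow> ('a node \<times> 'a edge \<times> 'a node) set" where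
  "steps_into l M c = {(origin M e, e, LinkNode l) | e. e \<in> prems l \<and> (switched l \<longrightarrow> e = c l)}"

lemma switching_add_link:
  assumes M: "is_net M" and l: "addable l M"
  shows "switching (add_link l M) c \<subseteq> switching M c \<union> steps_into l M c"
proof
  note N = is_net_add_link[OF assms]
  have part: "closed_part (add_link l M) (links M)" "restrict_net (add_link l M) (links M) = M"
    by (intro sub_net_is_closed_part[OF M N]; auto)+
  fix s assume s: "s \<in> switching (add_link l M) c"
  then obtain m where m: "m \<in> links (add_link l M)" "step_target s = LinkNode m"
    "step_edge s \<in> prems m"
      "step_source s = origin (add_link l M) (step_edge s)" "switched m \<longrightarrow> step_edge s = c m"
    using depth0_links_subset[of _ "add_link l M"]
    by (auto simp: switching_iff[OF N] depth0_graph_iff)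
  show "s \<in> switching M c \<union> steps_into l M c"
  proof (cases "m = l")
    case True
    then have "step_edge s \<in> edges M"
      using l m(3) by (auto simp: addable_def conclusions_of_iff)
    then have "step_source s = origin M (step_edge s)"
      using origin_restrict_net[OF N part(1)] m(4) part(2) by simp
    then have "s = (origin M (step_edge s), step_edge s, LinkNode l)"
      using m(2) True by (cases s) simp
    then show ?thesis
      using m(3,5) True unfolding steps_into_def by blast
  next
    case False
    then show ?thesis
      using s m(1,2) switching_restrict_net[OF N part(1), of c] part(2) by auto
  qed
qed

lemma DR_correct_add_link:
  assumes M: "is_net M" "DR_correct M" and l: "addable l M"
    and acyclic: "\<And>c. acyclic_graph (switching M c) \<Longrightarrow>
      acyclic_graph (switching M c \<union> steps_into l M c)"
  shows "DR_correct (add_link l M)"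
  unfolding DR_correct_iff[of "add_link l M"]
proof
  show "DR_acyclic (add_link l M)"
    unfolding DR_acyclic_def
  proof (intro allI impI)
    fix c assume "switching_choice (add_link l M) c"
    then have "acyclic_graph (switching M c)"
      using M(2) unfolding DR_correct_iff[of M] DR_acyclic_def by (auto simp: switching_choice_def)
    then show "acyclic_graph (switching (add_link l M) c)"
      using acyclic acyclic_graph_mono switching_add_link[OF M(1) l] by blast
  qed
  show "\<forall>b\<in>boxes (add_link l M). DR_correct (box_net (add_link l M) b)"
    using M(2) unfolding DR_correct_iff[of M] by (simp add: box_net_def)
qed

lemma DR_correct_add_unary_link:
  assumes M: "is_net M" "DR_correct M" and l: "addable l M"
    and unary: "\<And>e e'. e \<in> prems l \<Longrightarrow> e' \<in> prems l \<Longrightarrow> \<not> switched l \<Longrightarrow> e = e'"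
  shows "DR_correct (add_link l M)"
proof (rule DR_correct_add_link[OF M l])
  fix c assume acyclic: "acyclic_graph (switching M c)"
  have new: "LinkNode l \<notin> nodes M"
    using LinkNode_in_nodes addable_new[OF l] by blast
  show "acyclic_graph (switching M c \<union> steps_into l M c)"
  proof (cases "steps_into l M c = {}")
    case True
    then show ?thesis using acyclic by (simp only: Un_empty_right)
  next
    case False
    then obtain e where e: "e \<in> prems l" "switched l \<longrightarrow> e = c l"
      unfolding steps_into_def by blast
    then have "switching M c \<union> steps_into l M c =
        insert (origin M e, e, LinkNode l) (switching M c)"
      using unary unfolding steps_into_def by blast
    moreover have "origin M e \<in> nodes M"
      using origin_in_nodes[OF M(1)] l e(1) by (auto simp: addable_def conclusions_of_iff)
    moreover have "step_source s \<noteq> LinkNode l \<and> step_target s \<noteq> LinkNode l"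
      if "s \<in> switching M c" for s
      using switching_nodes[OF M(1) that] new by auto
    ultimately show ?thesis
      using acyclic_graph_insert_leaf[OF acyclic, of "LinkNode l" "origin M e" e] new by metis
  qed
qed

lemma conclusions_juxtapose:
  assumes "edges M \<inter> edges N = {}" "e \<in> conclusions M"
  shows "e \<in> conclusions (juxtapose M N)"
proof -
  have "e \<in> edges M" "e \<notin> edges N" using assms by (auto simp: conclusions_of_iff)
  then show ?thesis
    using assms(2) edges_ofI(1)[of _ "links N" e] by (auto simp: conclusions_of_iff edges_of_Un)
qed

lemma acyclic_graph_join:
  assumes G: "acyclic_graph G" "\<And>s. s \<in> G \<Longrightarrow> step_source s \<in> V \<and> step_target s \<in> V"
    and H: "acyclic_graph H" "\<And>s. s \<in> H \<Longrightarrow> step_source s \<notin> V \<and> step_target s \<notin> V"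
    and new: "\<And>s. s \<in> H \<Longrightarrow> step_source s \<noteq> v \<and> step_target s \<noteq> v" "v \<notin> V" "u \<in> V" "u' \<notin> V" "u' \<noteq> v"
  shows "acyclic_graph (insert (u, e, v) (insert (u', e', v) (G \<union> H)))"
proof -
  have "acyclic_graph (insert (u', e', v) H)"
    using new by (intro acyclic_graph_insert_leaf[OF H(1)]) auto
  then have "acyclic_graph (G \<union> insert (u', e', v) H)"
    using H(2) new by (intro acyclic_graph_Un[where V = V, OF G]) auto
  moreover have "\<not> connected_in (G \<union> insert (u', e', v) H) u v"
  proof
    assume "connected_in (G \<union> insert (u', e', v) H) u v"
    then have "u \<in> V \<longleftrightarrow> v \<in> V"
    proof (rule connected_in_invariant)
      fix s assume "s \<in> G \<union> insert (u', e', v) H"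
      then show "step_source s \<in> V \<longleftrightarrow> step_target s \<in> V"
        using G(2)[of s] H(2)[of s] new(2,4) by auto
    qed
    then show False using new(2,3) by blast
  qed
  ultimately show ?thesis
    using acyclic_graph_insert[of "G \<union> insert (u', e', v) H" "(u, e, v)"] by simp
qed

lemma addable_juxtapose:
  assumes disj: "edges M \<inter> edges N = {}" and ab: "a \<in> conclusions M" "b \<in> conclusions N"
    and l: "typed l" "prems l = {a, b}" "concs l \<inter> (edges M \<union> edges N) = {}" "\<not> port_link l"
  shows "addable l (juxtapose M N)"
proof -
  have "b \<in> conclusions (juxtapose N M)"
    using disj by (intro conclusions_juxtapose ab(2)) blast
  then show ?thesis
    using l conclusions_juxtapose[OF disj ab(1)] juxtapose_commute[of M N]
    by (auto simp: addable_def edges_of_Un)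
qed

lemma DR_correct_add_binary_link:
  assumes M: "is_net M" "DR_correct M" and N: "is_net N" "DR_correct N"
    and disj: "edges M \<inter> edges N = {}"
    and ab: "a \<in> conclusions M" "b \<in> conclusions N"
    and l: "addable l (juxtapose M N)" "prems l = {a, b}" "\<not> switched l"
  shows "DR_correct (add_link l (juxtapose M N))"
proof (rule DR_correct_add_link[OF is_net_juxtapose[OF M(1) N(1) disj]
      DR_correct_juxtapose[OF M N disj] l(1)])
  note J = is_net_juxtapose[OF M(1) N(1) disj] and parts = closed_part_juxtapose[OF M(1) N(1) disj]
  have new: "LinkNode l \<notin> nodes M" "LinkNode l \<notin> nodes N"
    using LinkNode_in_nodes[of l M] LinkNode_in_nodes[of l N] addable_new[OF l(1)] by auto
  have nodes: "nodes M \<inter> nodes N = {}"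
    by (rule nodes_disjoint[OF M(1) N(1) links_disjoint[OF disj]])
  have origins: "origin (juxtapose M N) a = origin M a" "origin (juxtapose M N) b = origin N b"
    using origin_restrict_net[OF J parts(1)] origin_restrict_net[OF J parts(3)] ab parts(2,4)
    by (auto simp: conclusions_of_iff)
  have origin_nodes: "origin M a \<in> nodes M" "origin N b \<in> nodes N"
    using origin_in_nodes M(1) N(1) ab by (auto simp: conclusions_of_iff)
  fix c assume "acyclic_graph (switching (juxtapose M N) c)"
  then have acyclic: "acyclic_graph (switching M c)" "acyclic_graph (switching N c)"
    using acyclic_graph_mono unfolding switching_juxtapose[OF M(1) N(1) disj] by blast+
  have "steps_into l (juxtapose M N) c =
      {(origin M a, a, LinkNode l), (origin N b, b, LinkNode l)}"
    using l(2,3) origins by (auto simp: steps_into_def)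
  moreover have "acyclic_graph (insert (origin M a, a, LinkNode l)
      (insert (origin N b, b, LinkNode l) (switching M c \<union> switching N c)))"
  proof (rule acyclic_graph_join[where V = "nodes M", OF acyclic(1) _ acyclic(2)])
    show "step_source s \<in> nodes M \<and> step_target s \<in> nodes M" if "s \<in> switching M c" for s
      by (rule switching_nodes[OF M(1) that])
    show "step_source s \<notin> nodes M \<and> step_target s \<notin> nodes M" if "s \<in> switching N c" for s
      using switching_nodes[OF N(1) that] nodes by blast
    show "step_source s \<noteq> LinkNode l \<and> step_target s \<noteq> LinkNode l" if "s \<in> switching N c" for s
      using switching_nodes[OF N(1) that] new by auto
  qed (use origin_nodes nodes new in auto)
  ultimately show "acyclic_graph (switching (juxtapose M N) c \<union> steps_into l (juxtapose M N) c)"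
    by (simp add: switching_juxtapose[OF M(1) N(1) disj])
qed

subsection \<open>Boxes\<close>

locale box_rule =
  fixes M :: "'a net" and a c E f and b :: "'a box"
  assumes M: "is_net M" and conclusions: "conclusions M = insert a E"
    and principal: "c \<notin> edges M" "typed (OfCourseLink a c)"
    and auxiliary: "inj_on f E" "f ` E \<inter> edges M = {}" "c \<notin> f ` E" "\<forall>e\<in>E. typed (PaxLink e (f e))"
    and box: "b = Box (OfCourseLink a c) ((\<lambda>e. PaxLink e (f e)) ` E) (links M)"
begin

definition boxed :: "'a net" where
  "boxed = Net (ports b \<union> links M) (insert b (boxes M))"

lemma boxed_simps [simp]:
  "links boxed = ports b \<union> links M" "boxes boxed = insert b (boxes M)"
  "content b = links M" "box_links b = ports b \<union> links M"
  by (simp_all add: boxed_def) (simp_all add: box box_links_def)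

lemma ports_eq: "ports b = insert (OfCourseLink a c) ((\<lambda>e. PaxLink e (f e)) ` E)"
  by (simp add: ports_def box)

lemma port_fresh: "l \<in> ports b \<Longrightarrow> concs l \<noteq> {} \<and> concs l \<inter> edges M = {}"
  using principal(1) auxiliary(2) by (auto simp: ports_eq)

lemma ports_new: "ports b \<inter> links M = {}"
  using port_fresh edges_ofI(2) by fastforce

lemma net_graph_boxed: "net_graph (ports b \<union> links M)"
proof (rule net_graph_extend[OF is_netD(1)[OF M]])
  have "finite (conclusions M)"
    using net_graph_finite_edges[OF is_netD(1)[OF M]] by (simp add: conclusions_of_def)
  then show "finite (ports b)"
    by (simp add: ports_eq conclusions)
  show "typed l" if "l \<in> ports b" for l
    using that principal(2) auxiliary(4) by (auto simp: ports_eq)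
  have "a \<notin> E"
    using principal(2) auxiliary(4) by auto
  then show "disjoint_family_on prems (ports b)"
    by (auto simp: disjoint_family_on_def ports_eq)
  show "disjoint_family_on concs (ports b)"
    using auxiliary(3) inj_onD[OF auxiliary(1)] by (auto simp: disjoint_family_on_def ports_eq)
  show "\<Union> (prems ` ports b) \<subseteq> conclusions M \<union> \<Union> (concs ` ports b)"
    by (auto simp: ports_eq conclusions)
  show "\<Union> (concs ` ports b) \<inter> edges M = {}"
    using port_fresh by blast
qed

lemma is_net_boxed: "is_net boxed"
  unfolding is_net_iff boxed_simps
proof (intro conjI ballI impI net_graph_boxed)
  show "delimits_box (ports b \<union> links M) b'" if "b' \<in> insert b (boxes M)" for b'
  proof (cases "b' = b")
    case True
    then show ?thesis
      using ports_new is_netD(1)[OF M]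
      by (auto simp: delimits_box_def conclusions ports_eq) (auto simp: box)
  next
    case False
    then show ?thesis
      using that is_netD(2,3)[OF M, of b'] delimits_box_mono by blast
  qed
  show "\<exists>b'\<in>insert b (boxes M). l \<in> ports b'" if "l \<in> ports b \<union> links M" "port_link l" for l
    using that is_netD(4)[OF M, of l] by blast
  have "nested_or_disjoint b b'" "nested_or_disjoint b' b" if "b' \<in> boxes M" for b'
    using is_netD(3)[OF M that] by (auto simp: nested_or_disjoint_def)
  then show "pairwise nested_or_disjoint (insert b (boxes M))"
    using M by (auto simp: is_net_iff pairwise_insert)
qed

lemma DR_correct_boxed:
  assumes DR: "DR_correct M"
  shows "DR_correct boxed"
  unfolding DR_correct_iff[of boxed]
proof
  have "depth0_links boxed = {}"
    by (auto simp: depth0_links_def)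
  then have "switching boxed s = {}" for s
    using switching_iff[OF is_net_boxed] by (auto simp: depth0_graph_def)
  then show "DR_acyclic boxed"
    by (simp add: DR_acyclic_def)
  have "boxes M = {b' \<in> boxes boxed. box_links b' \<subseteq> links M}"
    using is_netD(3)[OF M] ports_new by (auto simp: ports_def)
  then have M_eq: "restrict_net boxed (links M) = M"
    by (intro net.expand) (simp add: restrict_net_def)
  then have "box_net boxed b = M"
    by (simp add: box_net_eq_restrict_net)
  moreover have "box_net boxed b' = box_net M b'" if "b' \<in> boxes M" for b'
    using box_net_restrict_net[OF is_netD(3)[OF M that], of boxed] M_eq by simp
  ultimately show "\<forall>b'\<in>boxes boxed. DR_correct (box_net boxed b')"
    using DR DR_correct_iff[of M] by auto
qed

end

lemma is_net_empty: "is_net (Net {} {})"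
  by (simp add: is_net_iff net_graph_iff disjoint_family_on_def)

lemma DR_correct_empty: "DR_correct (Net {} {})"
proof -
  have "switching (Net {} {}) c = {}" for c :: "'a link \<Rightarrow> 'a edge"
    using switching_iff[OF is_net_empty] by (auto simp: depth0_graph_def depth0_links_def)
  then show ?thesis
    unfolding DR_correct_iff[of "Net {} {}"] by (simp add: DR_acyclic_def)
qed

definition correct_net :: "'a net \<Rightarrow> bool" where
  "correct_net N \<longleftrightarrow> is_net N \<and> DR_correct N"

lemma correct_net_add_unary_link:
  assumes "correct_net M" "addable l M" "\<And>e e'. e \<in> prems l \<Longrightarrow> e' \<in> prems l \<Longrightarrow> \<not> switched l \<Longrightarrow> e = e'"
  shows "correct_net (add_link l M)"
  using assms is_net_add_link DR_correct_add_unary_link unfolding correct_net_def by blast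

lemma correct_net_add_binary_link:
  assumes "correct_net M" "correct_net N" "edges M \<inter> edges N = {}" "a \<in> conclusions M"
      "b \<in> conclusions N"
    "typed l" "prems l = {a, b}" "concs l \<inter> (edges M \<union> edges N) = {}" "\<not> port_link l" "\<not> switched l"
  shows "correct_net (add_link l (juxtapose M N))"
  using assms addable_juxtapose[of M N a b l] is_net_juxtapose[of M N]
    is_net_add_link[of "juxtapose M N" l]
    DR_correct_add_binary_link[of M N a b l] by (simp add: correct_net_def)

lemma correct_net_single_link:
  assumes "typed l" "prems l = {}" "\<not> port_link l"
  shows "correct_net (Net {l} {})"
proof -
  have "correct_net (add_link l (Net {} {}))"
    using assms by (intro correct_net_add_unary_link)
      (auto simp: correct_net_def is_net_empty DR_correct_empty addable_def edges_of_def)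
  then show ?thesis by (simp add: add_link_def)
qed

theorem sequentializable_imp_correct_net: "sequentializable N \<Longrightarrow> correct_net N"
proof (induction rule: sequentializable.induct)
  case empty
  show ?case by (simp add: correct_net_def is_net_empty DR_correct_empty)
next
  case (ax c d)
  then show ?case by (intro correct_net_single_link) auto
next
  case (one c)
  then show ?case by (intro correct_net_single_link) auto
next
  case (juxtaposition M N)
  then show ?case using is_net_juxtapose DR_correct_juxtapose unfolding correct_net_def by blast
next
  case (cut M N a b)
  then show ?case by (intro correct_net_add_binary_link) auto
next
  case (tensor M N a b c)
  then show ?case by (intro correct_net_add_binary_link) auto
next
  case (bottom N c)
  then show ?case by (intro correct_net_add_unary_link) (auto simp: addable_def)
next
  case (par N a b c)
  then show ?case by (intro correct_net_add_unary_link) (auto simp: addable_def)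
next
  case (why_not N E c)
  then show ?case by (intro correct_net_add_unary_link) (auto simp: addable_def)
next
  case (flat N a c)
  then show ?case by (intro correct_net_add_unary_link) (auto simp: addable_def)
next
  case (para N a c)
  then show ?case by (intro correct_net_add_unary_link) (auto simp: addable_def)
next
  case (box N a E c f p P)
  interpret box_rule N a c E f "Box p P (links N)"
    using box by unfold_locales (auto simp: correct_net_def)
  have "boxed = Net (insert p P \<union> links N) (insert (Box p P (links N)) (boxes N))"
    by (simp add: boxed_def ports_def)
  then show ?case
    using is_net_boxed DR_correct_boxed box.IH by (simp add: correct_net_def)
qed

section \<open>Indexings and balanced cycles\<close>

definition paragraph_weight :: "'a link \<Rightarrow> int" where
  "paragraph_weight l = of_bool (\<exists>a c. l = ParagraphLink a c)"

lemma index_constraint_iff: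
  "index_constraint I l \<longleftrightarrow>
     (\<exists>j. (\<forall>e\<in>concs l. I e = j) \<and> (\<forall>e\<in>prems l. I e = j + paragraph_weight l))"
proof (cases "\<exists>a c. l = ParagraphLink a c")
  case False
  then have "index_constraint I l \<longleftrightarrow> (\<forall>e \<in> prems l \<union> concs l. \<forall>e' \<in> prems l \<union> concs l. I e = I e')"
    by (cases l) auto
  also have "\<dots> \<longleftrightarrow> (\<exists>j. \<forall>e \<in> prems l \<union> concs l. I e = j)"
    by metis
  also have "\<dots> \<longleftrightarrow> (\<exists>j. (\<forall>e\<in>concs l. I e = j) \<and> (\<forall>e\<in>prems l. I e = j))"
    by (intro ex_cong1) blast
  finally show ?thesis
    using False by (simp add: paragraph_weight_def)
qed (auto simp: paragraph_weight_def)

definition paragraph_drop :: "'a link \<times> 'a edge \<times> 'a link \<Rightarrow> int" where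
  "paragraph_drop s = - paragraph_weight (step_target s)"

lemma underlying_graph_iff:
  "s \<in> underlying_graph N \<longleftrightarrow> step_source s \<in> links N \<and> step_target s \<in> links N \<and>
     step_edge s \<in> concs (step_source s) \<and> step_edge s \<in> prems (step_target s)"
  by (cases s) (auto simp: underlying_graph_def)

lemma inj_on_step_edge_underlying_graph:
  assumes "net_graph (links N)"
  shows "inj_on step_edge (underlying_graph N)"
proof (rule inj_onI)
  fix s t assume st: "s \<in> underlying_graph N" "t \<in> underlying_graph N" "step_edge s = step_edge t"
  then have "step_source s = step_source t" "step_target s = step_target t"
    using producer_eq[OF assms, of "step_source s" "step_edge s"]
      producer_eq[OF assms, of "step_source t" "step_edge s"]
      net_graph_prem_unique[OF assms, of "step_target s" "step_target t" "step_edge s"]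
    by (auto simp: underlying_graph_iff)
  then show "s = t"
    using st(3) by (cases s; cases t) simp
qed

lemma finite_underlying_graph:
  assumes "net_graph (links N)"
  shows "finite (underlying_graph N)"
proof (rule inj_on_finite[OF inj_on_step_edge_underlying_graph[OF assms]])
  show "step_edge ` underlying_graph N \<subseteq> edges N"
    using edges_ofI(1) by (intro image_subsetI) (auto simp: underlying_graph_iff)
  show "finite (edges N)" by (rule net_graph_finite_edges[OF assms])
qed

lemma indexable_iff_potential:
  assumes N: "net_graph (links N)"
  shows "(\<exists>I. indexing N I) \<longleftrightarrow> (\<exists>J. potential (underlying_graph N) paragraph_drop J)"
proof
  assume "\<exists>I. indexing N I"
  then obtain I
    where "\<forall>l\<in>links N. \<exists>j. (\<forall>e\<in>concs l. I e = j) \<and> (\<forall>e\<in>prems l. I e = j + paragraph_weight l)"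
    unfolding indexing_def index_constraint_iff by blast
  from bchoice[OF this] obtain J
    where J: "\<forall>l\<in>links N. (\<forall>e\<in>concs l. I e = J l) \<and> (\<forall>e\<in>prems l. I e = J l + paragraph_weight l)" ..
  have "J (step_target s) - J (step_source s) = paragraph_drop s" if "s \<in> underlying_graph N" for s
  proof -
    have "I (step_edge s) = J (step_source s)"
      "I (step_edge s) = J (step_target s) + paragraph_weight (step_target s)"
      using J that by (simp_all add: underlying_graph_iff)
    then show ?thesis by (simp add: paragraph_drop_def)
  qed
  then show "\<exists>J. potential (underlying_graph N) paragraph_drop J"
    unfolding potential_def by blast
next
  assume "\<exists>J. potential (underlying_graph N) paragraph_drop J"
  then obtain J where J: "\<And>s. s \<in> underlying_graph N \<Longrightarrow>
      J (step_target s) - J (step_source s) = paragraph_drop s"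
    unfolding potential_def by blast
  have prems: "J (producer (links N) e) = J l + paragraph_weight l"
    if l: "l \<in> links N" "e \<in> prems l" for l e
    using J[of "(producer (links N) e, e, l)"] producer_in[OF N edges_ofI(1)[OF l]] l
    by (simp add: underlying_graph_iff paragraph_drop_def)
  have "indexing N (\<lambda>e. J (producer (links N) e))"
    unfolding indexing_def index_constraint_iff
  proof
    fix l assume l: "l \<in> links N"
    show "\<exists>j. (\<forall>e\<in>concs l. J (producer (links N) e) = j) \<and>
        (\<forall>e\<in>prems l. J (producer (links N) e) = j + paragraph_weight l)"
      using prems[OF l] producer_eq[OF N l] by (intro exI[of _ "J l"]) simp
  qed
  then show "\<exists>I. indexing N I" by blast
qed

lemma sum_cyclic_shift:
  fixes f :: "nat \<Rightarrow> 'a::comm_monoid_add"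
  shows "(\<Sum>i<n. f (Suc i mod n)) = (\<Sum>i<n. f i)"
proof (cases n)
  case (Suc m)
  have "(\<Sum>i<Suc m. f (Suc i mod Suc m)) = (\<Sum>i<m. f (Suc i)) + f 0"
    by simp
  also have "\<dots> = (\<Sum>i<Suc m. f i)"
    by (subst sum.lessThan_Suc_shift) (simp add: add.commute)
  finally show ?thesis using Suc by simp
qed simp

definition entering_weight :: "'a net \<Rightarrow> 'a link \<times> 'a edge \<times> 'a link \<Rightarrow> int" where
  "entering_weight N s = of_bool (s \<in> underlying_graph N) * paragraph_weight (step_target s)"

definition leaving_weight :: "'a net \<Rightarrow> 'a link \<times> 'a edge \<times> 'a link \<Rightarrow> int" where
  "leaving_weight N s = of_bool (s \<notin> underlying_graph N) * paragraph_weight (step_source s)"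

lemma signed_weight_paragraph_drop:
  "signed_weight (underlying_graph N) paragraph_drop s = leaving_weight N s - entering_weight N s"
  by (simp add: signed_weight_def paragraph_drop_def entering_weight_def leaving_weight_def)

lemma paragraph_traversal_weight:
  assumes N: "net_graph (links N)"
    and st: "s \<in> sym_steps (underlying_graph N)" "t \<in> sym_steps (underlying_graph N)"
    and "linked s t"
  shows "leaving_weight N t - entering_weight N s =
    of_bool (step_target s = ParagraphLink (step_edge t) (step_edge s)) -
    of_bool (step_target s = ParagraphLink (step_edge s) (step_edge t))"
proof (cases "\<exists>a c. step_target s = ParagraphLink a c")
  case True
  then obtain a c where ac: "step_target s = ParagraphLink a c" by blast
  have "step_target s \<in> links N"
    using st(1) by (auto simp: in_sym_steps underlying_graph_iff)
  then have "a \<noteq> c"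
    using net_graph_typed[OF N] ac by fastforce
  moreover have "step_edge s = (if s \<in> underlying_graph N then a else c)"
    using st(1) ac by (auto simp: in_sym_steps underlying_graph_iff)
  moreover have "step_edge t = (if t \<in> underlying_graph N then c else a)"
    using st(2) ac \<open>linked s t\<close> by (auto simp: in_sym_steps underlying_graph_iff)
  ultimately show ?thesis
    using ac \<open>linked s t\<close>
    by (auto simp: entering_weight_def leaving_weight_def paragraph_weight_def)
next
  case False
  then show ?thesis
    using \<open>linked s t\<close> by (auto simp: entering_weight_def leaving_weight_def paragraph_weight_def)
qed

lemma sum_paragraph_drop_cycle:
  assumes N: "net_graph (links N)" and p: "cycle (underlying_graph N) p"
  shows "(\<Sum>s\<leftarrow>p. signed_weight (underlying_graph N) paragraph_drop s) =
    int (card (upward_traversals p)) - int (card (downward_traversals p))"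
proof -
  let ?n = "length p"
  have "(\<Sum>s\<leftarrow>p. signed_weight (underlying_graph N) paragraph_drop s) =
      (\<Sum>i<?n. leaving_weight N (p ! i) - entering_weight N (p ! i))"
    by (simp add: sum_list_sum_nth atLeast0LessThan signed_weight_paragraph_drop)
  also have "\<dots> = (\<Sum>i<?n. leaving_weight N (p ! (Suc i mod ?n)) - entering_weight N (p ! i))"
    using sum_cyclic_shift[of "\<lambda>i. leaving_weight N (p ! i)" ?n] by (simp add: sum_subtractf)
  also have "\<dots> = (\<Sum>i<?n. of_bool (i \<in> upward_traversals p) - of_bool (i \<in> downward_traversals p))"
  proof (rule sum.cong[OF refl])
    fix i assume "i \<in> {..<?n}"
    then have i: "i < ?n" by simp
    then have "Suc i mod ?n < ?n" by (intro mod_less_divisor) linarith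
    have "p ! j \<in> sym_steps (underlying_graph N)" if "j < ?n" for j
      using p nth_mem[OF that] by (auto simp: cycle_iff_simple_circuit simple_circuit_def)
    moreover have "linked (p ! i) (p ! (Suc i mod ?n))"
      using p i(1) by (simp add: cycle_def)
    ultimately show "leaving_weight N (p ! (Suc i mod ?n)) - entering_weight N (p ! i) =
        of_bool (i \<in> upward_traversals p) - of_bool (i \<in> downward_traversals p)"
      using paragraph_traversal_weight[OF N, of "p ! i" "p ! (Suc i mod ?n)"] i \<open>Suc i mod ?n < ?n\<close>
      by (simp add: upward_traversals_def downward_traversals_def)
  qed
  also have "\<dots> = int (card (upward_traversals p)) - int (card (downward_traversals p))"
  proof -
    have "{..<?n} \<inter> {i. i \<in> upward_traversals p} = upward_traversals p"
      "{..<?n} \<inter> {i. i \<in> downward_traversals p} = downward_traversals p"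
      by (auto simp: upward_traversals_def downward_traversals_def)
    then show ?thesis by (simp add: sum_subtractf sum_of_bool_eq)
  qed
  finally show ?thesis .
qed

theorem indexable_iff_balanced:
  assumes N: "net_graph (links N)"
  shows "(\<exists>I. indexing N I) \<longleftrightarrow> (\<forall>p. cycle (underlying_graph N) p \<longrightarrow> balanced p)"
  unfolding indexable_iff_potential[OF N]
    potential_exists_iff[OF finite_underlying_graph[OF N] inj_on_step_edge_underlying_graph[OF N]]
  by (auto simp: sum_paragraph_drop_cycle[OF N] balanced_def)

subsection \<open>The par closure\<close>

lemma conclusions_add_link:
  assumes "prems l \<subseteq> conclusions N" "concs l \<inter> edges N = {}"
  shows "conclusions (add_link l N) = concs l \<union> (conclusions N - prems l)"
proof (rule set_eqI)
  fix e
  have "e \<notin> edges N" if "e \<in> concs l" using assms(2) that by blast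
  moreover have "e \<in> edges N" if "e \<in> prems l"
    using assms(1) that by (auto simp: conclusions_of_iff)
  ultimately show "e \<in> conclusions (add_link l N) \<longleftrightarrow> e \<in> concs l \<union> (conclusions N - prems l)"
    using edges_ofI(1)[of _ "links N" e] by (auto simp: conclusions_of_iff edges_of_insert)
qed

lemma index_constraint_cong:
  "(\<And>e. e \<in> prems l \<union> concs l \<Longrightarrow> I e = J e) \<Longrightarrow> index_constraint I l \<longleftrightarrow> index_constraint J l"
  unfolding index_constraint_iff by auto

lemma conclusions_add_par:
  assumes "a \<in> conclusions N" "b \<in> conclusions N" "c \<notin> edges N"
  shows "conclusions (add_link (ParLink a b c) N) = insert c (conclusions N - {a, b})"
  using conclusions_add_link[of "ParLink a b c" N] assms by simp

lemma strong_indexing_conclusions: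
  "strong_indexing N I \<Longrightarrow> e \<in> conclusions N \<Longrightarrow> e' \<in> conclusions N \<Longrightarrow> I e = I e'"
  unfolding strong_indexing_def by (meson bspec)

lemma strong_indexing_remove_par:
  assumes abc: "a \<in> conclusions N" "b \<in> conclusions N" "c \<notin> edges N"
    and I: "strong_indexing (add_link (ParLink a b c) N) I"
  shows "strong_indexing N I"
proof -
  let ?M = "add_link (ParLink a b c) N"
  have "indexing N I" and "index_constraint I (ParLink a b c)"
    using I unfolding strong_indexing_def indexing_def add_link_simps(1) by blast+
  then have ab_eq: "I a = I c" "I b = I c"
    unfolding index_constraint.simps prems.simps concs.simps by blast+
  have equal: "I e = I c" if "e \<in> insert c (conclusions N - {a, b})" for e
  proof -
    have "e \<in> conclusions ?M" "c \<in> conclusions ?M"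
      using that unfolding conclusions_add_par[OF abc] by auto
    then show ?thesis by (rule strong_indexing_conclusions[OF I])
  qed
  have "I e = I c" if "e \<in> conclusions N" for e
  proof (cases "e \<in> {a, b}")
    case True
    then show ?thesis using ab_eq by auto
  next
    case False
    then show ?thesis using that by (intro equal) simp
  qed
  then show ?thesis
    using \<open>indexing N I\<close> unfolding strong_indexing_def by simp
qed

lemma strong_indexing_add_par:
  assumes abc: "a \<in> conclusions N" "b \<in> conclusions N" "c \<notin> edges N"
    and I: "strong_indexing N I"
  shows "strong_indexing (add_link (ParLink a b c) N) (I(c := I a))"
proof -
  let ?I = "I(c := I a)" and ?M = "add_link (ParLink a b c) N"
  have equal: "I e = I a" if "e \<in> conclusions N" for e
    by (rule strong_indexing_conclusions[OF I that abc(1)])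
  have "index_constraint ?I l" if l: "l \<in> links N" for l
  proof -
    have "?I e = I e" if "e \<in> prems l \<union> concs l" for e
      using that l abc(3) edges_ofI[of l "links N" e] by auto
    then have "index_constraint ?I l \<longleftrightarrow> index_constraint I l"
      by (rule index_constraint_cong)
    then show ?thesis
      using I l by (simp add: strong_indexing_def indexing_def)
  qed
  moreover have "index_constraint ?I (ParLink a b c)"
    using equal[OF abc(2)] by simp
  moreover have "?I e = I a" if "e \<in> insert c (conclusions N - {a, b})" for e
    using that equal by auto
  then have "\<forall>e\<in>conclusions ?M. \<forall>e'\<in>conclusions ?M. ?I e = ?I e'"
    unfolding conclusions_add_par[OF abc] by simp
  ultimately show ?thesis
    unfolding strong_indexing_def indexing_def add_link_simps(1) by blast
qed

lemma strongly_indexable_par_closure: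
  "par_closure N C \<Longrightarrow> strongly_indexable N \<longleftrightarrow> (\<exists>I. indexing C I)"
proof (induction rule: par_closure.induct)
  case (closed N)
  then have "strong_indexing N I \<longleftrightarrow> indexing N I" for I
    unfolding strong_indexing_def by metis
  then show ?case
    by (simp add: strongly_indexable_def)
next
  case (step a N b c C)
  then have "strongly_indexable N \<longleftrightarrow> strongly_indexable (add_link (ParLink a b c) N)"
    unfolding strongly_indexable_def
    using strong_indexing_remove_par[OF step.hyps(1-3)] strong_indexing_add_par[OF step.hyps(1-3)]
    by blast
  then show ?case
    using step.IH by simp
qed

lemma net_graph_par_closure:
  "par_closure N C \<Longrightarrow> net_graph (links N) \<Longrightarrow> net_graph (links C)"
proof (induction rule: par_closure.induct)
  case (step a N b c C)
  then show ?case
    using net_graph_insert[of "links N" "ParLink a b c"] by simp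
qed

lemma fresh_edge_exists:
  assumes "finite E"
  obtains c where "c \<notin> E" "label c = A"
proof -
  obtain n where "n \<notin> edge_id ` E"
    using ex_new_if_finite[OF infinite_UNIV_nat finite_imageI[OF assms]] by blast
  then show thesis
    using that[of "Edge n A"] by force
qed

lemma par_closure_exists:
  assumes "net_graph (links N)" "flat_free_conclusions N"
  shows "\<exists>C. par_closure N C"
  using assms
proof (induction "card (conclusions N)" arbitrary: N rule: less_induct)
  case less
  show ?case
  proof (cases "\<forall>e\<in>conclusions N. \<forall>e'\<in>conclusions N. e = e'")
    case True
    then show ?thesis using par_closure.closed by blast
  next
    case False
    then obtain a b where ab: "a \<in> conclusions N" "b \<in> conclusions N" "a \<noteq> b" by blast
    obtain A B where AB: "label a = Formula A" "label b = Formula B"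
      using less.prems(2) ab unfolding flat_free_conclusions_def by blast
    have finite: "finite (edges N)"
      by (rule net_graph_finite_edges[OF less.prems(1)])
    then obtain c where c: "c \<notin> edges N" "label c = Formula (Par A B)"
      by (rule fresh_edge_exists)
    let ?l = "ParLink a b c"
    have typed: "typed ?l" using AB ab(3) c(2) by simp
    note conclusions = conclusions_add_par[OF ab(1,2) c(1)]
    have "finite (conclusions N)" "c \<notin> conclusions N"
      using finite c(1) by (auto simp: conclusions_of_def)
    then have "card (conclusions (add_link ?l N)) < card (conclusions N)"
      unfolding conclusions using ab card_mono[of "conclusions N" "{a, b}"]
      by (simp add: card_Diff_subset)
    moreover have "net_graph (links (add_link ?l N))"
      using net_graph_insert[OF less.prems(1) typed] ab c(1) by simp
    moreover have "flat_free_conclusions (add_link ?l N)"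
      using less.prems(2) c(2) unfolding flat_free_conclusions_def conclusions by auto
    ultimately obtain C where "par_closure (add_link ?l N) C"
      using less.hyps by blast
    then show ?thesis
      using par_closure.step[OF ab(1,2) c(1) typed] by blast
  qed
qed

theorem strongly_indexable_iff_balanced_closure:
  assumes N: "net_graph (links N)" "flat_free_conclusions N"
  shows "strongly_indexable N \<longleftrightarrow>
    (\<exists>C. par_closure N C \<and> (\<forall>p. cycle (underlying_graph C) p \<longrightarrow> balanced p))"
proof -
  have "strongly_indexable N \<longleftrightarrow> (\<forall>p. cycle (underlying_graph C) p \<longrightarrow> balanced p)"
    if C: "par_closure N C" for C
    unfolding strongly_indexable_par_closure[OF C]
    by (rule indexable_iff_balanced[OF net_graph_par_closure[OF C N(1)]])
  then show ?thesis
    using par_closure_exists[OF N] by blast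
qed

theorem mainTheorem11:
  fixes N :: "'a net"
  assumes "is_net N" and "flat_free_conclusions N"
  shows "(strongly_indexable N \<and> sequentializable N) \<longleftrightarrow> proof_net N"
proof -
  have "sequentializable N \<longleftrightarrow> DR_correct N"
    using DR_correct_imp_sequentializable[OF assms(1)] sequentializable_imp_correct_net
    unfolding correct_net_def by blast
  moreover have "strongly_indexable N \<longleftrightarrow>
      (\<exists>C. par_closure N C \<and> (\<forall>p. cycle (underlying_graph C) p \<longrightarrow> balanced p))"
    by (rule strongly_indexable_iff_balanced_closure[OF is_netD(1)[OF assms(1)] assms(2)])
  ultimately show ?thesis
    using assms unfolding proof_net_def DR_net_def by blast
qed

end
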